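(* Assume that pseudorandom function families exist. Then no polynomial-time algorithm decides $MC_C$ (given an XOR-AND circuit $C$ with $n$ inputs and $m$ gates, where $m$ is polynomial in $n$, and a target $s\in\mathbb{N}$, decide whether $c_\wedge(f_C)\le s$). Furthermore, for every constant $\epsilon>0$, no algorithm with running time $\mathrm{poly}(m)2^{O(n)}$ that takes such a circuit $C$ as input approximates $c_\wedge(f_C)$ within a factor of $(2-\epsilon)^{n/2}$, i.e. always outputs a value in $[c_\wedge(f_C),(2-\epsilon)^{n/2}c_\wedge(f_C)]$.
   Context: An XOR-AND circuit is a Boolean circuit with fan-in 2 over the basis $(\land,\oplus,1)$ (arithmetic over $\mathbb{F}_2$); $f_C$ is the function computed by $C$; the size of $C$ is its number of gates. The multiplicative complexity $c_\wedge(f)$ of a Boolean function $f$ is the smallest number of AND gates in an XOR-AND circuit computing $f$. $B_n$ is the set of functions $\mathbb{F}_2^n\to\mathbb{F}_2$. A family $\{f_n\}_{n\in\mathbb{N}}$ with $f_n:\{0,1\}^n\times\{0,1\}^n\to\{0,1\}$ is a pseudorandom function family if $f$ is computable in polynomial time and for every probabilistic polynomial-time oracle Turing machine $A$, $\left|\Pr_{k\in_R\{0,1\}^n}[A^{f_n(k,\cdot)}(1^n)=1]-\Pr_{g\in_R B_n}[A^{g}(1^n)=1]\right|\le n^{-\omega(1)}$, where $\in_R$ means chosen uniformly at random and $A^H$ means $A$ has oracle access to $H$.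
   Formalization: In the approximation part, m is not required to be polynomial in n: with m at most a fixed polynomial the claim fails for 0<ε<1 (output 0 if f_C is affine, otherwise m). Also ε is taken at most 2, so that (2-ε)^{n/2} is defined. *)

theory Defs
  imports "HOL-Probability.Probability"
begin

section \<open>XOR-AND circuits and multiplicative complexity\<close>

text \<open>
  The field with two elements is represented by \<^typ>\<open>bool\<close>.  In a circuit with \<open>n\<close> inputs, the
  nodes \<open>0, \<dots>, n - 1\<close> are the inputs and node \<open>n + i\<close> is the \<open>i\<close>-th gate.
\<close>

datatype gate = One | And nat nat | Xor nat nat

record circuit =
  inputs :: nat
  gates :: "gate list"
  out :: nat

fun gate_args :: "gate \<Rightarrow> nat set" where
  "gate_args One = {}"
| "gate_args (And i j) = {i, j}"
| "gate_args (Xor i j) = {i, j}"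

definition wf_circuit :: "circuit \<Rightarrow> bool" where
  "wf_circuit C \<longleftrightarrow>
     (\<forall>i < length (gates C). \<forall>j \<in> gate_args (gates C ! i). j < inputs C + i) \<and>
     out C < inputs C + length (gates C)"

definition num_gates :: "circuit \<Rightarrow> nat" where
  "num_gates C = length (gates C)"

definition num_ands :: "circuit \<Rightarrow> nat" where
  "num_ands C = length (filter (\<lambda>g. \<exists>i j. g = And i j) (gates C))"

fun gate_val :: "bool list \<Rightarrow> gate \<Rightarrow> bool" where
  "gate_val vs One = True"
| "gate_val vs (And i j) = (vs ! i \<and> vs ! j)"
| "gate_val vs (Xor i j) = (vs ! i \<noteq> vs ! j)"

definition circuit_fun :: "circuit \<Rightarrow> bool list \<Rightarrow> bool" where
  "circuit_fun C x = foldl (\<lambda>vs g. vs @ [gate_val vs g]) x (gates C) ! out C"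

definition computes :: "circuit \<Rightarrow> nat \<Rightarrow> (bool list \<Rightarrow> bool) \<Rightarrow> bool" where
  "computes C n f \<longleftrightarrow> wf_circuit C \<and> inputs C = n \<and> (\<forall>x. length x = n \<longrightarrow> circuit_fun C x = f x)"

definition mult_complexity :: "nat \<Rightarrow> (bool list \<Rightarrow> bool) \<Rightarrow> nat" where
  "mult_complexity n f = (LEAST k. \<exists>C. computes C n f \<and> num_ands C = k)"

section \<open>Turing machines\<close>

text \<open>
  Multi-tape machines with two-way infinite tapes, a coin toss in every step, and access to oracles.
  Symbol \<open>0\<close> is the blank, \<open>1\<close> and \<open>2\<close> stand for the bits 0 and 1, further symbols are auxiliary.
  Tape \<open>0\<close> holds the input and, on halting, the output; tape \<open>1\<close> holds the queries.
  The transition function only matters on the finite set of arguments considered in \<open>wf_tm\<close>.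
\<close>

record tm =
  ntapes :: nat
  nsyms :: nat
  nstates :: nat
  delta :: "nat \<Rightarrow> nat list \<Rightarrow> bool \<Rightarrow> nat \<times> (nat \<times> int) list"

type_synonym tape = "(int \<Rightarrow> nat) \<times> int"
type_synonym config = "nat \<times> tape list"

abbreviation (input) start_state :: nat where "start_state \<equiv> 0"
abbreviation (input) halt_state :: nat where "halt_state \<equiv> 1"
abbreviation (input) query_state :: nat where "query_state \<equiv> 2"
abbreviation (input) yes_state :: nat where "yes_state \<equiv> 3"
abbreviation (input) no_state :: nat where "no_state \<equiv> 4"

definition wf_tm :: "tm \<Rightarrow> bool" where
  "wf_tm M \<longleftrightarrow> ntapes M \<ge> 2 \<and> nsyms M \<ge> 3 \<and> nstates M \<ge> 5 \<and>
     (\<forall>q < nstates M. \<forall>rs b. length rs = ntapes M \<longrightarrow> set rs \<subseteq> {..<nsyms M} \<longrightarrow>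
        fst (delta M q rs b) < nstates M \<and>
        length (snd (delta M q rs b)) = ntapes M \<and>
        set (snd (delta M q rs b)) \<subseteq> {..<nsyms M} \<times> {-1, 0, 1})"

text \<open>Ordinary deterministic machines: coins are ignored and no query is ever made.\<close>

definition deterministic_tm :: "tm \<Rightarrow> bool" where
  "deterministic_tm M \<longleftrightarrow> wf_tm M \<and>
     (\<forall>q < nstates M. \<forall>rs. length rs = ntapes M \<longrightarrow> set rs \<subseteq> {..<nsyms M} \<longrightarrow>
        delta M q rs True = delta M q rs False \<and>
        fst (delta M q rs False) \<noteq> query_state)"

definition act :: "nat \<times> int \<Rightarrow> tape \<Rightarrow> tape" where
  "act a tp = ((fst tp)(snd tp := fst a), snd tp + snd a)"

text \<open>The bit string written on a tape from cell \<open>0\<close> up to the first symbol that is not a bit.\<close>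

definition tape_bits :: "tape \<Rightarrow> bool list" where
  "tape_bits tp = map (\<lambda>i. fst tp (int i) = 2) [0..<(LEAST i. fst tp (int i) \<notin> {1, 2})]"

definition bits_tape :: "bool list \<Rightarrow> tape" where
  "bits_tape w =
     (\<lambda>i. if 0 \<le> i \<and> i < int (length w) then (if w ! nat i then 2 else 1) else 0, 0)"

definition init_config :: "tm \<Rightarrow> bool list \<Rightarrow> config" where
  "init_config M w = (start_state, bits_tape w # replicate (ntapes M - 1) (bits_tape []))"

definition step :: "tm \<Rightarrow> (bool list \<Rightarrow> bool) \<Rightarrow> config \<Rightarrow> bool \<Rightarrow> config" where
  "step M Q c b = (case c of (q, tps) \<Rightarrow>
     if q = halt_state then c
     else if q = query_state then (if Q (tape_bits (tps ! 1)) then yes_state else no_state, tps)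
     else let (q', as) = delta M q (map (\<lambda>tp. fst tp (snd tp)) tps) b
          in (q', map2 act as tps))"

text \<open>The length of the coin sequence is the number of steps performed.\<close>

definition run :: "tm \<Rightarrow> (bool list \<Rightarrow> bool) \<Rightarrow> bool list \<Rightarrow> bool list \<Rightarrow> config" where
  "run M Q w coins = foldl (step M Q) (init_config M w) coins"

definition halted :: "config \<Rightarrow> bool" where
  "halted c \<longleftrightarrow> fst c = halt_state"

definition tm_output :: "config \<Rightarrow> bool list" where
  "tm_output c = tape_bits (snd c ! 0)"

definition outputs_within :: "tm \<Rightarrow> bool list \<Rightarrow> nat \<Rightarrow> bool list \<Rightarrow> bool" where
  "outputs_within M w t v \<longleftrightarrow>
     (let c = run M (\<lambda>_. False) w (replicate t False) in halted c \<and> tm_output c = v)"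

section \<open>Pseudorandom function families\<close>

definition bit_strings :: "nat \<Rightarrow> bool list set" where
  "bit_strings n = {x. length x = n}"

definition boolean_functions :: "nat \<Rightarrow> (bool list \<Rightarrow> bool) set" where
  "boolean_functions n = bit_strings n \<rightarrow>\<^sub>E UNIV"

text \<open>Queries of a length other than \<open>n\<close> are answered by 0.\<close>

definition oracle_fun :: "nat \<Rightarrow> (bool list \<Rightarrow> bool) \<Rightarrow> bool list \<Rightarrow> bool" where
  "oracle_fun n g w \<longleftrightarrow> length w = n \<and> g w"

abbreviation unary_input :: "nat \<Rightarrow> bool list" where
  "unary_input n \<equiv> replicate n True"

definition oracle_time_bound :: "tm \<Rightarrow> (nat \<Rightarrow> nat) \<Rightarrow> bool" where
  "oracle_time_bound M T \<longleftrightarrow>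
     (\<forall>n g coins. length coins = T n \<longrightarrow> halted (run M (oracle_fun n g) (unary_input n) coins))"

text \<open>
  The probability that a machine halting within \<open>t\<close> steps outputs 1 when the function that answers its queries is drawn
  from \<open>G\<close>; \<open>t\<close> coins suffice.
\<close>

definition accept_prob :: "tm \<Rightarrow> nat \<Rightarrow> nat \<Rightarrow> (bool list \<Rightarrow> bool) pmf \<Rightarrow> real" where
  "accept_prob M t n G =
     measure_pmf.prob (pair_pmf G (pmf_of_set (bit_strings t)))
       {(g, coins). tm_output (run M (oracle_fun n g) (unary_input n) coins) = [True]}"

definition advantage ::
    "tm \<Rightarrow> nat \<Rightarrow> (nat \<Rightarrow> bool list \<Rightarrow> bool list \<Rightarrow> bool) \<Rightarrow> nat \<Rightarrow> real" where
  "advantage M t f n =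
     \<bar>accept_prob M t n (map_pmf (f n) (pmf_of_set (bit_strings n)))
      - accept_prob M t n (pmf_of_set (boolean_functions n))\<bar>"

text \<open>Bounded by \<open>n\<close> to the power of \<open>-\<omega>(1)\<close>.\<close>

definition negligible :: "(nat \<Rightarrow> real) \<Rightarrow> bool" where
  "negligible \<mu> \<longleftrightarrow>
     (\<exists>h :: nat \<Rightarrow> real. filterlim h at_top sequentially \<and>
        (\<forall>\<^sub>F n in sequentially. \<mu> n \<le> real n powr (- h n)))"

definition poly_time_family :: "(nat \<Rightarrow> bool list \<Rightarrow> bool list \<Rightarrow> bool) \<Rightarrow> bool" where
  "poly_time_family f \<longleftrightarrow>
     (\<exists>M c. deterministic_tm M \<and>
        (\<forall>n. \<forall>k \<in> bit_strings n. \<forall>x \<in> bit_strings n.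
           outputs_within M (k @ x) (c * n ^ c + c) [f n k x]))"

definition pseudorandom_family :: "(nat \<Rightarrow> bool list \<Rightarrow> bool list \<Rightarrow> bool) \<Rightarrow> bool" where
  "pseudorandom_family f \<longleftrightarrow> poly_time_family f \<and>
     (\<forall>A c. wf_tm A \<longrightarrow> oracle_time_bound A (\<lambda>n. c * n ^ c + c) \<longrightarrow>
        negligible (\<lambda>n. advantage A (c * n ^ c + c) f n))"

section \<open>Computing the multiplicative complexity of a circuit\<close>

text \<open>
  Circuits are encoded self-delimitingly with all numbers in unary, so that the length of an
  encoding is at least the number of inputs plus the number of gates and polynomial in it.
\<close>

definition enc_nat :: "nat \<Rightarrow> bool list" where
  "enc_nat a = replicate a True @ [False]"

fun enc_gate :: "gate \<Rightarrow> bool list" where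
  "enc_gate One = [False, False]"
| "enc_gate (And i j) = [True, False] @ enc_nat i @ enc_nat j"
| "enc_gate (Xor i j) = [True, True] @ enc_nat i @ enc_nat j"

definition enc_circuit :: "circuit \<Rightarrow> bool list" where
  "enc_circuit C =
     enc_nat (inputs C) @ enc_nat (num_gates C) @ concat (map enc_gate (gates C)) @ enc_nat (out C)"

text \<open>Binary numerals, least significant bit first, inverted by \<^term>\<open>horner_sum of_bool (2::nat)\<close>.\<close>

fun enc_binary :: "nat \<Rightarrow> bool list" where
  "enc_binary s = (if s = 0 then [] else odd s # enc_binary (s div 2))"

declare enc_binary.simps [simp del]

text \<open>
  \<open>decides_MC k M\<close>: in time polynomial in the length of its input, \<open>M\<close> decides the problem for
  circuits whose number of gates is at most \<open>n ^ k + k\<close>; nothing is required on other inputs.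
\<close>

definition decides_MC :: "nat \<Rightarrow> tm \<Rightarrow> bool" where
  "decides_MC k M \<longleftrightarrow> deterministic_tm M \<and>
     (\<exists>c. \<forall>C s. wf_circuit C \<longrightarrow> num_gates C \<le> inputs C ^ k + k \<longrightarrow>
        (let w = enc_circuit C @ enc_binary s
         in outputs_within M w (c * length w ^ c + c)
              [mult_complexity (inputs C) (circuit_fun C) \<le> s]))"

text \<open>
  The number of gates is not bounded here: for circuits with polynomially many gates the number
  of gates itself is, for all large \<open>n\<close>, within any exponential factor of a nonzero
  multiplicative complexity.  The time bound is an arbitrary polynomial in the number of gates
  times \<open>2 ^ O(n)\<close>.
\<close>

definition approximates_MC :: "real \<Rightarrow> tm \<Rightarrow> bool" where
  "approximates_MC \<epsilon> M \<longleftrightarrow> deterministic_tm M \<and>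
     (\<exists>c. \<forall>C. wf_circuit C \<longrightarrow>
        (let n = inputs C; m = num_gates C; mc = mult_complexity n (circuit_fun C)
         in \<exists>v. outputs_within M (enc_circuit C) ((c * m ^ c + c) * 2 ^ (c * n)) v \<and>
              real (horner_sum of_bool 2 v) \<in> {real mc .. (2 - \<epsilon>) powr (real n / 2) * real mc}))"

end

theory Submission imports Defs begin

text \<open>
  Suppose a machine \<open>M\<close> decides or approximates the multiplicative complexity of circuits.  To test a
  function \<open>g\<close> on \<open>n\<close> bits, restrict it to the \<open>2 ^ l\<close> points whose last \<open>n - l\<close> bits are 0, where
  \<open>l = a * bit_len n\<close> is a large constant multiple of \<open>log n\<close>.  Querying \<open>g\<close> at these points takes
  polynomial time and yields a circuit of polynomial size for the restriction, on which \<open>M\<close> is run;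
  since \<open>2 ^ O(l)\<close> is polynomial in \<open>n\<close>, this remains feasible for the slower approximation algorithm.
  (For the decision problem, unused inputs are added until there are as many inputs as gates.)

  If \<open>g\<close> comes from a pseudorandom family, simulating its Turing machine by a circuit shows that the
  restriction has multiplicative complexity polynomial in \<open>n\<close>, say at most \<open>2 ^ (2 e log n)\<close>, which
  for large \<open>a\<close> is below \<open>2 ^ (l / 2 - log n)\<close> even after multiplication by \<open>(2 - \<epsilon>) ^ (l / 2)\<close>.
  For random \<open>g\<close> the restriction is a random function on \<open>l\<close> bits; a function computable with \<open>s\<close>
  conjunctions is determined by \<open>O(s ^ 2 + l s)\<close> bits, so with \<open>s = 2 ^ (l / 2 - log n)\<close> at most half
  of all functions have complexity \<open>\<le> s\<close>.  Comparing the answer of \<open>M\<close> with \<open>s\<close> therefore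
  distinguishes the family from random functions with constant advantage.
\<close>

section \<open>Functions computable with few conjunctions\<close>


text \<open>The distinguisher has to be a machine of the given model, whose query state stores no
  return address. So the enumeration of the points is a program that stops at each query and is
  resumed by one of two fixed programs, one per answer, with its whole state kept on tapes. All
  thresholds are powers of two: in binary such a number is a block of zeros and a one, and an output
  lies below it iff it has no one from a certain position on. With L = \<open>bit_len n\<close>, s =
  2^(b L) and l = 2 (b + 1) L we have s^2 = 2^(l - 2 L), which leaves room for the lower-order terms
  of the counting exponent. A polynomial (n + 2)^e is at most 2^(2 e L). Hence b = 2 e + 1 serves
  for the decision problem; for the approximation, with \<beta> = 2 - \<epsilon>, the condition is
  \<beta>^(b + 1) 4^e < 2^b, true for large b since \<beta> < 2. It is essential that e depends
  neither on a nor on the number of inputs, because b and a are chosen after it. The circuit that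
  simulates the family's machine only serves to bound the complexity; the distinguisher never builds
  it.\<close>

inductive_set affine_span :: "('x \<Rightarrow> bool) set \<Rightarrow> ('x \<Rightarrow> bool) set" for B where
  base: "f \<in> B \<Longrightarrow> f \<in> affine_span B"
| one: "(\<lambda>_. True) \<in> affine_span B"
| xor: "f \<in> affine_span B \<Longrightarrow> g \<in> affine_span B \<Longrightarrow> (\<lambda>x. f x \<noteq> g x) \<in> affine_span B"

text \<open>This is a circuit stripped of its XOR gates: each of the \<open>k\<close> products
  multiplies two affine functions of everything available so far, and only the resulting functions
  are kept. The form is easy to count, and circuits can be rebuilt from it.\<close>

inductive and_ext :: "('x \<Rightarrow> bool) set \<Rightarrow> nat \<Rightarrow> ('x \<Rightarrow> bool) set \<Rightarrow> bool" where
  refl: "and_ext B 0 B"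
| step: "f \<in> affine_span B \<Longrightarrow> g \<in> affine_span B \<Longrightarrow>
    and_ext (insert (\<lambda>x. f x \<and> g x) B) k B' \<Longrightarrow> and_ext B (Suc k) B'"

definition and_reach :: "('x \<Rightarrow> bool) set \<Rightarrow> nat \<Rightarrow> ('x \<Rightarrow> bool) set" where
  "and_reach B k = {f. \<exists>B'. and_ext B k B' \<and> f \<in> affine_span B'}"

lemma affine_span_mono:
  assumes "B \<subseteq> B'" shows "affine_span B \<subseteq> affine_span B'"
proof
  fix f assume "f \<in> affine_span B"
  then show "f \<in> affine_span B'"
  proof induction
    case (xor f g)
    then show ?case by (intro affine_span.xor)
  qed (use assms in \<open>auto intro: affine_span.base affine_span.one\<close>)
qed

lemma affine_span_not: "f \<in> affine_span B \<Longrightarrow> (\<lambda>x. \<not> f x) \<in> affine_span B"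
  using affine_span.xor[OF affine_span.one, of f B] by simp

lemma affine_span_const: "(\<lambda>_. b) \<in> affine_span B"
  using affine_span.one affine_span_not[OF affine_span.one] by (cases b) auto

lemma and_ext_subset: "and_ext B k B' \<Longrightarrow> B \<subseteq> B'"
  by (induction rule: and_ext.induct) auto


lemma and_ext_span: "and_ext B k B' \<Longrightarrow> f \<in> affine_span B \<Longrightarrow> f \<in> affine_span B'"
  using affine_span_mono and_ext_subset by blast

lemma and_ext_trans: "and_ext B k B' \<Longrightarrow> and_ext B' j B'' \<Longrightarrow> and_ext B (k + j) B''"
  by (induction rule: and_ext.induct) (auto intro: and_ext.intros)

lemma and_ext_single:
  "f \<in> affine_span B \<Longrightarrow> g \<in> affine_span B \<Longrightarrow> and_ext B 1 (insert (\<lambda>x. f x \<and> g x) B)"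
  using and_ext.step[OF _ _ and_ext.refl] by simp

text \<open>Spare conjunctions are spent on multiplying 1 by 1, so exact counts can be replaced by
  upper bounds.\<close>

lemma and_ext_more: "and_ext B k B' \<Longrightarrow> \<exists>B''. and_ext B (k + d) B'' \<and> B' \<subseteq> B''"
proof (induction d)
  case 0
  then show ?case by auto
next
  case (Suc d)
  then obtain B'' where "and_ext B (k + d) B''" "B' \<subseteq> B''" by auto
  then show ?case
    using and_ext_trans[OF _ and_ext_single[OF affine_span.one affine_span.one]]
    by (metis Suc_eq_plus1 add_Suc_right subset_insertI2)
qed

lemma and_reach_mono:
  assumes "k \<le> k'" shows "and_reach B k \<subseteq> and_reach B k'"
proof
  fix f assume "f \<in> and_reach B k"
  then obtain B' where B': "and_ext B k B'" "f \<in> affine_span B'" by (auto simp: and_reach_def)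
  obtain B'' where "and_ext B k' B''" "B' \<subseteq> B''"
    using and_ext_more[OF B'(1), of "k' - k"] assms by auto
  then show "f \<in> and_reach B k'" using B'(2) affine_span_mono unfolding and_reach_def by blast
qed

section \<open>Counting the functions computable with k products\<close>

lemma affine_span_empty: "affine_span {} \<subseteq> {\<lambda>_. True, \<lambda>_. False}"
proof
  fix f :: "'x \<Rightarrow> bool" assume "f \<in> affine_span {}"
  then show "f \<in> {\<lambda>_. True, \<lambda>_. False}" by induction auto
qed

text \<open>Over the field with two elements a new generator occurs with coefficient 0 or 1, since
  two occurrences cancel; hence it at most doubles the span.\<close>

lemma affine_span_insert:
  "affine_span (insert b B) \<subseteq> affine_span B \<union> (\<lambda>g x. b x \<noteq> g x) ` affine_span B"
proof
  fix f assume "f \<in> affine_span (insert b B)"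
  then have "f \<in> affine_span B \<or> (\<exists>g \<in> affine_span B. f = (\<lambda>x. b x \<noteq> g x))"
  proof induction
    case (base f)
    have "b = (\<lambda>x. b x \<noteq> False)" by auto
    then show ?case using base affine_span_const[of False B] affine_span.base[of f B]
      by (cases "f = b") auto
  next
    case one
    then show ?case using affine_span.one by blast
  next
    case (xor f g)
    consider "f \<in> affine_span B" "g \<in> affine_span B"
      | g' where "f \<in> affine_span B" "g' \<in> affine_span B" "g = (\<lambda>x. b x \<noteq> g' x)"
      | f' where "g \<in> affine_span B" "f' \<in> affine_span B" "f = (\<lambda>x. b x \<noteq> f' x)"
      | f' g' where "g' \<in> affine_span B" "f' \<in> affine_span B" "f = (\<lambda>x. b x \<noteq> f' x)"
          "g = (\<lambda>x. b x \<noteq> g' x)"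
      using xor.IH by blast
    then show ?case
    proof cases
      case 1
      then show ?thesis by (intro disjI1 affine_span.xor)
    next
      case 2
      have "(\<lambda>x. f x \<noteq> g x) = (\<lambda>x. b x \<noteq> (f x \<noteq> g' x))" unfolding 2(3) by (rule ext) blast
      then show ?thesis by (intro disjI2 bexI[OF _ affine_span.xor[OF 2(1,2)]])
    next
      case 3
      have "(\<lambda>x. f x \<noteq> g x) = (\<lambda>x. b x \<noteq> (f' x \<noteq> g x))" unfolding 3(3) by (rule ext) blast
      then show ?thesis by (intro disjI2 bexI[OF _ affine_span.xor[OF 3(2,1)]])
    next
      case 4
      have "(\<lambda>x. f x \<noteq> g x) = (\<lambda>x. f' x \<noteq> g' x)" unfolding 4(3,4) by (rule ext) blast
      then show ?thesis using affine_span.xor[OF 4(2,1)] by simp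
    qed
  qed
  then show "f \<in> affine_span B \<union> (\<lambda>g x. b x \<noteq> g x) ` affine_span B" by blast
qed

lemma card_affine_span:
  fixes B :: "('x \<Rightarrow> bool) set"
  shows "finite B \<Longrightarrow> finite (affine_span B) \<and> card (affine_span B) \<le> 2 ^ (card B + 1)"
proof (induction rule: finite_induct)
  case empty
  have "card (affine_span {} :: ('x \<Rightarrow> bool) set) \<le> card {\<lambda>_ :: 'x. True, \<lambda>_. False}"
    by (rule card_mono) (use affine_span_empty in auto)
  also have "card {\<lambda>_ :: 'x. True, \<lambda>_. False} \<le> 2" by (simp add: card_insert_if)
  finally show ?case using finite_subset[OF affine_span_empty] by auto
next
  case (insert b B)
  let ?S = "affine_span B \<union> (\<lambda>g x. b x \<noteq> g x) ` affine_span B"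
  have fin: "finite ?S" using insert by auto
  have "card (affine_span (insert b B)) \<le> card ?S"
    using card_mono[OF fin affine_span_insert] .
  also have "\<dots> \<le> card (affine_span B) + card (affine_span B)"
    by (rule order.trans[OF card_Un_le]) (use insert card_image_le in auto)
  also have "\<dots> \<le> 2 ^ (card (insert b B) + 1)" using insert by auto
  finally show ?case using finite_subset[OF affine_span_insert fin] by auto
qed

lemma and_ext_0_iff: "and_ext B 0 B' \<longleftrightarrow> B' = B"
  by (subst and_ext.simps) auto

lemma and_ext_Suc_iff: "and_ext B (Suc k) B' \<longleftrightarrow>
    (\<exists>p \<in> affine_span B \<times> affine_span B. and_ext (insert (\<lambda>x. fst p x \<and> snd p x) B) k B')"
  by (subst and_ext.simps) auto

lemma and_reach_0: "and_reach B 0 = affine_span B"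
  by (simp add: and_reach_def and_ext_0_iff)

lemma and_reach_Suc:
  "and_reach B (Suc k) =
     (\<Union>p \<in> affine_span B \<times> affine_span B. and_reach (insert (\<lambda>x. fst p x \<and> snd p x) B) k)"
  unfolding and_reach_def and_ext_Suc_iff by blast

text \<open>A product is chosen by two members of a span of at most 2^(|B| + 1) functions, after
  which \<open>B\<close> has at most one more element. The exponents 2 (|B| + i + 1) for i < k, and
  |B| + k + 1 for the final span, add up to at most the stated quadratic one.\<close>

lemma card_and_reach:
  "finite B \<Longrightarrow> finite (and_reach B k) \<and>
     card (and_reach B k) \<le> 2 ^ (2 * k * (card B + k) + card B + k + 1)"
proof (induction k arbitrary: B)
  case 0
  then show ?case using card_affine_span[OF 0] by (simp add: and_reach_0)
next
  case (Suc k)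
  let ?e = "2 * k * (card B + 1 + k) + (card B + 1) + k + 1"
  let ?S = "affine_span B \<times> affine_span B"
  let ?R = "\<lambda>p. and_reach (insert (\<lambda>x. fst p x \<and> snd p x) B) k"
  have R: "finite (?R p)" "card (?R p) \<le> 2 ^ ?e" for p
  proof -
    have *: "finite (insert (\<lambda>x. fst p x \<and> snd p x) B)"
      "card (insert (\<lambda>x. fst p x \<and> snd p x) B) \<le> card B + 1"
      using Suc.prems by (auto simp: card_insert_if)
    show "finite (?R p)" using Suc.IH[OF *(1)] by auto
    have "card (?R p) \<le> 2 ^ (2 * k * (card (insert (\<lambda>x. fst p x \<and> snd p x) B) + k)
        + card (insert (\<lambda>x. fst p x \<and> snd p x) B) + k + 1)"
      using Suc.IH[OF *(1)] by auto
    also have "\<dots> \<le> 2 ^ ?e"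
      by (rule power_increasing, intro add_mono mult_mono) (use *(2) in auto)
    finally show "card (?R p) \<le> 2 ^ ?e" .
  qed
  have S: "finite ?S" "card ?S \<le> 2 ^ (2 * (card B + 1))"
  proof -
    show "finite ?S" using card_affine_span[OF Suc.prems] by auto
    have "card ?S \<le> 2 ^ (card B + 1) * 2 ^ (card B + 1)"
      unfolding card_cartesian_product using card_affine_span[OF Suc.prems] by (intro mult_mono) auto
    then show "card ?S \<le> 2 ^ (2 * (card B + 1))" by (simp only: power_add [symmetric] mult_2)
  qed
  have "card (\<Union>p \<in> ?S. ?R p) \<le> (\<Sum>p \<in> ?S. card (?R p))" by (rule card_UN_le[OF S(1)])
  also have "\<dots> \<le> card ?S * 2 ^ ?e" using sum_bounded_above[of ?S "\<lambda>p. card (?R p)"] R(2) by auto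
  also have "\<dots> \<le> 2 ^ (2 * (card B + 1)) * 2 ^ ?e" using S(2) by (rule mult_right_mono) simp
  also have "\<dots> = 2 ^ (2 * (card B + 1) + ?e)" by (simp only: power_add)
  also have "\<dots> \<le> 2 ^ (2 * Suc k * (card B + Suc k) + card B + Suc k + 1)"
    by (rule power_increasing) (auto simp: algebra_simps)
  finally show ?case unfolding and_reach_Suc using S(1) R(1) by auto
qed

section \<open>From products to circuits and back\<close>

definition gate_vals :: "gate list \<Rightarrow> bool list \<Rightarrow> bool list" where
  "gate_vals gs x = foldl (\<lambda>vs g. vs @ [gate_val vs g]) x gs"

definition gates_ok :: "nat \<Rightarrow> gate list \<Rightarrow> bool" where
  "gates_ok n gs \<longleftrightarrow> (\<forall>i < length gs. \<forall>j \<in> gate_args (gs ! i). j < n + i)"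

definition count_ands :: "gate list \<Rightarrow> nat" where
  "count_ands gs = length (filter (\<lambda>g. \<exists>i j. g = And i j) gs)"

definition is_node :: "nat \<Rightarrow> gate list \<Rightarrow> (bool list \<Rightarrow> bool) \<Rightarrow> bool" where
  "is_node n gs f \<longleftrightarrow>
     (\<exists>j < n + length gs. \<forall>x. length x = n \<longrightarrow> gate_vals gs x ! j = f x)"

lemma gate_vals_Nil [simp]: "gate_vals [] x = x"
  by (simp add: gate_vals_def)

lemma gate_vals_snoc [simp]:
  "gate_vals (gs @ [g]) x = gate_vals gs x @ [gate_val (gate_vals gs x) g]"
  by (simp add: gate_vals_def)

lemma gate_vals_Cons: "gate_vals (g # gs) x = gate_vals gs (x @ [gate_val x g])"
  by (simp add: gate_vals_def)

lemma gate_vals_append: "gate_vals (gs @ hs) x = gate_vals hs (gate_vals gs x)"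
  by (simp add: gate_vals_def)

lemma length_gate_vals [simp]: "length (gate_vals gs x) = length x + length gs"
  by (induction gs rule: rev_induct) auto

lemma nth_gate_vals_append:
  "j < length x + length gs \<Longrightarrow> gate_vals (gs @ hs) x ! j = gate_vals gs x ! j"
proof (induction hs rule: rev_induct)
  case (snoc h hs)
  have "gate_vals (gs @ hs @ [h]) x = gate_vals (gs @ hs) x @ [gate_val (gate_vals (gs @ hs) x) h]"
    using gate_vals_snoc[of "gs @ hs" h x] by simp
  then show ?case using snoc by (simp add: nth_append)
qed simp

lemma gates_ok_snoc:
  "gates_ok n (gs @ [g]) \<longleftrightarrow> gates_ok n gs \<and> (\<forall>j \<in> gate_args g. j < n + length gs)"
  unfolding gates_ok_def by (auto simp: nth_append less_Suc_eq all_conj_distrib)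

lemma count_ands_append [simp]: "count_ands (gs @ hs) = count_ands gs + count_ands hs"
  by (simp add: count_ands_def)

lemma is_node_append:
  assumes "is_node n gs f" shows "is_node n (gs @ hs) f"
proof -
  obtain j where "j < n + length gs" "\<forall>x. length x = n \<longrightarrow> gate_vals gs x ! j = f x"
    using assms unfolding is_node_def by blast
  then show ?thesis unfolding is_node_def
    by (intro exI[of _ j]) (auto simp: nth_gate_vals_append)
qed

text \<open>The initial gate list is arbitrary so that the second summand can be built on top of the
  gates for the first; nodes that exist already keep their indices and values.\<close>

lemma affine_span_imp_gates:
  assumes "f \<in> affine_span B" "\<And>b. b \<in> B \<Longrightarrow> is_node n gs b" "gates_ok n gs"
  shows "\<exists>hs. gates_ok n (gs @ hs) \<and> count_ands hs = 0 \<and> is_node n (gs @ hs) f"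
  using assms
proof (induction arbitrary: gs)
  case (base f)
  then show ?case by (intro exI[of _ "[]"]) (auto simp: count_ands_def)
next
  case one
  then show ?case
    by (intro exI[of _ "[One]"])
      (auto simp: count_ands_def gates_ok_snoc is_node_def intro!: exI[of _ "n + length gs"] simp: nth_append)
next
  case (xor f g)
  obtain hs where hs: "gates_ok n (gs @ hs)" "count_ands hs = 0" "is_node n (gs @ hs) f"
    using xor by blast
  have "\<And>b. b \<in> B \<Longrightarrow> is_node n (gs @ hs) b" using xor.prems is_node_append by blast
  then obtain ks where ks: "gates_ok n (gs @ hs @ ks)" "count_ands ks = 0" "is_node n (gs @ hs @ ks) g"
    using xor.IH(2)[of "gs @ hs"] hs(1) by auto
  have "is_node n (gs @ hs @ ks) f" using is_node_append[OF hs(3), of ks] by simp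
  then obtain i where i: "i < n + length (gs @ hs @ ks)"
      "\<And>x. length x = n \<Longrightarrow> gate_vals (gs @ hs @ ks) x ! i = f x"
    unfolding is_node_def by blast
  obtain j where j: "j < n + length (gs @ hs @ ks)"
      "\<And>x. length x = n \<Longrightarrow> gate_vals (gs @ hs @ ks) x ! j = g x"
    using ks(3) unfolding is_node_def by blast
  let ?hs = "hs @ ks @ [Xor i j]"
  have eq: "gs @ ?hs = (gs @ hs @ ks) @ [Xor i j]" by simp
  have "gates_ok n (gs @ ?hs)" unfolding eq gates_ok_snoc using ks i j by auto
  moreover have "count_ands ?hs = 0" using hs ks by (simp add: count_ands_def)
  moreover have "is_node n (gs @ ?hs) (\<lambda>x. f x \<noteq> g x)"
    unfolding eq is_node_def
    by (intro exI[of _ "n + length (gs @ hs @ ks)"])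
      (use i j in \<open>auto simp: nth_append simp del: append_assoc\<close>)
  ultimately show ?case by blast
qed

lemma and_ext_imp_gates:
  assumes "and_ext B k B'" "\<And>b. b \<in> B \<Longrightarrow> is_node n gs b" "gates_ok n gs"
  shows "\<exists>hs. gates_ok n (gs @ hs) \<and> count_ands hs = k \<and> (\<forall>b \<in> B'. is_node n (gs @ hs) b)"
  using assms
proof (induction arbitrary: gs)
  case (refl B)
  then show ?case by (intro exI[of _ "[]"]) (auto simp: count_ands_def)
next
  case (step f B g k B')
  obtain hs where hs: "gates_ok n (gs @ hs)" "count_ands hs = 0" "is_node n (gs @ hs) f"
    using affine_span_imp_gates[OF step.hyps(1) step.prems] by blast
  have "\<And>b. b \<in> B \<Longrightarrow> is_node n (gs @ hs) b" using step.prems is_node_append by blast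
  from affine_span_imp_gates[OF step.hyps(2) this hs(1)]
  obtain ks where ks: "gates_ok n (gs @ hs @ ks)" "count_ands ks = 0" "is_node n (gs @ hs @ ks) g"
    by auto
  have "is_node n (gs @ hs @ ks) f" using is_node_append[OF hs(3), of ks] by simp
  then obtain i where i: "i < n + length (gs @ hs @ ks)"
      "\<And>x. length x = n \<Longrightarrow> gate_vals (gs @ hs @ ks) x ! i = f x"
    unfolding is_node_def by blast
  obtain j where j: "j < n + length (gs @ hs @ ks)"
      "\<And>x. length x = n \<Longrightarrow> gate_vals (gs @ hs @ ks) x ! j = g x"
    using ks(3) unfolding is_node_def by blast
  let ?gs = "(gs @ hs @ ks) @ [And i j]"
  have ok: "gates_ok n ?gs" unfolding gates_ok_snoc using ks i j by auto
  have "is_node n ?gs (\<lambda>x. f x \<and> g x)"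
    unfolding is_node_def
    by (intro exI[of _ "n + length (gs @ hs @ ks)"])
      (use i j in \<open>auto simp: nth_append simp del: append_assoc\<close>)
  moreover have "is_node n ?gs b" if "b \<in> B" for b
    using is_node_append[OF step.prems(1)[OF that], of "hs @ ks @ [And i j]"] by simp
  ultimately have "\<And>b. b \<in> insert (\<lambda>x. f x \<and> g x) B \<Longrightarrow> is_node n ?gs b" by auto
  from step.IH[OF this ok] obtain hs' where hs': "gates_ok n (?gs @ hs')" "count_ands hs' = k"
      "\<forall>b \<in> B'. is_node n (?gs @ hs') b" by auto
  then show ?case using hs ks
    by (intro exI[of _ "hs @ ks @ [And i j] @ hs'"]) (auto simp: count_ands_def)
qed

lemma circuit_fun_gate_vals: "circuit_fun C x = gate_vals (gates C) x ! out C"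
  by (simp add: circuit_fun_def gate_vals_def)

lemma wf_circuit_iff: "wf_circuit C \<longleftrightarrow>
    gates_ok (inputs C) (gates C) \<and> out C < inputs C + length (gates C)"
  by (simp add: wf_circuit_def gates_ok_def)

lemma mult_complexity_le_reach:
  assumes "f \<in> and_reach ((\<lambda>i x. x ! i) ` {..<n}) k"
  shows "mult_complexity n f \<le> k"
proof -
  obtain B' where B': "and_ext ((\<lambda>i x. x ! i) ` {..<n}) k B'" "f \<in> affine_span B'"
    using assms by (auto simp: and_reach_def)
  have "is_node n [] b" if "b \<in> (\<lambda>i x. x ! i) ` {..<n}" for b
    using that by (auto simp: is_node_def)
  from and_ext_imp_gates[OF B'(1) this] obtain hs where hs: "gates_ok n hs" "count_ands hs = k"
    "\<And>b. b \<in> B' \<Longrightarrow> is_node n hs b" by (auto simp: gates_ok_def)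
  from affine_span_imp_gates[OF B'(2) hs(3,1)] obtain ks where ks: "gates_ok n (hs @ ks)"
    "count_ands ks = 0" "is_node n (hs @ ks) f" by auto
  then obtain j where j: "j < n + length (hs @ ks)"
      "\<And>x. length x = n \<Longrightarrow> gate_vals (hs @ ks) x ! j = f x"
    unfolding is_node_def by blast
  let ?C = "\<lparr>inputs = n, gates = hs @ ks, out = j\<rparr>"
  have "computes ?C n f" using ks j by (auto simp: computes_def wf_circuit_iff circuit_fun_gate_vals)
  moreover have "num_ands ?C = k" using hs(2) ks(2) by (simp add: num_ands_def count_ands_def)
  ultimately show ?thesis unfolding mult_complexity_def by (intro Least_le) blast
qed

text \<open>Inputs may be replaced by affine functions of another argument at no cost in
  conjunctions. Later \<open>\<phi>\<close> sets the padding inputs of a circuit to 0.\<close>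

lemma gates_imp_and_ext:
  assumes "gates_ok n gs" "\<And>w. length (\<phi> w) = n" "\<And>j. j < n \<Longrightarrow> (\<lambda>w. \<phi> w ! j) \<in> affine_span B"
  shows "\<exists>B'. and_ext B (count_ands gs) B' \<and>
    (\<forall>j < n + length gs. (\<lambda>w. gate_vals gs (\<phi> w) ! j) \<in> affine_span B')"
  using assms(1)
proof (induction gs rule: rev_induct)
  case Nil
  then show ?case using assms by (auto simp: count_ands_def intro: and_ext.refl)
next
  case (snoc g gs)
  then obtain B' where B': "and_ext B (count_ands gs) B'"
    "\<And>j. j < n + length gs \<Longrightarrow> (\<lambda>w. gate_vals gs (\<phi> w) ! j) \<in> affine_span B'"
    by (auto simp: gates_ok_snoc)
  have args: "\<And>j. j \<in> gate_args g \<Longrightarrow> j < n + length gs" using snoc.prems by (auto simp: gates_ok_snoc)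
  have "\<exists>B''. and_ext B' (count_ands [g]) B'' \<and> (\<lambda>w. gate_val (gate_vals gs (\<phi> w)) g) \<in> affine_span B''"
  proof (cases g)
    case One
    then show ?thesis
      by (intro exI[of _ B']) (auto simp: count_ands_def intro: and_ext.refl affine_span.one)
  next
    case (And i j)
    then show ?thesis
      using and_ext_single[OF B'(2)[of i] B'(2)[of j]] args
      by (fastforce simp: count_ands_def intro: affine_span.base)
  next
    case (Xor i j)
    then show ?thesis using affine_span.xor[OF B'(2)[of i] B'(2)[of j]] args
      by (intro exI[of _ B']) (auto simp: count_ands_def intro: and_ext.refl)
  qed
  then obtain B'' where B'': "and_ext B' (count_ands [g]) B''"
    "(\<lambda>w. gate_val (gate_vals gs (\<phi> w)) g) \<in> affine_span B''" by blast
  have "(\<lambda>w. gate_vals (gs @ [g]) (\<phi> w) ! j) \<in> affine_span B''" if "j < n + length (gs @ [g])" for j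
  proof (cases "j < n + length gs")
    case True
    then show ?thesis using and_ext_span[OF B''(1) B'(2)] assms(2) by (simp add: nth_append)
  next
    case False
    then have "j = n + length gs" using that by simp
    then show ?thesis using B''(2) assms(2) by (simp add: nth_append)
  qed
  then show ?case using and_ext_trans[OF B'(1) B''(1)] by (intro exI[of _ B'']) auto
qed

text \<open>The products come from an optimal circuit \<open>D\<close> for the same function, not
  from \<open>C\<close>, which only shows that some circuit exists.\<close>

lemma and_reach_if_mult_complexity_le:
  assumes "wf_circuit C" "inputs C = n" "mult_complexity n (circuit_fun C) \<le> s"
    and "\<And>w. length (\<phi> w) = n" "\<And>j. j < n \<Longrightarrow> (\<lambda>w. \<phi> w ! j) \<in> affine_span B"
  shows "(\<lambda>w. circuit_fun C (\<phi> w)) \<in> and_reach B s"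
proof -
  have "\<exists>k D. computes D n (circuit_fun C) \<and> num_ands D = k"
    using assms(1,2) by (auto simp: computes_def)
  from LeastI_ex[OF this] obtain D where D: "computes D n (circuit_fun C)"
    "num_ands D = mult_complexity n (circuit_fun C)"
    unfolding mult_complexity_def by auto
  then have wf: "gates_ok n (gates D)" "out D < n + length (gates D)" "inputs D = n"
    by (auto simp: computes_def wf_circuit_iff)
  obtain B' where B': "and_ext B (count_ands (gates D)) B'"
    "(\<lambda>w. gate_vals (gates D) (\<phi> w) ! out D) \<in> affine_span B'"
    using gates_imp_and_ext[of n "gates D" \<phi> B] wf assms(4,5) by blast
  have eq: "(\<lambda>w. gate_vals (gates D) (\<phi> w) ! out D) = (\<lambda>w. circuit_fun C (\<phi> w))"
    using D assms(4) by (auto simp: computes_def circuit_fun_gate_vals)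
  have "(\<lambda>w. circuit_fun C (\<phi> w)) \<in> and_reach B (count_ands (gates D))"
    using B' unfolding eq and_reach_def by blast
  then show ?thesis using and_reach_mono[of "count_ands (gates D)" s B] D(2) assms(3)
    by (auto simp: num_ands_def count_ands_def)
qed

section \<open>Finite-valued quantities given by affine indicators\<close>

definition span_var :: "('x \<Rightarrow> bool) set \<Rightarrow> ('x \<Rightarrow> 'a) \<Rightarrow> bool" where
  "span_var B X \<longleftrightarrow> (\<forall>a. (\<lambda>x. X x = a) \<in> affine_span B)"

lemma span_var_mono: "span_var B X \<Longrightarrow> B \<subseteq> B' \<Longrightarrow> span_var B' X"
  using subsetD[OF affine_span_mono[of B B']] unfolding span_var_def by simp

lemma span_var_ext: "span_var B X \<Longrightarrow> and_ext B k B' \<Longrightarrow> span_var B' X"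
  by (rule span_var_mono[OF _ and_ext_subset])

lemma span_var_const: "span_var B (\<lambda>_. c)"
  unfolding span_var_def by (intro allI affine_span_const)

text \<open>A disjunction of mutually exclusive events is their sum over the field with two
  elements, hence free of conjunctions.\<close>

lemma affine_span_disjoint_Ex:
  assumes "finite A" "\<And>a. a \<in> A \<Longrightarrow> F a \<in> affine_span B"
    and "\<And>x a b. a \<in> A \<Longrightarrow> b \<in> A \<Longrightarrow> F a x \<Longrightarrow> F b x \<Longrightarrow> a = b"
  shows "(\<lambda>x. \<exists>a \<in> A. F a x) \<in> affine_span B"
  using assms
proof (induction rule: finite_induct)
  case empty
  then show ?case by (simp add: affine_span_const)
next
  case (insert c A)
  have IH: "(\<lambda>x. \<exists>a \<in> A. F a x) \<in> affine_span B"
    by (rule insert.IH) (use insert.prems in \<open>blast+\<close>)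
  have "F c x \<Longrightarrow> a \<in> A \<Longrightarrow> F a x \<Longrightarrow> False" for a x
    using insert.prems(2)[of c a x] insert.hyps by auto
  then have "(\<lambda>x. \<exists>a \<in> insert c A. F a x) = (\<lambda>x. F c x \<noteq> (\<exists>a \<in> A. F a x))"
    by fastforce
  then show ?case using affine_span.xor[OF insert.prems(1)[of c] IH] by simp
qed

lemma span_var_pred:
  assumes "span_var B X" "finite R" "\<And>x. X x \<in> R"
  shows "(\<lambda>x. P (X x)) \<in> affine_span B"
proof -
  have "(\<lambda>x. \<exists>a \<in> {a \<in> R. P a}. X x = a) \<in> affine_span B"
    by (rule affine_span_disjoint_Ex) (use assms in \<open>auto simp: span_var_def\<close>)
  moreover have "(\<lambda>x. \<exists>a \<in> {a \<in> R. P a}. X x = a) = (\<lambda>x. P (X x))" using assms(3) by auto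
  ultimately show ?thesis by simp
qed

text \<open>This is the gain of one-hot encoding: once the indicators of a finite-valued quantity
  are affine, every function of it is free, however complicated. In the simulation below, only the
  forming of tuples costs conjunctions.\<close>

lemma span_var_map:
  assumes "span_var B X" "finite R" "\<And>x. X x \<in> R"
  shows "span_var B (\<lambda>x. \<phi> (X x))"
  unfolding span_var_def by (rule allI) (rule span_var_pred[OF assms])

lemma span_var_bool: "f \<in> affine_span B \<Longrightarrow> span_var B f"
  unfolding span_var_def
proof
  fix a :: bool assume "f \<in> affine_span B"
  then show "(\<lambda>x. f x = a) \<in> affine_span B" using affine_span_not by (cases a) auto
qed

lemma and_ext_family:
  assumes "finite A" "\<And>a. a \<in> A \<Longrightarrow> F a \<in> affine_span B \<and> G a \<in> affine_span B"
  shows "\<exists>B'. and_ext B (card A) B' \<and> (\<forall>a \<in> A. (\<lambda>x. F a x \<and> G a x) \<in> affine_span B')"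
  using assms
proof (induction rule: finite_induct)
  case empty
  then show ?case by (auto intro: and_ext.refl)
next
  case (insert c A)
  then obtain B' where B': "and_ext B (card A) B'"
    "\<forall>a \<in> A. (\<lambda>x. F a x \<and> G a x) \<in> affine_span B'" by auto
  let ?B = "insert (\<lambda>x. F c x \<and> G c x) B'"
  have ext: "and_ext B' 1 ?B"
    using insert.prems[of c] and_ext_span[OF B'(1)] by (intro and_ext_single) auto
  have "\<forall>a \<in> insert c A. (\<lambda>x. F a x \<and> G a x) \<in> affine_span ?B"
    using B'(2) and_ext_span[OF ext] by (auto intro: affine_span.base)
  then show ?case using and_ext_trans[OF B'(1) ext] insert.hyps by auto
qed

text \<open>The indicators of a pair are products of indicators, one for each pair of possible
  values; all other pairs have the constant indicator 0.\<close>

lemma span_var_pair: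
  assumes "span_var B X" "finite R" "\<And>x. X x \<in> R" "span_var B Y" "finite S" "\<And>x. Y x \<in> S"
  shows "\<exists>B'. and_ext B (card R * card S) B' \<and> span_var B' (\<lambda>x. (X x, Y x))"
proof -
  have fin: "finite (R \<times> S)" using assms by simp
  have sp: "(\<lambda>x. X x = fst p) \<in> affine_span B \<and> (\<lambda>x. Y x = snd p) \<in> affine_span B" for p
    using assms(1,4) by (simp add: span_var_def)
  obtain B' where B': "and_ext B (card (R \<times> S)) B'"
    "\<And>p. p \<in> R \<times> S \<Longrightarrow> (\<lambda>x. X x = fst p \<and> Y x = snd p) \<in> affine_span B'"
    using and_ext_family[OF fin, of "\<lambda>p x. X x = fst p" B "\<lambda>p x. Y x = snd p"] sp by blast
  have "(\<lambda>x. (X x, Y x) = p) \<in> affine_span B'" for p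
  proof (cases "p \<in> R \<times> S")
    case True
    then show ?thesis using B'(2)[of p] by (simp add: prod_eq_iff)
  next
    case False
    then have "(\<lambda>x. (X x, Y x) = p) = (\<lambda>_. False)" using assms by auto
    then show ?thesis by (simp add: affine_span_const)
  qed
  then show ?thesis using B'(1) by (auto simp: span_var_def card_cartesian_product)
qed

text \<open>The hypothesis ranges over all \<open>D\<close> above \<open>B\<close> because each
  member is built on top of the products already spent on the others.\<close>

lemma span_var_family:
  assumes "finite P"
    and "\<And>p D. p \<in> P \<Longrightarrow> B \<subseteq> D \<Longrightarrow> \<exists>D'. and_ext D k D' \<and> span_var D' (Z p)"
  shows "\<exists>D'. and_ext B (card P * k) D' \<and> (\<forall>p \<in> P. span_var D' (Z p))"
  using assms
proof (induction rule: finite_induct)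
  case empty
  then show ?case by (auto intro: and_ext.refl)
next
  case (insert c P)
  then obtain D where D: "and_ext B (card P * k) D" "\<forall>p \<in> P. span_var D (Z p)" by blast
  obtain D' where D': "and_ext D k D'" "span_var D' (Z c)"
    using insert.prems[of c D] and_ext_subset[OF D(1)] by auto
  have "\<forall>p \<in> insert c P. span_var D' (Z p)" using D(2) D' span_var_ext by blast
  then show ?case using and_ext_trans[OF D(1) D'(1)] insert.hyps
    by (intro exI[of _ D']) (auto simp: add.commute)
qed

text \<open>The list grows by one entry at a time. Pairing the prefix with its next entry costs at
  most the number of lists of full length, and each round is padded to exactly that number.\<close>

lemma span_var_list:
  assumes "\<And>i. i < K \<Longrightarrow> span_var B (X i)" "finite R" "\<And>i x. i < K \<Longrightarrow> X i x \<in> R"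
  shows "\<exists>B'. and_ext B (K * card R ^ K) B' \<and> span_var B' (\<lambda>x. map (\<lambda>i. X i x) [0..<K])"
proof (cases "K = 0")
  case True
  then show ?thesis by (auto intro: and_ext.refl span_var_const)
next
  case False
  then have "R \<noteq> {}" using assms(3)[of 0] by auto
  then have pos: "card R > 0" using assms(2) by (simp add: card_gt_0_iff)
  have "j \<le> K \<Longrightarrow>
      \<exists>B'. and_ext B (j * card R ^ K) B' \<and> span_var B' (\<lambda>x. map (\<lambda>i. X i x) [0..<j])" for j
  proof (induction j)
    case 0
    then show ?case by (auto intro: and_ext.refl span_var_const)
  next
    case (Suc j)
    then obtain B' where B': "and_ext B (j * card R ^ K) B'"
      "span_var B' (\<lambda>x. map (\<lambda>i. X i x) [0..<j])" by auto
    let ?L = "{xs. set xs \<subseteq> R \<and> length xs = j}"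
    have fin: "finite ?L" using finite_lists_length_eq[OF assms(2)] .
    have "span_var B' (X j)" using assms(1)[of j] Suc.prems span_var_ext[OF _ B'(1)] by auto
    from span_var_pair[OF B'(2) fin _ this assms(2)] Suc.prems assms(3)
    obtain B'' where B'': "and_ext B' (card ?L * card R) B''"
      "span_var B'' (\<lambda>x. (map (\<lambda>i. X i x) [0..<j], X j x))"
      by (auto simp: image_subset_iff)
    have "card ?L * card R = card R ^ Suc j"
      by (simp add: card_lists_length_eq[OF assms(2)])
    also have "\<dots> \<le> card R ^ K" using pos Suc.prems by (intro power_increasing) auto
    finally have le: "card ?L * card R \<le> card R ^ K" .
    obtain E where E: "and_ext B' (card R ^ K) E" "B'' \<subseteq> E"
      using and_ext_more[OF B''(1), of "card R ^ K - card ?L * card R"] le by auto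
    have "span_var E (\<lambda>x. (\<lambda>p. fst p @ [snd p]) (map (\<lambda>i. X i x) [0..<j], X j x))"
      by (rule span_var_map[OF span_var_mono[OF B''(2) E(2)], of "?L \<times> R"])
        (use fin assms Suc.prems in \<open>auto simp: image_subset_iff\<close>)
    then show ?case using and_ext_trans[OF B'(1) E(1)]
      by (intro exI[of _ E]) (auto simp: add.commute)
  qed
  then show ?thesis by blast
qed

section \<open>Runs of Turing machines\<close>

definition wf_config :: "tm \<Rightarrow> config \<Rightarrow> bool" where
  "wf_config M c \<longleftrightarrow> fst c < nstates M \<and> length (snd c) = ntapes M \<and>
     (\<forall>i < ntapes M. \<forall>p. fst (snd c ! i) p < nsyms M)"

abbreviation head_syms :: "tape list \<Rightarrow> nat list" where
  "head_syms tps \<equiv> map (\<lambda>tp. fst tp (snd tp)) tps"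

lemma wf_config_delta:
  assumes "wf_tm M" "wf_config M (q, tps)"
  shows "fst (delta M q (head_syms tps) b) < nstates M"
    "length (snd (delta M q (head_syms tps) b)) = ntapes M"
    "i < ntapes M \<Longrightarrow> fst (snd (delta M q (head_syms tps) b) ! i) < nsyms M"
    "i < ntapes M \<Longrightarrow> snd (snd (delta M q (head_syms tps) b) ! i) \<in> {-1, 0, 1}"
proof -
  have "length (head_syms tps) = ntapes M" "set (head_syms tps) \<subseteq> {..<nsyms M}" "q < nstates M"
    using assms(2) by (auto simp: wf_config_def in_set_conv_nth) (metis fst_conv)
  then have *: "fst (delta M q (head_syms tps) b) < nstates M \<and>
        length (snd (delta M q (head_syms tps) b)) = ntapes M \<and>
        set (snd (delta M q (head_syms tps) b)) \<subseteq> {..<nsyms M} \<times> {-1, 0, 1}"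
    using assms(1) unfolding wf_tm_def by blast
  then show "fst (delta M q (head_syms tps) b) < nstates M"
    "length (snd (delta M q (head_syms tps) b)) = ntapes M" by auto
  assume "i < ntapes M"
  then have "snd (delta M q (head_syms tps) b) ! i \<in> {..<nsyms M} \<times> {-1, 0, 1}"
    using * nth_mem by (metis subsetD)
  then show "fst (snd (delta M q (head_syms tps) b) ! i) < nsyms M"
    "snd (snd (delta M q (head_syms tps) b) ! i) \<in> {-1, 0, 1}"
    by (auto simp: mem_Times_iff)
qed

lemma step_simps:
  "step M Q (q, tps) b = (if q = 1 then (q, tps)
     else if q = 2 then (if Q (tape_bits (tps ! 1)) then 3 else 4, tps)
     else (fst (delta M q (head_syms tps) b), map2 act (snd (delta M q (head_syms tps) b)) tps))"
  by (simp add: step_def split: prod.split)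

lemma wf_config_step:
  assumes "wf_tm M" "wf_config M c" shows "wf_config M (step M Q c b)"
proof -
  obtain q tps where c: "c = (q, tps)" by (cases c)
  have "nstates M \<ge> 5" using assms(1) by (auto simp: wf_tm_def)
  then show ?thesis
    using wf_config_delta[OF assms(1), where q = q and tps = tps and b = b] assms(2)
    unfolding c step_simps by (auto simp: wf_config_def act_def)
qed

lemma wf_config_init:
  assumes "wf_tm M" shows "wf_config M (init_config M w)"
proof -
  have "fst ((bits_tape w # replicate (ntapes M - 1) (bits_tape [])) ! i) p < nsyms M"
    if "i < ntapes M" for i p
    using that assms by (cases i) (auto simp: bits_tape_def wf_tm_def)
  then show ?thesis using assms by (auto simp: wf_config_def init_config_def wf_tm_def)
qed

lemma run_snoc: "run M Q w (cs @ [b]) = step M Q (run M Q w cs) b"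
  by (simp add: run_def)

lemma run_replicate_Suc:
  "run M Q w (replicate (Suc t) b) = step M Q (run M Q w (replicate t b)) b"
  using run_snoc[of M Q w "replicate t b" b] by (simp add: replicate_append_same)

lemma wf_config_run: "wf_tm M \<Longrightarrow> wf_config M (run M Q w cs)"
  by (induction cs rule: rev_induct) (auto simp: run_snoc wf_config_step run_def wf_config_init)

lemma head_bound_run:
  assumes "wf_tm M" "i < ntapes M"
  shows "\<bar>snd (snd (run M Q w cs) ! i)\<bar> \<le> int (length cs)"
proof (induction cs rule: rev_induct)
  case Nil
  then show ?case using assms by (cases i) (auto simp: run_def init_config_def bits_tape_def)
next
  case (snoc b cs)
  obtain q tps where c: "run M Q w cs = (q, tps)" by fastforce
  have wf: "wf_config M (q, tps)" using wf_config_run[OF assms(1), of Q w cs] c by simp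
  note d = wf_config_delta(2)[OF assms(1) wf, of b] wf_config_delta(4)[OF assms(1) wf assms(2), of b]
  show ?case using snoc d assms wf
    by (auto simp: run_snoc c step_simps act_def wf_config_def)
qed

section \<open>Circuits simulating Turing machines\<close>

context
  fixes M :: tm and w :: "'x \<Rightarrow> bool list" and T :: nat
  assumes wf: "wf_tm M"
begin

abbreviation cfg :: "nat \<Rightarrow> 'x \<Rightarrow> config" where
  "cfg t x \<equiv> run M (\<lambda>_. False) (w x) (replicate t False)"

abbreviation cell :: "nat \<Rightarrow> nat \<Rightarrow> int \<Rightarrow> 'x \<Rightarrow> nat" where
  "cell t i p x \<equiv> fst (snd (cfg t x) ! i) p"

abbreviation head :: "nat \<Rightarrow> nat \<Rightarrow> 'x \<Rightarrow> int" where
  "head t i x \<equiv> snd (snd (cfg t x) ! i)"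

text \<open>Heads start on cell 0 and move by at most one cell, so during \<open>T\<close> steps
  they only see cells from -T to T, and finitely many indicators describe all that matters.\<close>

definition config_var :: "('x \<Rightarrow> bool) set \<Rightarrow> nat \<Rightarrow> bool" where
  "config_var B t \<longleftrightarrow> span_var B (\<lambda>x. fst (cfg t x)) \<and>
     (\<forall>i < ntapes M. span_var B (head t i) \<and> (\<forall>p \<in> {- int T .. int T}. span_var B (cell t i p)))"

text \<open>The summands pay, in this order, for: pairing each head with every cell of its tape,
  which yields the scanned symbols; the list of scanned symbols; joining the state to this list;
  joining each head to the result; and joining each cell to that.\<close>

definition step_ands :: nat where
  "step_ands = (let K = ntapes M; s = nsyms M; W = 2 * T + 1; U = nstates M * s ^ K in
     K * (W * (W * s)) + K * s ^ K + U + K * (U * W) + (K * W) * (U * W * s))"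

text \<open>The new state depends on the view \<open>U\<close> of state and scanned symbols, a new
  head position on \<open>U\<close> and the old position, a new cell on these and the old cell. Each
  dependence has finite domain, so it is enough to make the indicators of these tuples
  available.\<close>

lemma config_var_Suc:
  assumes "config_var B t" "t < T"
  shows "\<exists>B'. and_ext B step_ands B' \<and> config_var B' (Suc t)"
proof -
  define K s where "K = ntapes M" and "s = nsyms M"
  define I where "I = {- int T .. int T}"
  have cI: "card I = 2 * T + 1" "finite I" by (auto simp: I_def)
  have wfc: "wf_config M (cfg u x)" for u x using wf_config_run[OF wf] .
  have head: "head t i x \<in> I" if "i < K" for i x
    using head_bound_run[OF wf, of i "\<lambda>_. False" "w x" "replicate t False"] that assms(2)
    by (auto simp: K_def I_def)
  have cell: "cell t i p x \<in> {..<s}" if "i < K" for i p x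
    using wfc[where u = t and x = x] that by (auto simp: wf_config_def K_def s_def)
  have state: "fst (cfg t x) \<in> {..<nstates M}" for x using wfc[where u = t and x = x] by (auto simp: wf_config_def)
  have v: "span_var B (\<lambda>x. fst (cfg t x))" "\<And>i. i < K \<Longrightarrow> span_var B (head t i)"
    "\<And>i p. i < K \<Longrightarrow> p \<in> I \<Longrightarrow> span_var B (cell t i p)"
    using assms(1) by (auto simp: config_var_def K_def I_def)
  define scan where "scan i x = cell t i (head t i x) x" for i x
  have fam: "\<exists>D'. and_ext D ((2 * T + 1) * ((2 * T + 1) * s)) D' \<and> span_var D' (scan i)"
    if "i \<in> {..<K}" "B \<subseteq> D" for i D
  proof -
    have i: "i < K" using that by simp
    have fam: "\<exists>E'. and_ext E (card I * card {..<s}) E' \<and> span_var E' (\<lambda>x. (head t i x, cell t i p x))"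
      if "p \<in> I" "D \<subseteq> E" for p E
      by (rule span_var_pair)
        (use cI head[OF i] cell[OF i] span_var_mono[OF v(2)[OF i]] span_var_mono[OF v(3)[OF i that(1)]]
            that \<open>B \<subseteq> D\<close> in auto)
    have "\<exists>D'. and_ext D (card I * (card I * card {..<s})) D' \<and>
        (\<forall>p \<in> I. span_var D' (\<lambda>x. (head t i x, cell t i p x)))"
      by (rule span_var_family[OF cI(2)]) (rule fam, assumption+)
    then obtain D' where
      D': "and_ext D (card I * (card I * card {..<s})) D'"
        "\<And>p. p \<in> I \<Longrightarrow> span_var D' (\<lambda>x. (head t i x, cell t i p x))" by auto
    \<comment> \<open>The head is on exactly one position, so the events for different
      \<open>p\<close> exclude each other and the scanned symbol is read without further
      products.\<close>
    have "(\<lambda>x. \<exists>p \<in> I. (head t i x, cell t i p x) = (p, a)) \<in> affine_span D'" for a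
    proof (rule affine_span_disjoint_Ex)
      show "(\<lambda>x. (head t i x, cell t i p x) = (p, a)) \<in> affine_span D'" if "p \<in> I" for p
        using D'(2)[OF that] unfolding span_var_def by (rule spec)
    qed (use cI in auto)
    moreover have "(\<lambda>x. \<exists>p \<in> I. (head t i x, cell t i p x) = (p, a)) = (\<lambda>x. scan i x = a)" for a
      using head[OF i] by (auto simp: scan_def)
    ultimately have "span_var D' (scan i)" unfolding span_var_def by simp
    then show ?thesis using D'(1) cI by auto
  qed
  have "\<exists>B1. and_ext B (card {..<K} * ((2 * T + 1) * ((2 * T + 1) * s))) B1 \<and>
      (\<forall>i \<in> {..<K}. span_var B1 (scan i))"
    by (rule span_var_family[OF finite_lessThan]) (rule fam, assumption+)
  then obtain B1 where
    B1: "and_ext B (K * ((2 * T + 1) * ((2 * T + 1) * s))) B1" "\<And>i. i < K \<Longrightarrow> span_var B1 (scan i)"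
    by auto
  obtain B2 where B2: "and_ext B1 (K * s ^ K) B2" "span_var B2 (\<lambda>x. map (\<lambda>i. scan i x) [0..<K])"
    using span_var_list[of K B1 scan "{..<s}"] B1(2) cell by (auto simp: scan_def)
  define L where "L = {xs. set xs \<subseteq> {..<s} \<and> length xs = K}"
  have L: "finite L" "card L = s ^ K"
    by (simp_all add: L_def finite_lists_length_eq card_lists_length_eq)
  have scanL: "map (\<lambda>i. scan i x) [0..<K] \<in> L" for x
    using cell by (auto simp: L_def scan_def)
  have "span_var B2 (\<lambda>x. fst (cfg t x))"
    using span_var_ext[OF span_var_ext[OF v(1) B1(1)] B2(1)] .
  from span_var_pair[OF this _ state B2(2) L(1) scanL] obtain B3 where
    B3: "and_ext B2 (nstates M * s ^ K) B3"
      "span_var B3 (\<lambda>x. (fst (cfg t x), map (\<lambda>i. scan i x) [0..<K]))"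
    using L by auto
  define U where "U x = (fst (cfg t x), map (\<lambda>i. scan i x) [0..<K])" for x
  define R where "R = {..<nstates M} \<times> L"
  have R: "finite R" "card R = nstates M * s ^ K" and UR: "U x \<in> R" for x
    using L state scanL by (auto simp: R_def U_def)
  have U3: "span_var B3 U" using B3(2) by (simp add: U_def[abs_def])
  have sub3: "and_ext B (K * ((2 * T + 1) * ((2 * T + 1) * s)) + K * s ^ K + nstates M * s ^ K) B3"
    using and_ext_trans[OF and_ext_trans[OF B1(1) B2(1)] B3(1)] .
  have fam: "\<exists>D'. and_ext D (card R * (2 * T + 1)) D' \<and> span_var D' (\<lambda>x. (U x, head t i x))"
    if "i \<in> {..<K}" "B3 \<subseteq> D" for i D
    using span_var_pair[OF span_var_mono[OF U3 that(2)] R(1) UR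
        span_var_mono[OF v(2)] cI(2) head] that and_ext_subset[OF sub3] cI(1) by auto
  have "\<exists>B4. and_ext B3 (card {..<K} * (card R * (2 * T + 1))) B4 \<and>
      (\<forall>i \<in> {..<K}. span_var B4 (\<lambda>x. (U x, head t i x)))"
    by (rule span_var_family[OF finite_lessThan]) (rule fam, assumption+)
  then obtain B4 where
    B4: "and_ext B3 (K * (card R * (2 * T + 1))) B4"
      "\<And>i. i < K \<Longrightarrow> span_var B4 (\<lambda>x. (U x, head t i x))" by auto
  have sub4: "B \<subseteq> B4" using and_ext_subset[OF sub3] and_ext_subset[OF B4(1)] by auto
  have fam: "\<exists>D'. and_ext D (card R * (2 * T + 1) * s) D' \<and>
        span_var D' (\<lambda>x. ((U x, head t (fst ip) x), cell t (fst ip) (snd ip) x))"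
    if "ip \<in> {..<K} \<times> I" "B4 \<subseteq> D" for ip D
  proof -
    have i: "fst ip < K" "snd ip \<in> I" using that by auto
    have "span_var D (cell t (fst ip) (snd ip))"
      using span_var_mono[OF v(3)[OF i]] sub4 that(2) by blast
    from span_var_pair[OF span_var_mono[OF B4(2)[OF i(1)] that(2)], of "R \<times> I", OF _ _ this, of "{..<s}"]
    show ?thesis using R cI UR head[OF i(1)] cell[OF i(1)] by (auto simp: card_cartesian_product)
  qed
  have "\<exists>B5. and_ext B4 (card ({..<K} \<times> I) * (card R * (2 * T + 1) * s)) B5 \<and>
      (\<forall>ip \<in> {..<K} \<times> I. span_var B5 (\<lambda>x. ((U x, head t (fst ip) x), cell t (fst ip) (snd ip) x)))"
    by (rule span_var_family[OF finite_SigmaI[OF finite_lessThan cI(2)]]) (rule fam, assumption+)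
  then obtain B5 where
    B5: "and_ext B4 (card ({..<K} \<times> I) * (card R * (2 * T + 1) * s)) B5"
      "\<forall>ip \<in> {..<K} \<times> I. span_var B5 (\<lambda>x. ((U x, head t (fst ip) x), cell t (fst ip) (snd ip) x))"
    by (elim exE conjE) (rule that)
  have B5': "span_var B5 (\<lambda>x. ((U x, head t i x), cell t i p x))" if "i < K" "p \<in> I" for i p
    using bspec[OF B5(2), of "(i, p)"] that by simp
  have U5: "span_var B5 U" using span_var_ext[OF span_var_ext[OF U3 B4(1)] B5(1)] .
  have tot: "and_ext B step_ands B5"
    using and_ext_trans[OF and_ext_trans[OF sub3 B4(1)] B5(1)] R(2) cI(1)
    by (simp add: step_ands_def Let_def K_def s_def card_cartesian_product)
  \<comment> \<open>\<open>None\<close> stands for the halting state and the query state, in which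
    no tape changes. The oracle of these runs always answers no, whence the successor state 4
    below.\<close>
  define act_of where "act_of i u = (if fst u = 1 \<or> fst u = 2 then None
      else Some (snd (delta M (fst u) (snd u) False) ! i))" for i and u :: "nat \<times> nat list"
  have hs: "head_syms (snd (cfg t x)) = map (\<lambda>i. scan i x) [0..<K]" for x
    using wfc[where u = t and x = x] by (intro nth_equalityI) (auto simp: scan_def wf_config_def K_def)
  have stepx: "cfg (Suc t) x = step M (\<lambda>_. False) (fst (cfg t x), snd (cfg t x)) False" for x
    unfolding run_replicate_Suc by simp
  have wf2: "wf_config M (fst (cfg t x), snd (cfg t x))" for x using wfc[where u = t and x = x] by simp
  have st: "fst (cfg (Suc t) x) = (\<lambda>u. if fst u = 1 then 1 else if fst u = 2 then 4
      else fst (delta M (fst u) (snd u) False)) (U x)" for x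
    unfolding stepx step_simps by (simp add: U_def hs)
  have tp: "snd (cfg (Suc t) x) ! i = (case act_of i (U x) of None \<Rightarrow> snd (cfg t x) ! i
      | Some a \<Rightarrow> act a (snd (cfg t x) ! i))" if "i < K" for i x
    unfolding stepx step_simps
    using wf_config_delta(2)[OF wf wf2[of x], of False] that wf2[of x]
    by (auto simp: U_def act_of_def hs K_def wf_config_def)
  have "config_var B5 (Suc t)" unfolding config_var_def
  proof (intro conjI allI impI ballI)
    show "span_var B5 (\<lambda>x. fst (cfg (Suc t) x))"
      unfolding st by (rule span_var_map[OF U5 R(1) UR])
    fix i assume "i < ntapes M"
    then have i: "i < K" by (simp add: K_def)
    have "span_var B5 (\<lambda>x. (\<lambda>(u, h). case act_of i u of None \<Rightarrow> h | Some a \<Rightarrow> h + snd a) (U x, head t i x))"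
      by (rule span_var_map[OF span_var_ext[OF B4(2)[OF i] B5(1)], of "R \<times> I"])
        (use R cI UR head[OF i] in auto)
    moreover have "(\<lambda>x. (\<lambda>(u, h). case act_of i u of None \<Rightarrow> h | Some a \<Rightarrow> h + snd a) (U x, head t i x))
        = head (Suc t) i"
      unfolding tp[OF i] by (rule ext) (simp add: act_def split: option.split)
    ultimately show "span_var B5 (head (Suc t) i)" by (simp only:)
    fix p assume p: "p \<in> {- int T..int T}"
    have "span_var B5 (\<lambda>x. (\<lambda>((u, h), c). case act_of i u of None \<Rightarrow> c
        | Some a \<Rightarrow> if p = h then fst a else c) ((U x, head t i x), cell t i p x))"
      by (rule span_var_map[OF B5'[OF i], of p "(R \<times> I) \<times> {..<s}"])
        (use R cI UR head[OF i] cell[OF i] p in \<open>auto simp: I_def\<close>)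
    moreover have "(\<lambda>x. (\<lambda>((u, h), c). case act_of i u of None \<Rightarrow> c
        | Some a \<Rightarrow> if p = h then fst a else c) ((U x, head t i x), cell t i p x)) = cell (Suc t) i p"
      unfolding tp[OF i] by (rule ext) (simp add: act_def split: option.split)
    ultimately show "span_var B5 (cell (Suc t) i p)" by (simp only:)
  qed
  then show ?thesis using tot by blast
qed

lemma config_var_run:
  assumes "config_var B 0" "t \<le> T"
  shows "\<exists>B'. and_ext B (t * step_ands) B' \<and> config_var B' t"
  using assms(2)
proof (induction t)
  case 0
  then show ?case using assms(1) by (auto intro: and_ext.refl)
next
  case (Suc t)
  then obtain B' where B': "and_ext B (t * step_ands) B'" "config_var B' t" by auto
  obtain B'' where B'': "and_ext B' step_ands B''" "config_var B'' (Suc t)"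
    using config_var_Suc[OF B'(2)] Suc.prems by auto
  then show ?case using and_ext_trans[OF B'(1) B''(1)] by (auto simp: add.commute)
qed

text \<open>This separates a constant of the machine from the dependence on \<open>T\<close>, which
  is quadratic because head positions are paired with cells.\<close>

lemma step_ands_le:
  "step_ands \<le> (ntapes M * nsyms M + ntapes M * nsyms M ^ ntapes M +
     nstates M * nsyms M ^ ntapes M * (1 + ntapes M + ntapes M * nsyms M)) * (2 * T + 1) ^ 2"
proof -
  define W where "W = 2 * T + 1"
  have W: "W \<ge> 1" "W ^ 2 \<ge> 1" "W \<le> W ^ 2" by (auto simp: W_def power2_eq_square)
  define K s U where "K = ntapes M" and "s = nsyms M" and "U = nstates M * s ^ K"
  have "step_ands = K * s * W ^ 2 + K * s ^ K + U + K * U * W + K * U * s * W ^ 2"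
    by (simp add: step_ands_def Let_def W_def K_def s_def U_def power2_eq_square algebra_simps)
  also have "\<dots> \<le> K * s * W ^ 2 + K * s ^ K * W ^ 2 + U * W ^ 2 + K * U * W ^ 2 + K * U * s * W ^ 2"
    using W by (intro add_mono) auto
  also have "\<dots> = (K * s + K * s ^ K + U * (1 + K + K * s)) * W ^ 2"
    by (simp add: algebra_simps)
  finally show ?thesis by (simp add: K_def s_def U_def W_def)
qed

text \<open>At time 0 a cell of the input is a function of one affine bit and everything else is
  constant, so no product is spent before the first step. Only cell 0 is followed to the end, since
  it holds a one-bit output.\<close>

lemma tm_cell_reach:
  assumes "\<And>x. length (w x) = N" "\<And>i. i < N \<Longrightarrow> (\<lambda>x. w x ! i) \<in> affine_span B"
  shows "(\<lambda>x. cell T 0 0 x = 2) \<in> and_reach B (T * step_ands)"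
proof -
  have K: "ntapes M \<ge> 2" using wf by (simp add: wf_tm_def)
  have "span_var B (cell 0 i p)" if "i < ntapes M" for i p
  proof (cases "i = 0 \<and> 0 \<le> p \<and> p < int N")
    case True
    have "span_var B (\<lambda>x. (\<lambda>b. if b then 2 else 1) (w x ! nat p) :: nat)"
      by (rule span_var_map[OF span_var_bool[OF assms(2)], of _ UNIV]) (use True in auto)
    then show ?thesis using True assms(1) by (simp add: run_def init_config_def bits_tape_def)
  next
    case False
    then have "cell 0 i p = (\<lambda>_. 0)"
      using that assms(1) by (cases i) (auto simp: run_def init_config_def bits_tape_def fun_eq_iff)
    then show ?thesis using span_var_const[of B 0] by simp
  qed
  moreover have "head 0 i = (\<lambda>_. 0)" if "i < ntapes M" for i
    using that by (cases i) (auto simp: run_def init_config_def bits_tape_def fun_eq_iff)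
  moreover have "(\<lambda>x. fst (cfg 0 x)) = (\<lambda>_. 0)" by (simp add: run_def init_config_def)
  ultimately have "config_var B 0" unfolding config_var_def by (auto intro: span_var_const)
  from config_var_run[OF this order.refl] obtain B' where
    B': "and_ext B (T * step_ands) B'" "config_var B' T" by blast
  then have "span_var B' (cell T 0 0)" using K by (auto simp: config_var_def)
  then have "(\<lambda>x. cell T 0 0 x = 2) \<in> affine_span B'" unfolding span_var_def by blast
  then show ?thesis using B'(1) unfolding and_reach_def by blast
qed

end

lemma tape_bits_single:
  assumes "tape_bits tp = [b]" shows "b \<longleftrightarrow> fst tp 0 = 2"
proof -
  have "tape_bits tp ! 0 = (fst tp (int 0) = 2)"
    using assms unfolding tape_bits_def by (subst nth_map) (auto simp: map_eq_Cons_conv upt_eq_Cons_conv)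
  then show ?thesis using assms by simp
qed

text \<open>Time \<open>T\<close> costs \<open>T\<close> steps of quadratic price, hence the cube.
  The constant \<open>D\<close> is fixed before the input words, their length and the time.\<close>

lemma tm_output_reach:
  assumes "wf_tm M"
  obtains D where "\<And>(w :: 'x \<Rightarrow> bool list) N B f T. (\<And>x. length (w x) = N) \<Longrightarrow>
    (\<And>i. i < N \<Longrightarrow> (\<lambda>x. w x ! i) \<in> affine_span B) \<Longrightarrow>
    (\<And>x. outputs_within M (w x) T [f x]) \<Longrightarrow> f \<in> and_reach B (D * (2 * T + 1) ^ 3)"
proof
  define D where "D = ntapes M * nsyms M + ntapes M * nsyms M ^ ntapes M +
     nstates M * nsyms M ^ ntapes M * (1 + ntapes M + ntapes M * nsyms M)"
  fix w :: "'x \<Rightarrow> bool list" and N B f T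
  assume *: "\<And>x. length (w x) = N" "\<And>i. i < N \<Longrightarrow> (\<lambda>x. w x ! i) \<in> affine_span B"
    "\<And>x. outputs_within M (w x) T [f x]"
  have "f = (\<lambda>x. fst (snd (run M (\<lambda>_. False) (w x) (replicate T False)) ! 0) 0 = 2)"
    using *(3) tape_bits_single unfolding outputs_within_def tm_output_def Let_def by blast
  moreover have "T * step_ands M T \<le> (2 * T + 1) * (D * (2 * T + 1) ^ 2)"
    using step_ands_le[OF assms, of T] by (intro mult_mono) (auto simp: D_def)
  then have "T * step_ands M T \<le> D * (2 * T + 1) ^ 3"
    by (simp only: power3_eq_cube power2_eq_square mult_ac)
  ultimately show "f \<in> and_reach B (D * (2 * T + 1) ^ 3)"
    using tm_cell_reach[OF assms *(1,2), of T] and_reach_mono by blast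
qed

section \<open>Structured programs for Turing machines\<close>

text \<open>
  A state of the machine built from a program is the list of commands still to be executed.  The
  empty list is the query state, so that a program runs up to its next query.  Writing a symbol
  \<open>\<ge> 3\<close> leaves the cell unchanged.  \<open>CMach q s c d\<close> runs the given machine from state \<open>q\<close>, with its
  tape \<open>0\<close> on tape \<open>0\<close> and its tape \<open>i > 0\<close> on tape \<open>i + 15\<close>.  The head of tape \<open>15\<close> follows the head
  of tape \<open>0\<close> and \<open>s\<close> keeps track of the side of cell \<open>0\<close> on which they are; when the machine halts,
  \<open>c\<close> or \<open>d\<close> is executed accordingly.
\<close>

datatype com = CAct nat nat int | CSeq com com | CIf nat "nat \<Rightarrow> bool" com com
  | CWhile nat "nat \<Rightarrow> bool" com | CHalt | CMach nat bool com com

type_synonym state = "com list \<times> (nat \<Rightarrow> tape)"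

abbreviation scan :: "(nat \<Rightarrow> tape) \<Rightarrow> nat \<Rightarrow> nat" where
  "scan T j \<equiv> fst (T j) (snd (T j))"

definition tape_index :: "nat \<Rightarrow> nat" where
  "tape_index i = (if i = 0 then 0 else i + 15)"

text \<open>In \<open>CMach\<close>, machine states out of range count as halting, so that the
  continuations form a finite set whatever symbols are read. The symbol 2 on tape 15 marks cell 0;
  when it is scanned, the move of tape 0 determines the new side.\<close>

fun prog_delta :: "tm \<Rightarrow> com list \<Rightarrow> (nat \<Rightarrow> nat) \<Rightarrow> com list \<times> (nat \<Rightarrow> nat \<times> int)" where
  "prog_delta M [] r = ([], \<lambda>i. (r i, 0))"
| "prog_delta M (CAct j s d # k) r =
    (k, \<lambda>i. if i = j then (if s < 3 then s else r i, sgn d) else (r i, 0))"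
| "prog_delta M (CSeq c d # k) r = (c # d # k, \<lambda>i. (r i, 0))"
| "prog_delta M (CIf j P c d # k) r = ((if P (r j) then c else d) # k, \<lambda>i. (r i, 0))"
| "prog_delta M (CWhile j P c # k) r =
    (if P (r j) then c # CWhile j P c # k else k, \<lambda>i. (r i, 0))"
| "prog_delta M (CHalt # k) r = (CHalt # k, \<lambda>i. (r i, 0))"
| "prog_delta M (CMach q s c d # k) r =
    (let qa = delta M q (map (\<lambda>i. r (tape_index i)) [0..<ntapes M]) False; q' = fst qa; as = snd qa;
         s' = (if r 15 = 2 then snd (as ! 0) \<ge> 0 else s)
     in (if q' = 1 \<or> q' \<ge> nstates M then (if s' then c else d) # k else CMach q' s' c d # k,
         \<lambda>i. if i = 0 then as ! 0 else if i = 15 then (r i, snd (as ! 0))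
             else if i \<ge> 16 then as ! (i - 15) else (r i, 0)))"

definition prog_step :: "tm \<Rightarrow> state \<Rightarrow> state" where
  "prog_step M \<sigma> = (fst (prog_delta M (fst \<sigma>) (scan (snd \<sigma>))),
     \<lambda>i. act (snd (prog_delta M (fst \<sigma>) (scan (snd \<sigma>))) i) (snd \<sigma> i))"

lemma act_keep [simp]: "act (fst tp (snd tp), 0) tp = tp"
  by (simp add: act_def)

definition active :: "com list \<Rightarrow> bool" where
  "active s \<longleftrightarrow> (case s of [] \<Rightarrow> False | c # _ \<Rightarrow> c \<noteq> CHalt)"

inductive reaches :: "tm \<Rightarrow> state \<Rightarrow> nat \<Rightarrow> state \<Rightarrow> bool" for M where
  refl: "reaches M \<sigma> 0 \<sigma>"
| step: "active s \<Longrightarrow> reaches M (prog_step M (s, T)) t \<sigma> \<Longrightarrow> reaches M (s, T) (Suc t) \<sigma>"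

lemma reaches_trans: "reaches M \<sigma> t \<sigma>' \<Longrightarrow> reaches M \<sigma>' u \<sigma>'' \<Longrightarrow> reaches M \<sigma> (t + u) \<sigma>''"
  by (induction rule: reaches.induct) (auto intro: reaches.intros)

lemma reaches_single: "active s \<Longrightarrow> prog_step M (s, T) = \<sigma> \<Longrightarrow> reaches M (s, T) 1 \<sigma>"
  using reaches.step[OF _ reaches.refl] by fastforce

text \<open>Quantifying over all continuations makes this a big-step semantics that composes. The
  step count in \<open>reaches\<close> is exact; here it becomes an upper bound, which may be met
  differently for different \<open>k\<close>.\<close>

definition exec :: "tm \<Rightarrow> com \<Rightarrow> (nat \<Rightarrow> tape) \<Rightarrow> nat \<Rightarrow> (nat \<Rightarrow> tape) \<Rightarrow> bool" where
  "exec M c T t T' \<longleftrightarrow> (\<forall>k. \<exists>t' \<le> t. reaches M (c # k, T) t' (k, T'))"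

lemma exec_mono: "exec M c T t T' \<Longrightarrow> t \<le> t' \<Longrightarrow> exec M c T t' T'"
  unfolding exec_def by (meson order.trans)

lemma exec_first_step:
  assumes "\<And>k. active (c # k)" "\<And>k. prog_step M (c # k, T) = (pre @ k, T')"
    and "\<And>k. \<exists>t' \<le> t. reaches M (pre @ k, T') t' (k, T'')"
  shows "exec M c T (Suc t) T''"
  unfolding exec_def
proof
  fix k
  obtain t' where "t' \<le> t" "reaches M (pre @ k, T') t' (k, T'')" using assms(3) by blast
  then show "\<exists>t' \<le> Suc t. reaches M (c # k, T) t' (k, T'')"
    using reaches.step[of "c # k" M T t'] assms(1,2) by (intro exI[of _ "Suc t'"]) auto
qed

lemma exec_act:
  "exec M (CAct j s d) T 1 (T(j := act (if s < 3 then s else scan T j, sgn d) (T j)))"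
proof -
  have "exec M (CAct j s d) T (Suc 0) (T(j := act (if s < 3 then s else scan T j, sgn d) (T j)))"
    (is "exec _ _ _ _ ?T")
  proof (rule exec_first_step[where pre = "[]" and T' = ?T])
    show "prog_step M (CAct j s d # k, T) = ([] @ k, ?T)" for k
      by (auto simp: prog_step_def fun_eq_iff[of "\<lambda>i. act _ _"])
  qed (auto simp: active_def intro: reaches.refl)
  then show ?thesis by simp
qed

lemma exec_seq:
  assumes "exec M c T t T'" "exec M d T' u T''" shows "exec M (CSeq c d) T (t + u + 1) T''"
proof -
  have "\<exists>t' \<le> t + u. reaches M (c # d # k, T) t' (k, T'')" for k
  proof -
    obtain t1 where "t1 \<le> t" "reaches M (c # d # k, T) t1 (d # k, T')"
      using assms(1) unfolding exec_def by blast
    moreover obtain t2 where "t2 \<le> u" "reaches M (d # k, T') t2 (k, T'')"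
      using assms(2) unfolding exec_def by blast
    ultimately show ?thesis using reaches_trans by (intro exI[of _ "t1 + t2"]) auto
  qed
  then have "exec M (CSeq c d) T (Suc (t + u)) T''"
    by (intro exec_first_step[where pre = "[c, d]" and T' = T]) (auto simp: active_def prog_step_def)
  then show ?thesis by simp
qed

lemma exec_if:
  assumes "exec M (if P (scan T j) then c else d) T t T'"
  shows "exec M (CIf j P c d) T (t + 1) T'"
proof -
  have "exec M (CIf j P c d) T (Suc t) T'"
    by (rule exec_first_step[where pre = "[if P (scan T j) then c else d]" and T' = T])
      (use assms in \<open>auto simp: active_def prog_step_def exec_def\<close>)
  then show ?thesis by simp
qed

lemma exec_while_end: "\<not> P (scan T j) \<Longrightarrow> exec M (CWhile j P c) T 1 T"
  using exec_first_step[where c = "CWhile j P c" and pre = "[]" and T' = T and T = T and t = 0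
      and M = M and T'' = T]
  by (auto simp: active_def prog_step_def intro: reaches.refl)

lemma exec_while_step:
  assumes "P (scan T j)" "exec M c T t T'" "exec M (CWhile j P c) T' u T''"
  shows "exec M (CWhile j P c) T (t + u + 1) T''"
proof -
  let ?w = "CWhile j P c"
  have "\<exists>t' \<le> t + u. reaches M (c # ?w # k, T) t' (k, T'')" for k
  proof -
    obtain t1 where "t1 \<le> t" "reaches M (c # ?w # k, T) t1 (?w # k, T')"
      using assms(2) unfolding exec_def by blast
    moreover obtain t2 where "t2 \<le> u" "reaches M (?w # k, T') t2 (k, T'')"
      using assms(3) unfolding exec_def by blast
    ultimately show ?thesis using reaches_trans by (intro exI[of _ "t1 + t2"]) auto
  qed
  then have "exec M ?w T (Suc (t + u)) T''"
    by (intro exec_first_step[where pre = "[c, ?w]" and T' = T])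
      (use assms(1) in \<open>auto simp: active_def prog_step_def\<close>)
  then show ?thesis by simp
qed

section \<open>The Turing machine of a program\<close>

text \<open>These are the command lists that can arise while \<open>c\<close> runs in front of
  \<open>k\<close>. A loop reappears as its own continuation instead of being unfolded, so the set
  is finite and can serve as the state set of a machine.\<close>

fun conts :: "tm \<Rightarrow> com \<Rightarrow> com list \<Rightarrow> com list set" where
  "conts M (CAct j s d) k = {CAct j s d # k}"
| "conts M (CSeq c d) k = {CSeq c d # k} \<union> conts M c (d # k) \<union> conts M d k"
| "conts M (CIf j P c d) k = {CIf j P c d # k} \<union> conts M c k \<union> conts M d k"
| "conts M (CWhile j P c) k = {CWhile j P c # k} \<union> conts M c (CWhile j P c # k)"
| "conts M CHalt k = {CHalt # k}"
| "conts M (CMach q s c d) k = {CMach q s c d # k} \<union>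
     (\<lambda>(q', s'). CMach q' s' c d # k) ` ({..<nstates M} \<times> UNIV) \<union> conts M c k \<union> conts M d k"

lemma finite_conts: "finite (conts M c k)"
  by (induction c arbitrary: k) auto

lemma conts_self: "c # k \<in> conts M c k"
  by (cases c) auto

lemma conts_step: "s \<in> conts M c k \<Longrightarrow> fst (prog_delta M s r) \<in> insert k (conts M c k)"
proof (induction c arbitrary: k)
  case (CSeq c d)
  then consider "s = CSeq c d # k" | "s \<in> conts M c (d # k)" | "s \<in> conts M d k" by auto
  then show ?case
  proof cases
    case 1
    then show ?thesis using conts_self[of c "d # k" M] by simp
  next
    case 2
    then show ?thesis using CSeq.IH(1)[OF 2] conts_self[of d k M] by auto
  next
    case 3
    then show ?thesis using CSeq.IH(2)[OF 3] by auto
  qed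
next
  case (CIf j P c d)
  then consider "s = CIf j P c d # k" | "s \<in> conts M c k" | "s \<in> conts M d k" by auto
  then show ?case
  proof cases
    case 1
    then show ?thesis using conts_self[of c k M] conts_self[of d k M] by simp
  next
    case 2
    then show ?thesis using CIf.IH(1)[OF 2] by auto
  next
    case 3
    then show ?thesis using CIf.IH(2)[OF 3] by auto
  qed
next
  case (CWhile j P c)
  then consider "s = CWhile j P c # k" | "s \<in> conts M c (CWhile j P c # k)" by auto
  then show ?case
  proof cases
    case 1
    then show ?thesis using conts_self[of c "CWhile j P c # k" M] by simp
  next
    case 2
    then show ?thesis using CWhile.IH[OF 2] by auto
  qed
next
  case (CMach q s' c d)
  then consider q' s'' where "s = CMach q' s'' c d # k" | "s \<in> conts M c k" | "s \<in> conts M d k"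
    by auto
  then show ?case
  proof cases
    case 1
    then show ?thesis using conts_self[of c k M] conts_self[of d k M] by (auto simp: Let_def)
  next
    case 2
    then show ?thesis using CMach.IH(1)[OF 2] by auto
  next
    case 3
    then show ?thesis using CMach.IH(2)[OF 3] by auto
  qed
qed auto

definition prog_states :: "tm \<Rightarrow> com \<Rightarrow> com \<Rightarrow> com \<Rightarrow> com list set" where
  "prog_states M p p1 p0 = {[]} \<union> conts M p [] \<union> conts M p1 [] \<union> conts M p0 []"

lemma finite_prog_states: "finite (prog_states M p p1 p0)"
  by (simp add: prog_states_def finite_conts)

lemma prog_states_start: "[p] \<in> prog_states M p p1 p0" "[p1] \<in> prog_states M p p1 p0"
    "[p0] \<in> prog_states M p p1 p0"
  using conts_self[of p "[]" M] conts_self[of p1 "[]" M] conts_self[of p0 "[]" M]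
  by (auto simp: prog_states_def)

lemma prog_states_step:
  "s \<in> prog_states M p p1 p0 \<Longrightarrow> fst (prog_delta M s r) \<in> prog_states M p p1 p0"
  unfolding prog_states_def
  using conts_step[of s M p "[]" r] conts_step[of s M p1 "[]" r] conts_step[of s M p0 "[]" r] by auto

context
  fixes M :: tm and p p1 p0 :: com
  assumes wf: "wf_tm M"
begin

abbreviation PS :: "com list set" where "PS \<equiv> prog_states M p p1 p0"

definition state_index :: "com list \<Rightarrow> nat" where
  "state_index = (SOME f. bij_betw f PS {0..<card PS})"

lemma state_index: "bij_betw state_index PS {0..<card PS}"
  unfolding state_index_def using ex_bij_betw_finite_nat[OF finite_prog_states[of M p p1 p0]]
  by (rule someI_ex)

text \<open>The states 0 to 4 are reserved by the model: the empty list becomes the query state,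
  every list headed by \<open>CHalt\<close> the halting state, and all others are numbered from 5
  on.\<close>

definition enc_state :: "com list \<Rightarrow> nat" where
  "enc_state s = (if s = [] then 2 else if hd s = CHalt then 1 else 5 + state_index s)"

text \<open>The answer states 3 and 4 carry no memory of the query, so they can only start the fixed
  programs \<open>p1\<close> and \<open>p0\<close>, which must find their place in the computation
  from the tapes.\<close>

definition prog_tm :: tm where
  "prog_tm = \<lparr>ntapes = ntapes M + 15, nsyms = nsyms M, nstates = 5 + card PS,
     delta = (\<lambda>q rs b. let r = (!) rs; K = ntapes M + 15 in
       if q = 0 then (enc_state [p], map (\<lambda>i. (r i, 0)) [0..<K])
       else if q = 3 then (enc_state [p1], map (\<lambda>i. (r i, 0)) [0..<K])
       else if q = 4 then (enc_state [p0], map (\<lambda>i. (r i, 0)) [0..<K])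
       else if q < 5 then (1, map (\<lambda>i. (r i, 0)) [0..<K])
       else let ka = prog_delta M (inv_into PS state_index (q - 5)) r
            in (enc_state (fst ka), map (snd ka) [0..<K]))\<rparr>"

lemma enc_state_bound: "s \<in> PS \<Longrightarrow> enc_state s < 5 + card PS"
  using state_index by (auto simp: enc_state_def bij_betw_def)

lemma prog_delta_wf:
  assumes "length rs = ntapes M + 15" "set rs \<subseteq> {..<nsyms M}" "i < ntapes M + 15"
    "\<And>q s c d k. s' = CMach q s c d # k \<Longrightarrow> q < nstates M"
  shows "snd (prog_delta M s' ((!) rs)) i \<in> {..<nsyms M} \<times> {-1, 0, 1}"
proof -
  have n: "nsyms M \<ge> 3" "ntapes M \<ge> 2" using wf by (auto simp: wf_tm_def)
  have rj: "rs ! j < nsyms M" if "j < ntapes M + 15" for j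
    using assms(1,2) that by (metis lessThan_iff nth_mem subsetD)
  note r = rj[OF assms(3)]
  show ?thesis
  proof (cases s')
    case Nil
    then show ?thesis using r by simp
  next
    case (Cons c' k)
    show ?thesis
    proof (cases c')
      case (CAct j s d)
      then show ?thesis using Cons r n by (auto simp: sgn_if)
    next
      case (CMach q s c d)
      define rm where "rm = map (\<lambda>i. rs ! tape_index i) [0..<ntapes M]"
      have "set rm \<subseteq> {..<nsyms M}" using rj by (auto simp: rm_def tape_index_def)
      moreover have "length rm = ntapes M" by (simp add: rm_def)
      moreover have "q < nstates M" using assms(4) CMach Cons by simp
      ultimately have *: "length (snd (delta M q rm False)) = ntapes M"
        "set (snd (delta M q rm False)) \<subseteq> {..<nsyms M} \<times> {-1, 0, 1}"
        using wf unfolding wf_tm_def by blast+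
      have "snd (delta M q rm False) ! j \<in> {..<nsyms M} \<times> {-1, 0, 1}" if "j < ntapes M" for j
        using * that nth_mem by (metis subsetD)
      from this[of 0] this[of "i - 15"] show ?thesis
        using Cons CMach n r assms(3) by (auto simp: Let_def mem_Times_iff simp flip: rm_def)
    qed (use Cons r in auto)
  qed
qed

end

fun prog_ok :: "tm \<Rightarrow> com \<Rightarrow> bool" where
  "prog_ok M (CSeq c d) \<longleftrightarrow> prog_ok M c \<and> prog_ok M d"
| "prog_ok M (CIf j P c d) \<longleftrightarrow> j < 16 \<and> prog_ok M c \<and> prog_ok M d"
| "prog_ok M (CWhile j P c) \<longleftrightarrow> j < 16 \<and> prog_ok M c"
| "prog_ok M (CMach q s c d) \<longleftrightarrow> q < nstates M \<and> prog_ok M c \<and> prog_ok M d"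
| "prog_ok M c \<longleftrightarrow> True"

lemma conts_ok: "s \<in> conts M c k \<Longrightarrow> prog_ok M c \<Longrightarrow> s \<noteq> [] \<and> prog_ok M (hd s)"
  by (induction c arbitrary: k) auto

lemma prog_states_ok:
  assumes "s \<in> prog_states M p p1 p0" "prog_ok M p" "prog_ok M p1" "prog_ok M p0" "s \<noteq> []"
  shows "prog_ok M (hd s)"
  using assms conts_ok[of s M p "[]"] conts_ok[of s M p1 "[]"] conts_ok[of s M p0 "[]"]
  by (auto simp: prog_states_def)

lemma wf_prog_tm:
  assumes "wf_tm M" "prog_ok M p" "prog_ok M p1" "prog_ok M p0"
  shows "wf_tm (prog_tm M p p1 p0)"
proof -
  have n: "nsyms M \<ge> 3" "ntapes M \<ge> 2" using assms(1) by (auto simp: wf_tm_def)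
  let ?S = "prog_states M p p1 p0"
  have ok: "q < nstates M" if "CMach q s c d # k \<in> ?S" for q s c d k
    using prog_states_ok[OF that assms(2-4)] by simp
  note start = prog_states_start[where M = M and p = p and ?p1.0 = p1 and ?p0.0 = p0]
  show ?thesis unfolding wf_tm_def
  proof (intro conjI allI impI)
    fix q rs b
    assume q: "q < nstates (prog_tm M p p1 p0)" and len: "length rs = ntapes (prog_tm M p p1 p0)"
      and sub: "set rs \<subseteq> {..<nsyms (prog_tm M p p1 p0)}"
    have len': "length rs = ntapes M + 15" and sub': "set rs \<subseteq> {..<nsyms M}"
      using len sub by (auto simp: prog_tm_def[OF assms(1)])
    have r: "rs ! i < nsyms M" if "i < ntapes M + 15" for i
      using len' sub' that nth_mem by (metis lessThan_iff subsetD)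
    define s where "s = inv_into ?S (state_index M p p1 p0) (q - 5)"
    have s: "s \<in> ?S" if "q \<ge> 5"
    proof -
      have "q - 5 \<in> state_index M p p1 p0 ` ?S"
        using state_index[OF assms(1), of p p1 p0] q that
        by (auto simp: bij_betw_def prog_tm_def[OF assms(1)])
      then show ?thesis unfolding s_def by (rule inv_into_into)
    qed
    note eb = enc_state_bound[OF assms(1), where p = p and ?p1.0 = p1 and ?p0.0 = p0]
    show "fst (delta (prog_tm M p p1 p0) q rs b) < nstates (prog_tm M p p1 p0)"
      using eb start eb[OF prog_states_step[OF s]]
      by (auto simp: prog_tm_def[OF assms(1)] Let_def simp flip: s_def)
    show "length (snd (delta (prog_tm M p p1 p0) q rs b)) = ntapes (prog_tm M p p1 p0)"
      by (auto simp: prog_tm_def[OF assms(1)] Let_def)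
    have "snd (prog_delta M s ((!) rs)) i \<in> {..<nsyms M} \<times> {-1, 0, 1}"
      if "i < ntapes M + 15" "q \<ge> 5" for i
      using prog_delta_wf[OF assms(1) len' sub' that(1), of s] ok s[OF that(2)] by blast
    then show "set (snd (delta (prog_tm M p p1 p0) q rs b)) \<subseteq> {..<nsyms (prog_tm M p p1 p0)} \<times> {- 1, 0, 1}"
      using r by (auto simp: prog_tm_def[OF assms(1)] Let_def image_subset_iff simp flip: s_def)
  qed (use n in \<open>auto simp: prog_tm_def[OF assms(1)]\<close>)
qed

text \<open>Asking for the same result under all coin sequences records that the machine is
  deterministic, so that later only the choice of the oracle is random.\<close>

definition tm_steps :: "tm \<Rightarrow> (bool list \<Rightarrow> bool) \<Rightarrow> config \<Rightarrow> nat \<Rightarrow> config \<Rightarrow> bool" where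
  "tm_steps A Q c t c' \<longleftrightarrow> (\<forall>coins. length coins = t \<longrightarrow> foldl (step A Q) c coins = c')"

lemma tm_steps_0: "tm_steps A Q c 0 c"
  by (simp add: tm_steps_def)

lemma tm_steps_trans:
  assumes "tm_steps A Q c t c'" "tm_steps A Q c' u c''" shows "tm_steps A Q c (t + u) c''"
  unfolding tm_steps_def
proof (intro allI impI)
  fix coins :: "bool list" assume l: "length coins = t + u"
  have "foldl (step A Q) c coins = foldl (step A Q) (foldl (step A Q) c (take t coins)) (drop t coins)"
    by (simp flip: foldl_append)
  then show "foldl (step A Q) c coins = c''" using assms l by (auto simp: tm_steps_def)
qed

lemma tm_steps_Suc:
  assumes "\<And>b. step A Q c b = c'" "tm_steps A Q c' t c''" shows "tm_steps A Q c (Suc t) c''"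
  using assms by (auto simp: tm_steps_def length_Suc_conv)

lemma step_halted: "halted c \<Longrightarrow> step A Q c b = c"
  by (cases c) (simp add: halted_def step_simps)

lemma halted_steps: "halted c \<Longrightarrow> tm_steps A Q c t c"
proof (induction t)
  case (Suc t)
  then show ?case by (intro tm_steps_Suc[OF step_halted])
qed (simp add: tm_steps_0)

definition prog_config :: "tm \<Rightarrow> com \<Rightarrow> com \<Rightarrow> com \<Rightarrow> state \<Rightarrow> config" where
  "prog_config M p p1 p0 \<sigma> = (enc_state M p p1 p0 (fst \<sigma>), map (snd \<sigma>) [0..<ntapes M + 15])"

lemma map2_act: "map2 act (map a [0..<K]) (map T [0..<K]) = map (\<lambda>i. act (a i) (T i)) [0..<K]"
  by (intro nth_equalityI) auto

text \<open>Programs are interpreted over infinitely many tapes, the machine has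
  \<open>ntapes M + 15\<close> of them. Both agree because tests are confined to tapes below 16 and
  the simulated machine uses exactly the tapes that exist.\<close>

lemma prog_delta_cong:
  assumes "\<And>i. i < ntapes M + 15 \<Longrightarrow> r i = r' i" "ntapes M \<ge> 2" "s \<noteq> [] \<Longrightarrow> prog_ok M (hd s)"
  shows "fst (prog_delta M s r) = fst (prog_delta M s r')"
    "i < ntapes M + 15 \<Longrightarrow> snd (prog_delta M s r) i = snd (prog_delta M s r') i"
proof -
  have m: "map (\<lambda>i. r (tape_index i)) [0..<ntapes M] = map (\<lambda>i. r' (tape_index i)) [0..<ntapes M]"
    using assms(1,2) by (auto simp: tape_index_def)
  have r: "j < 16 \<Longrightarrow> r j = r' j" for j using assms(1,2) by auto
  have 15: "r 15 = r' 15" using r by simp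
  have "fst (prog_delta M s r) = fst (prog_delta M s r') \<and>
    (i < ntapes M + 15 \<longrightarrow> snd (prog_delta M s r) i = snd (prog_delta M s r') i)"
  proof (cases s)
    case (Cons c k)
    have ok: "prog_ok M c" using assms(3) Cons by simp
    show ?thesis
    proof (cases c)
      case (CMach q s c d)
      show ?thesis unfolding Cons CMach prog_delta.simps m 15 using assms(1)[of i]
        by (simp add: Let_def 15)
    qed (use ok r assms(1)[of i] Cons in auto)
  qed (use assms(1) in auto)
  then show "fst (prog_delta M s r) = fst (prog_delta M s r')"
    "i < ntapes M + 15 \<Longrightarrow> snd (prog_delta M s r) i = snd (prog_delta M s r') i" by auto
qed

context
  fixes M p p1 p0
  assumes wf: "wf_tm M" and ok: "prog_ok M p" "prog_ok M p1" "prog_ok M p0"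
begin

private abbreviation "A \<equiv> prog_tm M p p1 p0"
private abbreviation "cf \<equiv> prog_config M p p1 p0"
private abbreviation "PS' \<equiv> prog_states M p p1 p0"

lemma step_active:
  assumes "s \<in> PS'" "active s"
  shows "step A Q (cf (s, T)) b = cf (prog_step M (s, T))"
proof -
  let ?K = "ntapes M + 15"
  let ?rs = "map (\<lambda>tp. fst tp (snd tp)) (map T [0..<?K])"
  have e: "enc_state M p p1 p0 s = 5 + state_index M p p1 p0 s"
    using assms(2) by (auto simp: enc_state_def[OF wf] active_def split: list.splits)
  have inv: "inv_into PS' (state_index M p p1 p0) (state_index M p p1 p0 s) = s"
    using state_index[OF wf, of p p1 p0] assms(1) by (simp add: bij_betw_def)
  have n: "ntapes M \<ge> 2" using wf by (simp add: wf_tm_def)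
  have c: "fst (prog_delta M s ((!) ?rs)) = fst (prog_delta M s (scan T))"
    "\<And>i. i < ?K \<Longrightarrow> snd (prog_delta M s ((!) ?rs)) i = snd (prog_delta M s (scan T)) i"
    by (rule prog_delta_cong; use n prog_states_ok[OF assms(1) ok] in simp)+
  have m: "map (snd (prog_delta M s ((!) ?rs))) [0..<?K] = map (snd (prog_delta M s (scan T))) [0..<?K]"
    using c(2) by simp
  have "delta A (enc_state M p p1 p0 s) ?rs b =
      (enc_state M p p1 p0 (fst (prog_delta M s (scan T))), map (snd (prog_delta M s (scan T))) [0..<?K])"
    using c(1) m by (simp add: prog_tm_def[OF wf] e inv)
  then show ?thesis
    unfolding prog_config_def fst_conv snd_conv step_simps
    by (simp add: e prog_step_def map2_act)
qed

lemma reaches_tm_steps: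
  "reaches M \<sigma> t \<sigma>' \<Longrightarrow> fst \<sigma> \<in> PS' \<Longrightarrow> tm_steps A Q (cf \<sigma>) t (cf \<sigma>') \<and> fst \<sigma>' \<in> PS'"
proof (induction rule: reaches.induct)
  case (refl \<sigma>)
  then show ?case by (simp add: tm_steps_0)
next
  case (step s T t \<sigma>)
  have "fst (prog_step M (s, T)) \<in> PS'"
    using prog_states_step step.prems by (simp add: prog_step_def)
  then show ?case using step tm_steps_Suc[OF step_active[of s Q T]] by auto
qed

lemma start_steps: "tm_steps A Q (0, map T [0..<ntapes M + 15]) 1 (cf ([p], T))"
  unfolding One_nat_def
  by (rule tm_steps_Suc[OF _ tm_steps_0])
    (auto simp: step_simps prog_config_def prog_tm_def[OF wf] Let_def map2_act intro!: nth_equalityI)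

lemma query_steps:
  "tm_steps A Q (cf ([], T)) 2 (cf ([if Q (tape_bits (T 1)) then p1 else p0], T))"
proof -
  let ?c = "(if Q (tape_bits (T 1)) then 3 else 4, map T [0..<ntapes M + 15]) :: config"
  have "step A Q (cf ([], T)) b = ?c" for b
    by (simp add: step_simps prog_config_def enc_state_def[OF wf])
  moreover have "step A Q ?c b = cf ([if Q (tape_bits (T 1)) then p1 else p0], T)" for b
    by (auto simp: step_simps prog_config_def prog_tm_def[OF wf] Let_def map2_act intro!: nth_equalityI)
  ultimately have "tm_steps A Q (cf ([], T)) (Suc (Suc 0)) (cf ([if Q (tape_bits (T 1)) then p1 else p0], T))"
    using tm_steps_Suc tm_steps_0 by metis
  then show ?thesis by (simp add: numeral_2_eq_2)
qed

end

section \<open>Simulating the given machine\<close>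

definition mark_tape :: "int \<Rightarrow> tape" where
  "mark_tape h = (\<lambda>i. if i = 0 then 2 else 0, h)"

definition runs_on :: "tm \<Rightarrow> tape list \<Rightarrow> (nat \<Rightarrow> tape) \<Rightarrow> bool" where
  "runs_on M tps T \<longleftrightarrow> length tps = ntapes M \<and> (\<forall>i < ntapes M. T (tape_index i) = tps ! i) \<and>
     T 15 = mark_tape (snd (tps ! 0))"

definition side_ok :: "bool \<Rightarrow> tape list \<Rightarrow> bool" where
  "side_ok s tps \<longleftrightarrow> (snd (tps ! 0) > 0 \<longrightarrow> s) \<and> (snd (tps ! 0) < 0 \<longrightarrow> \<not> s)"

text \<open>A head moves by at most one cell, so the side can change only in a step that starts on
  cell 0. There tape 15 shows its mark and the direction of the move gives the new side.\<close>

lemma prog_step_mach: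
  assumes wf: "wf_tm M" "wf_config M (q, tps)" and on: "runs_on M tps T" and side: "side_ok s tps"
    and q: "q \<noteq> 1" "q \<noteq> 2" and st: "step M Q (q, tps) False = (q', tps')"
  obtains s' T' where
    "\<And>k. prog_step M (CMach q s c d # k, T) =
      (if q' = 1 then (if s' then c else d) # k else CMach q' s' c d # k, T')"
    "runs_on M tps' T'" "side_ok s' tps'" "\<And>j. 0 < j \<Longrightarrow> j < 15 \<Longrightarrow> T' j = T j"
proof -
  define as where "as = snd (delta M q (head_syms tps) False)"
  have n: "ntapes M \<ge> 2" using wf by (simp add: wf_tm_def)
  have len: "length tps = ntapes M" using on by (simp add: runs_on_def)
  have q': "q' = fst (delta M q (head_syms tps) False)" and tps': "tps' = map2 act as tps"
    using st q by (auto simp: step_simps as_def)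
  have las: "length as = ntapes M" using wf_config_delta(2)[OF wf] by (simp add: as_def)
  have d0: "snd (as ! 0) \<in> {-1, 0, 1}" using wf_config_delta(4)[OF wf, of 0 False] n by (simp add: as_def)
  have bq: "q' < nstates M" using wf_config_delta(1)[OF wf] q' by simp
  have hs: "map (\<lambda>i. scan T (tape_index i)) [0..<ntapes M] = head_syms tps"
    using on by (intro nth_equalityI) (auto simp: runs_on_def)
  have T0: "T 0 = tps ! 0" using on n by (auto simp: runs_on_def tape_index_def dest: spec[of _ 0])
  have T15: "T 15 = mark_tape (snd (tps ! 0))" using on by (simp add: runs_on_def)
  define s' where "s' = (if scan T 15 = 2 then snd (as ! 0) \<ge> 0 else s)"
  define T' where "T' i = act (if i = 0 then as ! 0 else if i = 15 then (scan T i, snd (as ! 0))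
             else if i \<ge> 16 then as ! (i - 15) else (scan T i, 0)) (T i)" for i
  have tps'i: "tps' ! i = act (as ! i) (tps ! i)" if "i < ntapes M" for i
    using that las len by (simp add: tps')
  have 1: "prog_step M (CMach q s c d # k, T) =
      (if q' = 1 then (if s' then c else d) # k else CMach q' s' c d # k, T')" for k
    using bq unfolding q' s'_def T'_def[abs_def] as_def by (simp add: prog_step_def Let_def hs)
  have "T' (tape_index i) = tps' ! i" if "i < ntapes M" for i
    using that on T0 tps'i[OF that] by (auto simp: T'_def tape_index_def runs_on_def)
  moreover have "T' 15 = mark_tape (snd (tps' ! 0))"
    using tps'i[of 0] n by (simp add: T'_def T15 mark_tape_def act_def fun_eq_iff)
  ultimately have 2: "runs_on M tps' T'"
    using las len by (simp add: runs_on_def tps')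
  have "side_ok s' tps'"
    using side d0 tps'i[of 0] n by (auto simp: side_ok_def s'_def T15 mark_tape_def act_def)
  moreover have "\<And>j. 0 < j \<Longrightarrow> j < 15 \<Longrightarrow> T' j = T j" by (simp add: T'_def)
  ultimately show ?thesis using that 1 2 by metis
qed

lemma deterministic_not_query:
  assumes "deterministic_tm M" shows "fst (run M Q w cs) \<noteq> 2"
proof (induction cs rule: rev_induct)
  case Nil
  then show ?case by (simp add: run_def init_config_def)
next
  case (snoc b cs)
  obtain q tps where c: "run M Q w cs = (q, tps)" by fastforce
  have wf: "wf_tm M" using assms by (simp add: deterministic_tm_def)
  have wfc: "wf_config M (q, tps)" using wf_config_run[OF wf, of Q w cs] c by simp
  have "length (head_syms tps) = ntapes M" "set (head_syms tps) \<subseteq> {..<nsyms M}" "q < nstates M"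
    using wfc by (auto simp: wf_config_def in_set_conv_nth) (metis fst_conv)
  then have "fst (delta M q (head_syms tps) b) \<noteq> 2"
    using assms unfolding deterministic_tm_def by (metis (full_types))
  then show ?case using snoc by (auto simp: run_snoc c step_simps)
qed

text \<open>The simulation leaves \<open>CMach\<close> at the first halting time, which may come
  before \<open>t\<close>; from then on the configuration of the simulated machine is frozen, so the
  final tapes agree.\<close>

lemma reaches_mach:
  assumes det: "deterministic_tm M"
    and init: "runs_on M (snd (init_config M w)) T"
    and halt: "halted (run M (\<lambda>_. False) w (replicate t False))"
  obtains t' s T' where "t' \<le> t"
    "\<And>k. reaches M (CMach 0 True c d # k, T) t' ((if s then c else d) # k, T')"
    "runs_on M (snd (run M (\<lambda>_. False) w (replicate t False))) T'"
    "side_ok s (snd (run M (\<lambda>_. False) w (replicate t False)))"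
    "\<And>j. 0 < j \<Longrightarrow> j < 15 \<Longrightarrow> T' j = T j"
proof -
  define R where "R u = run M (\<lambda>_. False) w (replicate u False)" for u
  have wf: "wf_tm M" using det by (simp add: deterministic_tm_def)
  have R_Suc: "R (Suc u) = step M (\<lambda>_. False) (R u) False" for u
    unfolding R_def run_replicate_Suc ..
  have R0: "R 0 = init_config M w" by (simp add: R_def run_def)
  have inv: "\<exists>s T'. (\<forall>k. reaches M (CMach 0 True c d # k, T) u (CMach (fst (R u)) s c d # k, T')) \<and>
      runs_on M (snd (R u)) T' \<and> side_ok s (snd (R u)) \<and> (\<forall>j. 0 < j \<longrightarrow> j < 15 \<longrightarrow> T' j = T j)"
    if "\<forall>v \<le> u. \<not> halted (R v)" for u
    using that
  proof (induction u)
    case 0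
    have "side_ok True (snd (R 0))" by (simp add: side_ok_def R0 init_config_def bits_tape_def)
    moreover have "fst (R 0) = 0" by (simp add: R0 init_config_def)
    ultimately show ?case using init by (auto simp: R0 intro: reaches.refl)
  next
    case (Suc u)
    then obtain s Tu where IH: "\<And>k. reaches M (CMach 0 True c d # k, T) u (CMach (fst (R u)) s c d # k, Tu)"
      "runs_on M (snd (R u)) Tu" "side_ok s (snd (R u))" "\<And>j. 0 < j \<Longrightarrow> j < 15 \<Longrightarrow> Tu j = T j" by auto
    have q: "fst (R u) \<noteq> 1" "fst (R u) \<noteq> 2"
      using Suc.prems deterministic_not_query[OF det] by (auto simp: halted_def R_def)
    have wfc: "wf_config M (fst (R u), snd (R u))" using wf_config_run[OF wf] by (simp add: R_def)
    have "step M (\<lambda>_. False) (fst (R u), snd (R u)) False = (fst (R (Suc u)), snd (R (Suc u)))"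
      by (simp add: R_Suc)
    from prog_step_mach[OF wf wfc IH(2,3) q this] obtain s' T' where
      S: "\<And>k. prog_step M (CMach (fst (R u)) s c d # k, Tu) =
        (if fst (R (Suc u)) = 1 then (if s' then c else d) # k else CMach (fst (R (Suc u))) s' c d # k, T')"
      "runs_on M (snd (R (Suc u))) T'" "side_ok s' (snd (R (Suc u)))"
      "\<And>j. 0 < j \<Longrightarrow> j < 15 \<Longrightarrow> T' j = Tu j" by metis
    have nh: "fst (R (Suc u)) \<noteq> 1" using Suc.prems by (auto simp: halted_def)
    have "reaches M (CMach 0 True c d # k, T) (Suc u) (CMach (fst (R (Suc u))) s' c d # k, T')" for k
      using reaches_trans[OF IH(1) reaches_single[OF _ S(1)]] nh by (simp add: active_def)
    then show ?case using S IH(4) by (intro exI[of _ s'] exI[of _ T']) auto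
  qed
  \<comment> \<open>The step into the halting state is treated apart from the earlier ones, because
    it replaces the command by \<open>c\<close> or \<open>d\<close>.\<close>
  define u where "u = (LEAST u. halted (R u))"
  have hu: "halted (R u)" using halt LeastI[of "\<lambda>u. halted (R u)" t] by (simp add: u_def R_def)
  have ut: "u \<le> t" using halt Least_le[of "\<lambda>u. halted (R u)" t] by (simp add: u_def R_def)
  have "\<not> halted (R 0)" by (simp add: R0 init_config_def halted_def)
  then have "u \<noteq> 0" using hu by metis
  then obtain v where v: "u = Suc v" using not0_implies_Suc by blast
  have nh: "\<forall>v' \<le> v. \<not> halted (R v')"
  proof (intro allI impI)
    fix v' assume "v' \<le> v"
    then have "v' < u" using v by simp
    then show "\<not> halted (R v')" unfolding u_def by (rule not_less_Least)
  qed
  obtain s Tu where IH: "\<And>k. reaches M (CMach 0 True c d # k, T) v (CMach (fst (R v)) s c d # k, Tu)"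
      "runs_on M (snd (R v)) Tu" "side_ok s (snd (R v))" "\<And>j. 0 < j \<Longrightarrow> j < 15 \<Longrightarrow> Tu j = T j"
    using inv[OF nh] by blast
  have q: "fst (R v) \<noteq> 1" "fst (R v) \<noteq> 2"
    using nh deterministic_not_query[OF det] by (auto simp: halted_def R_def)
  have wfc: "wf_config M (fst (R v), snd (R v))" using wf_config_run[OF wf] by (simp add: R_def)
  have "step M (\<lambda>_. False) (fst (R v), snd (R v)) False = (fst (R u), snd (R u))"
    by (simp add: R_Suc v)
  from prog_step_mach[OF wf wfc IH(2,3) q this] obtain s' T' where
    S: "\<And>k. prog_step M (CMach (fst (R v)) s c d # k, Tu) =
      (if fst (R u) = 1 then (if s' then c else d) # k else CMach (fst (R u)) s' c d # k, T')"
    "runs_on M (snd (R u)) T'" "side_ok s' (snd (R u))"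
    "\<And>j. 0 < j \<Longrightarrow> j < 15 \<Longrightarrow> T' j = Tu j" by metis
  have "fst (R u) = 1" using hu by (simp add: halted_def)
  then have "reaches M (CMach 0 True c d # k, T) u ((if s' then c else d) # k, T')" for k
    using reaches_trans[OF IH(1) reaches_single[OF _ S(1)]] by (simp add: active_def v)
  moreover have "R t = R u"
  proof -
    have "R (u + e) = R u" for e
    proof (induction e)
      case (Suc e)
      then show ?case using step_halted[OF hu] by (simp add: R_Suc)
    qed simp
    from this[of "t - u"] ut show ?thesis by simp
  qed
  ultimately show ?thesis using S(2,3,4) IH(4) ut
    by (intro that[of u s' T']) (simp_all add: R_def)
qed

section \<open>Registers\<close>

text \<open>
  A register is a bit string with blanks on both sides; between commands the head is on its last
  symbol.  On the tapes \<open>0\<close> and \<open>1\<close> registers begin in cell \<open>0\<close>, on the other tapes in cell \<open>1\<close>, so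
  that initially blank tapes are empty registers.
\<close>

definition bit_sym :: "bool \<Rightarrow> nat" where
  "bit_sym b = (if b then 2 else 1)"

definition cells :: "int \<Rightarrow> bool list \<Rightarrow> int \<Rightarrow> nat" where
  "cells o' bs p = (if o' < p \<and> p \<le> o' + int (length bs) then bit_sym (bs ! nat (p - o' - 1)) else 0)"

definition reg_tape :: "int \<Rightarrow> bool list \<Rightarrow> tape" where
  "reg_tape o' bs = (cells o' bs, o' + int (length bs))"

lemma bit_sym_simps [simp]: "bit_sym b \<noteq> 0" "bit_sym b = 2 \<longleftrightarrow> b" "bit_sym b < 3"
  "bit_sym b = Suc 0 \<longleftrightarrow> \<not> b"
  by (auto simp: bit_sym_def)

lemma cells_at: "i < length bs \<Longrightarrow> cells o' bs (o' + 1 + int i) = bit_sym (bs ! i)"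
  by (simp add: cells_def)

lemma cells_outside [simp]: "cells o' bs o' = 0" "cells o' bs (o' + 1 + int (length bs)) = 0"
  by (simp_all add: cells_def)

lemma cells_eq_0_iff: "cells o' bs p = 0 \<longleftrightarrow> \<not> (o' < p \<and> p \<le> o' + int (length bs))"
  by (simp add: cells_def)

lemma scan_reg_tape:
  "fst (reg_tape o' bs) (snd (reg_tape o' bs)) = (if bs = [] then 0 else bit_sym (last bs))"
  by (cases bs rule: rev_cases) (auto simp: reg_tape_def cells_def)

lemma cells_snoc: "(cells o' bs)(o' + 1 + int (length bs) := bit_sym b) = cells o' (bs @ [b])"
  by (rule ext) (auto simp: cells_def nth_append)

lemma cells_butlast:
  "bs \<noteq> [] \<Longrightarrow> (cells o' bs)(o' + int (length bs) := 0) = cells o' (butlast bs)"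
  by (rule ext) (auto simp: cells_def nth_butlast)

definition cpush :: "nat \<Rightarrow> bool \<Rightarrow> com" where
  "cpush j b = CSeq (CAct j 3 1) (CAct j (bit_sym b) 0)"

definition cpop :: "nat \<Rightarrow> com" where
  "cpop j = CIf j (\<lambda>s. s = 0) (CAct j 3 0) (CAct j 0 (-1))"

definition cclear :: "nat \<Rightarrow> com" where
  "cclear j = CWhile j (\<lambda>s. s \<noteq> 0) (CAct j 0 (-1))"

definition cleft :: "nat \<Rightarrow> com" where
  "cleft j = CWhile j (\<lambda>s. s \<noteq> 0) (CAct j 3 (-1))"

text \<open>The source is read from its left end to keep the order of the bits. It is not consumed,
  and its head returns to the last symbol, as the convention for registers demands.\<close>

definition capp :: "nat \<Rightarrow> nat \<Rightarrow> com" where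
  "capp i j = CSeq (cleft i) (CSeq (CAct i 3 1) (CSeq
     (CWhile i (\<lambda>s. s \<noteq> 0) (CSeq (CIf i (\<lambda>s. s = 2) (cpush j True) (cpush j False)) (CAct i 3 1)))
     (CAct i 3 (-1))))"

lemma exec_act': "T' = T(j := act (if s < 3 then s else scan T j, sgn d) (T j)) \<Longrightarrow>
    exec M (CAct j s d) T 1 T'"
  using exec_act by simp

lemma exec_move: "T' = T(j := (fst (T j), snd (T j) + sgn d)) \<Longrightarrow> exec M (CAct j 3 d) T 1 T'"
  using exec_act[of M j 3 d T] by (simp add: act_def)

lemma exec_push:
  assumes "T j = reg_tape o' bs"
  shows "exec M (cpush j b) T 3 (T(j := reg_tape o' (bs @ [b])))"
proof -
  let ?T = "T(j := (cells o' bs, o' + 1 + int (length bs)))"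
  have 1: "exec M (CAct j 3 1) T 1 ?T"
    by (rule exec_move) (simp add: assms reg_tape_def add_ac)
  have 2: "exec M (CAct j (bit_sym b) 0) ?T 1 (T(j := reg_tape o' (bs @ [b])))"
    by (rule exec_act') (simp add: act_def reg_tape_def cells_snoc[unfolded add.assoc] add.assoc)
  show ?thesis unfolding cpush_def by (rule exec_mono[OF exec_seq[OF 1 2]]) simp
qed

lemma exec_pop_nonempty:
  assumes "T j = reg_tape o' bs" "bs \<noteq> []"
  shows "exec M (CAct j 0 (-1)) T 1 (T(j := reg_tape o' (butlast bs)))"
  by (rule exec_act') (use assms in \<open>auto simp: act_def reg_tape_def cells_butlast of_nat_diff
      Suc_le_eq\<close>)

lemma exec_pop:
  assumes "T j = reg_tape o' bs"
  shows "exec M (cpop j) T 2 (T(j := reg_tape o' (butlast bs)))"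
proof -
  have s: "scan T j = (if bs = [] then 0 else bit_sym (last bs))" using assms scan_reg_tape by simp
  have "exec M (CAct j 3 0) T 1 (T(j := reg_tape o' (butlast bs)))" if "bs = []"
    by (rule exec_move) (use that assms in \<open>auto simp: reg_tape_def\<close>)
  then have "exec M (if scan T j = 0 then CAct j 3 0 else CAct j 0 (-1)) T 1 (T(j := reg_tape o' (butlast bs)))"
    using s exec_pop_nonempty[of T j o' bs M, OF assms] by auto
  from exec_mono[OF exec_if[where P = "\<lambda>s. s = 0", OF this]] show ?thesis
    unfolding cpop_def by (simp del: fun_upd_apply)
qed

lemma exec_clear:
  "T j = reg_tape o' bs \<Longrightarrow> exec M (cclear j) T (2 * length bs + 1) (T(j := reg_tape o' []))"
proof (induction bs arbitrary: T rule: rev_induct)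
  case Nil
  have "T(j := reg_tape o' []) = T" using Nil by auto
  then show ?case unfolding cclear_def using exec_while_end[of "\<lambda>s. s \<noteq> 0" T j] Nil
    by (simp add: scan_reg_tape)
next
  case (snoc b bs)
  let ?T = "T(j := reg_tape o' bs)"
  have 1: "exec M (CAct j 0 (-1)) T 1 ?T" using exec_pop_nonempty[of T j o' "bs @ [b]" M, OF snoc.prems] by simp
  have 2: "exec M (cclear j) ?T (2 * length bs + 1) (T(j := reg_tape o' []))"
    using snoc.IH[of ?T] by (simp del: fun_upd_apply add: fun_upd_same)
  have 3: "scan T j \<noteq> 0" by (simp add: snoc.prems scan_reg_tape)
  show ?case unfolding cclear_def
    by (rule exec_mono[OF exec_while_step[where P = "\<lambda>s. s \<noteq> 0", OF 3 1 2[unfolded cclear_def]]]) simp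
qed

lemma exec_left:
  assumes "m \<le> length bs"
  shows "exec M (cleft j) (T(j := (cells o' bs, o' + int m))) (2 * m + 1) (T(j := (cells o' bs, o')))"
  using assms
proof (induction m)
  case 0
  have "exec M (cleft j) (T(j := (cells o' bs, o'))) 1 (T(j := (cells o' bs, o')))"
    unfolding cleft_def by (rule exec_while_end) simp
  then show ?case by (simp del: fun_upd_apply)
next
  case (Suc m)
  let ?T = "T(j := (cells o' bs, o' + int (Suc m)))"
  have 1: "exec M (CAct j 3 (-1)) ?T 1 (T(j := (cells o' bs, o' + int m)))"
    by (rule exec_move) simp
  have 2: "scan ?T j \<noteq> 0" using Suc.prems by (simp add: cells_eq_0_iff)
  have 3: "exec M (cleft j) (T(j := (cells o' bs, o' + int m))) (2 * m + 1) (T(j := (cells o' bs, o')))"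
    using Suc by (simp del: fun_upd_apply)
  show ?case unfolding cleft_def
    by (rule exec_mono[OF exec_while_step[where P = "\<lambda>s. s \<noteq> 0", OF 2 1 3[unfolded cleft_def]]]) simp
qed

lemma exec_app:
  assumes "T i = reg_tape oi bs" "T j = reg_tape oj cs" "i \<noteq> j"
  shows "exec M (capp i j) T (10 * length bs + 10) (T(j := reg_tape oj (cs @ bs)))"
proof -
  let ?f = "cells oi bs"
  have Ti: "T(i := (?f, oi + int (length bs))) = T" using assms(1) by (auto simp: reg_tape_def)
  have 1: "exec M (cleft i) T (2 * length bs + 1) (T(i := (?f, oi)))"
    using exec_left[of "length bs" bs M i T oi] by (simp add: Ti)
  have 2: "exec M (CAct i 3 1) (T(i := (?f, oi))) 1 (T(i := (?f, oi + 1)))"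
    by (rule exec_move) simp
  let ?b = "CSeq (CIf i (\<lambda>s. s = 2) (cpush j True) (cpush j False)) (CAct i 3 1)"
  \<comment> \<open>Here \<open>m\<close> counts the symbols that are still to be copied.\<close>
  have loop: "exec M (CWhile i (\<lambda>s. s \<noteq> 0) ?b)
      (T(i := (?f, oi + 1 + int (length bs - m)), j := reg_tape oj (cs @ take (length bs - m) bs))) (7 * m + 1)
      (T(i := (?f, oi + 1 + int (length bs)), j := reg_tape oj (cs @ bs)))" if "m \<le> length bs" for m
    using that
  proof (induction m)
    case 0
    let ?T = "T(i := (?f, oi + 1 + int (length bs)), j := reg_tape oj (cs @ bs))"
    have "exec M (CWhile i (\<lambda>s. s \<noteq> 0) ?b) ?T 1 ?T"
      by (rule exec_while_end) (use assms(3) in simp)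
    then show ?case by (simp del: fun_upd_apply)
  next
    case (Suc m)
    define u where "u = length bs - Suc m"
    have u: "u < length bs" "length bs - m = Suc u" using Suc.prems by (auto simp: u_def)
    let ?T = "T(i := (?f, oi + 1 + int u), j := reg_tape oj (cs @ take u bs))"
    let ?T1 = "T(i := (?f, oi + 1 + int u), j := reg_tape oj (cs @ take (Suc u) bs))"
    have sc: "scan ?T i = bit_sym (bs ! u)" using assms(3) u cells_at by simp
    have tk: "cs @ take (Suc u) bs = (cs @ take u bs) @ [bs ! u]" using u by (simp add: take_Suc_conv_app_nth)
    have "exec M (cpush j (bs ! u)) ?T 3 ?T1"
      unfolding tk using exec_push[of ?T j oj "cs @ take u bs" M "bs ! u"] by simp
    then have "exec M (if scan ?T i = 2 then cpush j True else cpush j False) ?T 3 ?T1"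
      unfolding sc by (cases "bs ! u") auto
    then have "exec M (CIf i (\<lambda>s. s = 2) (cpush j True) (cpush j False)) ?T (3 + 1) ?T1"
      by (rule exec_if)
    moreover have "exec M (CAct i 3 1) ?T1 1
        (T(i := (?f, oi + 1 + int (Suc u)), j := reg_tape oj (cs @ take (Suc u) bs)))"
      by (rule exec_move) (use assms(3) in \<open>auto simp: fun_eq_iff\<close>)
    ultimately have "exec M ?b ?T (3 + 1 + 1 + 1)
        (T(i := (?f, oi + 1 + int (Suc u)), j := reg_tape oj (cs @ take (Suc u) bs)))"
      by (rule exec_seq)
    moreover have "scan ?T i \<noteq> 0" by (simp add: sc del: fun_upd_apply)
    moreover have "exec M (CWhile i (\<lambda>s. s \<noteq> 0) ?b)
        (T(i := (?f, oi + 1 + int (Suc u)), j := reg_tape oj (cs @ take (Suc u) bs))) (7 * m + 1)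
        (T(i := (?f, oi + 1 + int (length bs)), j := reg_tape oj (cs @ bs)))"
      using Suc.IH Suc.prems unfolding u(2) by (simp del: fun_upd_apply)
    ultimately have "exec M (CWhile i (\<lambda>s. s \<noteq> 0) ?b) ?T ((3 + 1 + 1 + 1) + (7 * m + 1) + 1)
        (T(i := (?f, oi + 1 + int (length bs)), j := reg_tape oj (cs @ bs)))"
      by (intro exec_while_step[where P = "\<lambda>s. s \<noteq> 0"])
    from exec_mono[OF this] show ?case unfolding u_def by (simp del: fun_upd_apply)
  qed
  have "T(i := (?f, oi + 1), j := reg_tape oj cs) = T(i := (?f, oi + 1))"
    using assms(2,3) by (auto simp: fun_eq_iff)
  then have 3: "exec M (CWhile i (\<lambda>s. s \<noteq> 0) ?b) (T(i := (?f, oi + 1))) (7 * length bs + 1)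
      (T(i := (?f, oi + 1 + int (length bs)), j := reg_tape oj (cs @ bs)))"
    using loop[of "length bs"] by simp
  have "(T(i := (?f, oi + 1 + int (length bs)), j := reg_tape oj (cs @ bs)))
      (i := (?f, oi + int (length bs))) = T(j := reg_tape oj (cs @ bs))"
    using assms(1,3) by (auto simp: fun_eq_iff reg_tape_def)
  then have 4: "exec M (CAct i 3 (-1)) (T(i := (?f, oi + 1 + int (length bs)), j := reg_tape oj (cs @ bs))) 1
      (T(j := reg_tape oj (cs @ bs)))"
    using assms(3) by (intro exec_move) simp
  have "exec M (capp i j) T (2 * length bs + 1 + (1 + (7 * length bs + 1 + 1 + 1) + 1) + 1)
      (T(j := reg_tape oj (cs @ bs)))"
    unfolding capp_def by (rule exec_seq[OF 1 exec_seq[OF 2 exec_seq[OF 3 4]]])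
  then show ?thesis by (rule exec_mono) simp
qed

section \<open>Straight-line register programs\<close>

definition reg_offset :: "nat \<Rightarrow> int" where
  "reg_offset j = (if j < 2 then -1 else 0)"

text \<open>Tapes beyond the list are empty registers, which for these tapes means blank with the
  head on cell 0. So a finite list also describes the still untouched tapes of the simulated
  machine.\<close>

definition regs :: "bool list list \<Rightarrow> nat \<Rightarrow> tape" where
  "regs R j = reg_tape (reg_offset j) (if j < length R then R ! j else [])"

lemma regs_nth: "j < length R \<Longrightarrow> regs R j = reg_tape (reg_offset j) (R ! j)"
  by (simp add: regs_def)

lemma regs_update:
  "j < length R \<Longrightarrow> (regs R)(j := reg_tape (reg_offset j) bs) = regs (R[j := bs])"
  by (rule ext) (simp add: regs_def nth_list_update)

lemma scan_regs: "j < length R \<Longrightarrow> scan (regs R) j = (if R ! j = [] then 0 else bit_sym (last (R ! j)))"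
  by (simp add: regs_nth scan_reg_tape)

datatype op = Push nat bool | Pop nat | Clear nat | App nat nat

fun op_com :: "op \<Rightarrow> com" where
  "op_com (Push j b) = cpush j b"
| "op_com (Pop j) = cpop j"
| "op_com (Clear j) = cclear j"
| "op_com (App i j) = capp i j"

fun op_sem :: "op \<Rightarrow> bool list list \<Rightarrow> bool list list" where
  "op_sem (Push j b) R = R[j := R ! j @ [b]]"
| "op_sem (Pop j) R = R[j := butlast (R ! j)]"
| "op_sem (Clear j) R = R[j := []]"
| "op_sem (App i j) R = R[j := R ! j @ R ! i]"

text \<open>The bounds are rounded up so that a push or pop, together with the step that sequences
  it, counts exactly 10.\<close>

fun op_time :: "op \<Rightarrow> bool list list \<Rightarrow> nat" where
  "op_time (Push j b) R = 9"
| "op_time (Pop j) R = 9"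
| "op_time (Clear j) R = 10 * length (R ! j) + 9"
| "op_time (App i j) R = 10 * length (R ! i) + 10"

fun op_ok :: "op \<Rightarrow> bool" where
  "op_ok (Push j b) \<longleftrightarrow> j < 15"
| "op_ok (Pop j) \<longleftrightarrow> j < 15"
| "op_ok (Clear j) \<longleftrightarrow> j < 15"
| "op_ok (App i j) \<longleftrightarrow> i < 15 \<and> j < 15 \<and> i \<noteq> j"

fun ops_com :: "op list \<Rightarrow> com" where
  "ops_com [] = CAct 0 3 0"
| "ops_com (x # xs) = CSeq (op_com x) (ops_com xs)"

fun ops_sem :: "op list \<Rightarrow> bool list list \<Rightarrow> bool list list" where
  "ops_sem [] R = R"
| "ops_sem (x # xs) R = ops_sem xs (op_sem x R)"

fun ops_time :: "op list \<Rightarrow> bool list list \<Rightarrow> nat" where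
  "ops_time [] R = 1"
| "ops_time (x # xs) R = op_time x R + ops_time xs (op_sem x R) + 1"

definition rexec :: "tm \<Rightarrow> com \<Rightarrow> bool list list \<Rightarrow> nat \<Rightarrow> bool list list \<Rightarrow> bool" where
  "rexec M c R t R' \<longleftrightarrow> length R' = 15 \<and> exec M c (regs R) t (regs R')"

lemma length_op_sem [simp]: "length (op_sem x R) = length R"
  by (cases x) auto

lemma length_ops_sem [simp]: "length (ops_sem xs R) = length R"
  by (induction xs arbitrary: R) auto

lemma exec_op:
  assumes "length R = 15" "op_ok x" shows "exec M (op_com x) (regs R) (op_time x R) (regs (op_sem x R))"
proof (cases x)
  case (Push j b)
  then show ?thesis using exec_push[of "regs R" j, OF regs_nth, of M b] assms
    by (simp add: regs_update exec_mono)
next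
  case (Pop j)
  then show ?thesis using exec_pop[of "regs R" j, OF regs_nth, of M] assms
    by (simp add: regs_update exec_mono)
next
  case (Clear j)
  then show ?thesis using exec_clear[of "regs R" j, OF regs_nth, of M] assms
    by (simp add: regs_update exec_mono)
next
  case (App i j)
  then show ?thesis using exec_app[of "regs R" i _ _ j, OF regs_nth regs_nth, of M] assms
    by (simp add: regs_update)
qed

lemma rexec_ops:
  "length R = 15 \<Longrightarrow> list_all op_ok xs \<Longrightarrow> rexec M (ops_com xs) R (ops_time xs R) (ops_sem xs R)"
proof (induction xs arbitrary: R)
  case Nil
  have "exec M (CAct 0 3 0) (regs R) 1 (regs R)" by (rule exec_act') (simp add: act_def)
  then show ?case using Nil by (simp add: rexec_def)
next
  case (Cons x xs)
  then show ?case using exec_seq[OF exec_op[of R x M]] by (auto simp: rexec_def)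
qed

lemma rexec_ops':
  assumes "length R = 15" "list_all op_ok xs" "ops_sem xs R = R'" "ops_time xs R \<le> t"
  shows "rexec M (ops_com xs) R t R'"
  using rexec_ops[OF assms(1,2)] assms(3,4) exec_mono unfolding rexec_def by blast

lemma rexec_mono: "rexec M c R t R' \<Longrightarrow> t \<le> t' \<Longrightarrow> rexec M c R t' R'"
  unfolding rexec_def using exec_mono by blast

lemma rexec_seq:
  assumes "rexec M c R t R'" "rexec M d R' u R''" "t + u + 1 \<le> v" shows "rexec M (CSeq c d) R v R''"
  using assms exec_mono[OF exec_seq] unfolding rexec_def by blast

lemma rexec_if:
  assumes "length R = 15" "j < 15" "rexec M (if P (if R ! j = [] then 0 else bit_sym (last (R ! j))) then c else d) R t R'"
    "t + 1 \<le> v"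
  shows "rexec M (CIf j P c d) R v R'"
  using assms exec_mono[OF exec_if, of M P "regs R" j c d t "regs R'" v]
  unfolding rexec_def by (simp add: scan_regs)

lemma rexec_while_end:
  assumes "length R = 15" "j < 15" "\<not> P (if R ! j = [] then 0 else bit_sym (last (R ! j)))" "1 \<le> v"
  shows "rexec M (CWhile j P c) R v R"
  using assms exec_mono[OF exec_while_end, of P "regs R" j v M c]
  unfolding rexec_def by (simp add: scan_regs)

lemma rexec_while_step:
  assumes "length R = 15" "j < 15" "P (if R ! j = [] then 0 else bit_sym (last (R ! j)))"
    "rexec M c R t R'" "rexec M (CWhile j P c) R' u R''" "t + u + 1 \<le> v"
  shows "rexec M (CWhile j P c) R v R''"
  using assms exec_mono[OF exec_while_step, of P "regs R" j M c t "regs R'" u "regs R''" v]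
  unfolding rexec_def by (simp add: scan_regs)

section \<open>The binary counter\<close>

text \<open>The least significant bit is the last one, where the head is. Register \<open>z\<close>
  remembers in unary how many trailing ones have to come back as zeros, and \<open>ov\<close> deals
  with a counter consisting of ones only.\<close>

definition cinc :: "nat \<Rightarrow> nat \<Rightarrow> com \<Rightarrow> com" where
  "cinc x z ov = CSeq (CWhile x (\<lambda>s. s = 2) (ops_com [Pop x, Push z True]))
     (CSeq (CIf x (\<lambda>s. s = 0) ov (ops_com [Pop x, Push x True]))
           (CWhile z (\<lambda>s. s \<noteq> 0) (ops_com [Pop z, Push x False])))"

lemma rexec_inc_down:
  assumes "length R = 15" "x < 15" "z < 15" "x \<noteq> z" "R ! x = ys @ replicate m True" "ys = [] \<or> \<not> last ys"
  shows "rexec M (CWhile x (\<lambda>s. s = 2) (ops_com [Pop x, Push z True])) R (30 * m + 1)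
    (R[x := ys, z := R ! z @ replicate m True])"
  using assms
proof (induction m arbitrary: R)
  case 0
  then have "R[x := ys] = R" using list_update_id[of R x] by simp
  then have "R[x := ys, z := R ! z @ replicate 0 True] = R" by simp
  then show ?case using 0 by (auto intro!: rexec_while_end split: if_splits)
next
  case (Suc m)
  let ?R = "R[x := ys @ replicate m True, z := R ! z @ [True]]"
  have eq: "ys @ replicate (Suc m) True = (ys @ replicate m True) @ [True]"
    by (simp add: replicate_append_same)
  have 1: "rexec M (ops_com [Pop x, Push z True]) R 28 ?R"
    by (rule rexec_ops') (use Suc.prems eq in \<open>auto simp: butlast_append simp del: append_assoc\<close>)
  have 2: "rexec M (CWhile x (\<lambda>s. s = 2) (ops_com [Pop x, Push z True])) ?R (30 * m + 1)
    (?R[x := ys, z := ?R ! z @ replicate m True])"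
    by (rule Suc.IH) (use Suc.prems in \<open>auto simp: nth_list_update\<close>)
  have 3: "?R[x := ys, z := ?R ! z @ replicate m True] = R[x := ys, z := R ! z @ replicate (Suc m) True]"
    using Suc.prems unfolding list_eq_iff_nth_eq[where 'a = "bool list"] by (auto simp: nth_list_update replicate_append_same)
  show ?case
    by (rule rexec_while_step[OF _ _ _ 1 2[unfolded 3]])
      (use Suc.prems eq in \<open>auto simp del: append_assoc\<close>)
qed

lemma rexec_inc_up:
  assumes "length R = 15" "x < 15" "z < 15" "x \<noteq> z" "R ! z = replicate m True"
  shows "rexec M (CWhile z (\<lambda>s. s \<noteq> 0) (ops_com [Pop z, Push x False])) R (30 * m + 1)
    (R[z := [], x := R ! x @ replicate m False])"
  using assms
proof (induction m arbitrary: R)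
  case 0
  then have "R[z := []] = R" using list_update_id[of R z] by simp
  then have "R[z := [], x := R ! x @ replicate 0 False] = R" by simp
  then show ?case using 0 by (auto intro!: rexec_while_end split: if_splits)
next
  case (Suc m)
  let ?R = "R[z := replicate m True, x := R ! x @ [False]]"
  have eq: "replicate (Suc m) True = replicate m True @ [True]"
    by (simp add: replicate_append_same)
  have 1: "rexec M (ops_com [Pop z, Push x False]) R 28 ?R"
    by (rule rexec_ops') (use Suc.prems eq in \<open>auto simp: butlast_append simp del: append_assoc replicate_Suc\<close>)
  have 2: "rexec M (CWhile z (\<lambda>s. s \<noteq> 0) (ops_com [Pop z, Push x False])) ?R (30 * m + 1)
    (?R[z := [], x := ?R ! x @ replicate m False])"
    by (rule Suc.IH) (use Suc.prems in \<open>auto simp: nth_list_update\<close>)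
  have 3: "?R[z := [], x := ?R ! x @ replicate m False] = R[z := [], x := R ! x @ replicate (Suc m) False]"
    using Suc.prems unfolding list_eq_iff_nth_eq[where 'a = "bool list"] by (auto simp: nth_list_update replicate_append_same)
  show ?case
    by (rule rexec_while_step[OF _ _ _ 1 2[unfolded 3]]) (use Suc.prems in auto)
qed

lemma rexec_inc:
  assumes "length R = 15" "x < 15" "z < 15" "x \<noteq> z" "R ! x = ys @ False # replicate m True" "R ! z = []"
  shows "rexec M (cinc x z ov) R (60 * m + 50) (R[x := ys @ True # replicate m False])"
proof -
  have 1: "rexec M (CWhile x (\<lambda>s. s = 2) (ops_com [Pop x, Push z True])) R (30 * m + 1)
    (R[x := ys @ [False], z := R ! z @ replicate m True])" (is "rexec _ _ _ _ ?R1")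
    by (rule rexec_inc_down) (use assms in auto)
  have 2: "rexec M (CIf x (\<lambda>s. s = 0) ov (ops_com [Pop x, Push x True])) ?R1 30
      (R[x := ys @ [True], z := replicate m True])" (is "rexec _ _ _ _ ?R2")
  proof (rule rexec_if)
    have "ops_sem [Pop x, Push x True] ?R1 = ?R2" using assms
      unfolding list_eq_iff_nth_eq[where 'a = "bool list"] by (auto simp: nth_list_update)
    then have "rexec M (ops_com [Pop x, Push x True]) ?R1 28 ?R2"
      by (intro rexec_ops') (use assms in auto)
    then show "rexec M (if (if ?R1 ! x = [] then 0 else bit_sym (last (?R1 ! x))) = 0 then ov
        else ops_com [Pop x, Push x True]) ?R1 28 ?R2"
      using assms by simp
  qed (use assms in auto)
  have 3: "rexec M (CWhile z (\<lambda>s. s \<noteq> 0) (ops_com [Pop z, Push x False])) ?R2 (30 * m + 1)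
      (?R2[z := [], x := ?R2 ! x @ replicate m False])"
    by (rule rexec_inc_up) (use assms in auto)
  have 4: "?R2[z := [], x := ?R2 ! x @ replicate m False] = R[x := ys @ True # replicate m False]"
    using assms unfolding list_eq_iff_nth_eq[where 'a = "bool list"] by (auto simp: nth_list_update)
  show ?thesis unfolding cinc_def
    by (rule rexec_seq[OF 1 rexec_seq[OF 2 3[unfolded 4] order.refl]]) simp
qed

text \<open>The nested updates cover two uses: with \<open>v = x\<close> the counter gains a leading
  digit, with another \<open>v\<close> a flag is raised and the counter restarts at zero.\<close>

lemma rexec_inc_overflow:
  assumes "length R = 15" "x < 15" "z < 15" "x \<noteq> z" "R ! x = replicate m True" "R ! z = []" "v < 15" "v \<noteq> z"
  shows "rexec M (cinc x z (ops_com [Push v True])) R (60 * m + 50)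
    (let R' = R[x := []]; R'' = R'[v := R' ! v @ [True]] in R''[x := R'' ! x @ replicate m False])"
proof -
  define R' where "R' = R[x := []]"
  define R'' where "R'' = R'[v := R' ! v @ [True]]"
  have 1: "rexec M (CWhile x (\<lambda>s. s = 2) (ops_com [Pop x, Push z True])) R (30 * m + 1)
    (R[x := [], z := R ! z @ replicate m True])" (is "rexec _ _ _ _ ?R1")
    by (rule rexec_inc_down) (use assms in auto)
  have 2: "rexec M (CIf x (\<lambda>s. s = 0) (ops_com [Push v True]) (ops_com [Pop x, Push x True])) ?R1 30
      (R''[z := replicate m True])" (is "rexec _ _ _ _ ?R2")
  proof (rule rexec_if)
    have "ops_sem [Push v True] ?R1 = ?R2" using assms
      unfolding list_eq_iff_nth_eq[where 'a = "bool list"] by (auto simp: nth_list_update R''_def R'_def)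
    then have "rexec M (ops_com [Push v True]) ?R1 28 ?R2"
      by (intro rexec_ops') (use assms in auto)
    then show "rexec M (if (if ?R1 ! x = [] then 0 else bit_sym (last (?R1 ! x))) = 0 then ops_com [Push v True]
        else ops_com [Pop x, Push x True]) ?R1 28 ?R2"
      using assms by simp
  qed (use assms in auto)
  have 3: "rexec M (CWhile z (\<lambda>s. s \<noteq> 0) (ops_com [Pop z, Push x False])) ?R2 (30 * m + 1)
      (?R2[z := [], x := ?R2 ! x @ replicate m False])"
    by (rule rexec_inc_up) (use assms in \<open>auto simp: R''_def R'_def\<close>)
  have 4: "?R2[z := [], x := ?R2 ! x @ replicate m False] = R''[x := R'' ! x @ replicate m False]"
    using assms unfolding list_eq_iff_nth_eq[where 'a = "bool list"] by (auto simp: nth_list_update R''_def R'_def)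
  show ?thesis unfolding cinc_def Let_def R'_def[symmetric] R''_def[symmetric]
    by (rule rexec_seq[OF 1 rexec_seq[OF 2 3[unfolded 4] order.refl]]) simp
qed

section \<open>Truth-table circuits\<close>

text \<open>
  Nodes \<open>I\<close> and \<open>I + 1\<close> are the constants 1 and 0.  A point \<open>x\<close> contributes its minterm, a chain of
  conjunctions of literals \<open>y\<^sub>j + x\<^sub>j + 1\<close>, which is added to the node that sums the previous minterms.
  Input \<open>j\<close> is compared with the \<open>j\<close>-th bit of \<open>x\<close> from the right.
\<close>

fun chain_gates :: "nat \<Rightarrow> nat \<Rightarrow> nat \<Rightarrow> bool list \<Rightarrow> gate list" where
  "chain_gates I q j [] = []"
| "chain_gates I q j (b # bs) =
     Xor j (if b then Suc I else I) # And (q - 1) q # chain_gates I (Suc (Suc q)) (Suc j) bs"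

text \<open>The gate \<open>One\<close> at node \<open>q\<close> is the empty product from which the
  chain starts. The last gate adds the finished minterm to node \<open>q - 1\<close>, the sum so
  far, and thereby becomes the new last node.\<close>

definition point_gates :: "nat \<Rightarrow> nat \<Rightarrow> bool list \<Rightarrow> gate list" where
  "point_gates I q x = One # chain_gates I (Suc q) 0 (rev x) @ [Xor (q - 1) (q + 2 * length x)]"

definition tt_gates :: "nat \<Rightarrow> bool list list \<Rightarrow> gate list" where
  "tt_gates I xs = foldl (\<lambda>gs x. gs @ point_gates I (I + length gs) x) [One, Xor I I] xs"

definition tt_circuit :: "nat \<Rightarrow> bool list list \<Rightarrow> circuit" where
  "tt_circuit I xs = \<lparr>inputs = I, gates = tt_gates I xs, out = I + length (tt_gates I xs) - 1\<rparr>"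

lemma length_chain_gates [simp]: "length (chain_gates I q j bs) = 2 * length bs"
  by (induction bs arbitrary: q j) auto

lemma length_point_gates [simp]: "length (point_gates I q x) = 2 * length x + 2"
  by (simp add: point_gates_def)

lemma tt_gates_Nil: "tt_gates I [] = [One, Xor I I]"
  by (simp add: tt_gates_def)

lemma tt_gates_snoc:
  "tt_gates I (xs @ [x]) = tt_gates I xs @ point_gates I (I + length (tt_gates I xs)) x"
  by (simp add: tt_gates_def)

lemma length_tt_gates:
  "\<forall>x \<in> set xs. length x = l \<Longrightarrow> length (tt_gates I xs) = 2 + length xs * (2 * l + 2)"
  by (induction xs rule: rev_induct) (auto simp: tt_gates_Nil tt_gates_snoc)

lemma length_tt_gates_ge: "2 \<le> length (tt_gates I xs)"
  by (induction xs rule: rev_induct) (auto simp: tt_gates_Nil tt_gates_snoc)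

lemma gates_ok_append:
  "gates_ok n (gs @ hs) \<longleftrightarrow> gates_ok n gs \<and> gates_ok (n + length gs) hs"
proof (induction hs rule: rev_induct)
  case Nil
  then show ?case by (simp add: gates_ok_def)
next
  case (snoc h hs)
  then show ?case using gates_ok_snoc[of n "gs @ hs" h] gates_ok_snoc[of "n + length gs" hs h]
    by (auto simp: add.assoc)
qed

lemma gates_ok_Cons:
  "gates_ok n (g # gs) \<longleftrightarrow> (\<forall>j \<in> gate_args g. j < n) \<and> gates_ok (Suc n) gs"
  using gates_ok_append[of n "[g]" gs] by (simp add: gates_ok_def)

lemma gates_ok_Nil [simp]: "gates_ok n []"
  by (simp add: gates_ok_def)

lemma gates_ok_chain:
  "Suc I < q \<Longrightarrow> j + length bs \<le> I \<Longrightarrow> gates_ok q (chain_gates I q j bs)"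
  by (induction bs arbitrary: q j) (auto simp: gates_ok_Cons)

lemma gates_ok_tt:
  assumes "\<forall>x \<in> set xs. length x \<le> I" shows "gates_ok I (tt_gates I xs)"
  using assms
proof (induction xs rule: rev_induct)
  case Nil
  then show ?case by (auto simp: tt_gates_Nil gates_ok_Cons)
next
  case (snoc x xs)
  then show ?case using length_tt_gates_ge[of I xs]
    by (auto simp: tt_gates_snoc gates_ok_append point_gates_def gates_ok_Cons intro!: gates_ok_chain)
qed

lemma wf_tt_circuit: "\<forall>x \<in> set xs. length x \<le> I \<Longrightarrow> wf_circuit (tt_circuit I xs)"
  using gates_ok_tt[of xs I] length_tt_gates_ge[of I xs] by (auto simp: wf_circuit_iff tt_circuit_def)

lemma nth_gate_vals_old: "i < length vs \<Longrightarrow> gate_vals gs vs ! i = vs ! i"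
  using nth_gate_vals_append[of i vs "[]" gs] by simp

text \<open>The running product is always the last node: each round appends a literal and then its
  product with the previous last node. This invariant is why the induction is over arbitrary
  \<open>vs\<close>.\<close>

lemma gate_vals_chain:
  assumes "Suc I < length vs" "vs ! I" "\<not> vs ! Suc I" "j + length bs \<le> I"
  shows "gate_vals (chain_gates I (length vs) j bs) vs ! (length vs - 1 + 2 * length bs) \<longleftrightarrow>
    vs ! (length vs - 1) \<and> (\<forall>i < length bs. vs ! (j + i) = bs ! i)"
  using assms
proof (induction bs arbitrary: vs j)
  case (Cons b bs)
  define v1 where "v1 = (vs ! j \<noteq> vs ! (if b then Suc I else I))"
  define v2 where "v2 = (vs ! (length vs - 1) \<and> v1)"
  let ?vs = "vs @ [v1, v2]"
  have lt: "length vs - Suc 0 < length vs" using Cons.prems by simp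
  have v1: "v1 \<longleftrightarrow> vs ! j = b" using Cons.prems by (auto simp: v1_def)
  have e1: "gate_vals (chain_gates I (length vs) j (b # bs)) vs =
      gate_vals (chain_gates I (length ?vs) (Suc j) bs) ?vs"
    using Cons.prems lt by (simp add: gate_vals_Cons v1_def v2_def nth_append)
  have e2: "gate_vals (chain_gates I (length ?vs) (Suc j) bs) ?vs ! (length ?vs - 1 + 2 * length bs) \<longleftrightarrow>
    ?vs ! (length ?vs - 1) \<and> (\<forall>i < length bs. ?vs ! (Suc j + i) = bs ! i)"
    by (rule Cons.IH) (use Cons.prems in \<open>auto simp: nth_append\<close>)
  have e3: "(\<forall>i < length bs. ?vs ! (Suc j + i) = bs ! i) \<longleftrightarrow> (\<forall>i < length bs. vs ! (Suc j + i) = bs ! i)"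
    using Cons.prems by (auto simp: nth_append)
  have e4: "?vs ! (length ?vs - 1) = v2" by (simp add: nth_append)
  have e5: "length vs - 1 + 2 * length (b # bs) = length ?vs - 1 + 2 * length bs"
    using Cons.prems by simp
  show ?case unfolding e1 e5 e2 e3 e4 unfolding v2_def v1 by (simp add: All_less_Suc2)
qed simp

lemma gate_vals_point:
  assumes "Suc I < length vs" "vs ! I" "\<not> vs ! Suc I" "length x \<le> I"
  shows "gate_vals (point_gates I (length vs) x) vs ! (length vs + 2 * length x + 1) \<longleftrightarrow>
    vs ! (length vs - 1) \<noteq> (\<forall>i < length x. vs ! i = rev x ! i)"
proof -
  let ?vs = "vs @ [True]"
  let ?ch = "chain_gates I (length ?vs) 0 (rev x)"
  have "gate_vals ?ch ?vs ! (length ?vs - 1 + 2 * length (rev x)) \<longleftrightarrow>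
      ?vs ! (length ?vs - 1) \<and> (\<forall>i < length (rev x). ?vs ! (0 + i) = rev x ! i)"
    by (rule gate_vals_chain) (use assms in \<open>auto simp: nth_append\<close>)
  then have 1: "gate_vals ?ch ?vs ! (length vs + 2 * length x) \<longleftrightarrow> (\<forall>i < length x. vs ! i = rev x ! i)"
    using assms by (auto simp: nth_append)
  have 2: "gate_vals ?ch ?vs ! (length vs - 1) = vs ! (length vs - 1)"
    using assms by (subst nth_gate_vals_old) (auto simp: nth_append)
  have "gate_vals (point_gates I (length vs) x) vs = gate_vals (?ch @ [Xor (length vs - 1) (length vs + 2 * length x)]) ?vs"
    by (simp add: point_gates_def gate_vals_Cons)
  then show ?thesis using 1 2 by (simp add: nth_append)
qed

text \<open>Minterms of different points are never true together, so for a list without repetitions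
  their sum over the field with two elements is their disjunction.\<close>

lemma gate_vals_tt:
  assumes "length y = I" "l \<le> I" "\<forall>x \<in> set xs. length x = l" "distinct xs"
  shows "gate_vals (tt_gates I xs) y ! (I + length (tt_gates I xs) - 1) \<longleftrightarrow> rev (take l y) \<in> set xs"
    and "gate_vals (tt_gates I xs) y ! I" and "\<not> gate_vals (tt_gates I xs) y ! Suc I"
  using assms(3,4)
proof (induction xs rule: rev_induct)
  case Nil
  case 1
  then show ?case using assms(1) by (simp add: tt_gates_Nil gate_vals_Cons nth_append)
  case 2
  then show ?case using assms(1) by (simp add: tt_gates_Nil gate_vals_Cons nth_append)
  case 3
  then show ?case using assms(1) by (simp add: tt_gates_Nil gate_vals_Cons nth_append)
next
  case (snoc x xs)
  define vs where "vs = gate_vals (tt_gates I xs) y"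
  have len: "length vs = I + length (tt_gates I xs)" using assms(1) by (simp add: vs_def)
  have ge: "Suc I < length vs" using length_tt_gates_ge[of I xs] len by simp
  have eq: "gate_vals (tt_gates I (xs @ [x])) y = gate_vals (point_gates I (length vs) x) vs"
    by (simp add: tt_gates_snoc gate_vals_append vs_def assms(1))
  {
    case 1
    then have x: "length x = l" "x \<notin> set xs" and IH: "vs ! (length vs - 1) \<longleftrightarrow> rev (take l y) \<in> set xs" "vs ! I" "\<not> vs ! Suc I"
      using snoc.IH len by (auto simp: vs_def)
    have old: "vs ! i = y ! i" if "i < I" for i
      using that assms(1) nth_gate_vals_old[of i y] by (simp add: vs_def)
    have "(\<forall>i < length x. vs ! i = rev x ! i) \<longleftrightarrow> take l y = rev x"
      using x(1) assms(1,2) old by (auto simp: list_eq_iff_nth_eq)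
    also have "\<dots> \<longleftrightarrow> rev (take l y) = x" by (metis rev_rev_ident)
    finally have "gate_vals (point_gates I (length vs) x) vs ! (length vs + 2 * length x + 1) \<longleftrightarrow>
        rev (take l y) \<in> set (xs @ [x])"
      using gate_vals_point[of I vs x] ge IH x assms(2) by auto
    moreover have "I + length (tt_gates I (xs @ [x])) - 1 = length vs + 2 * length x + 1"
      using len by (simp add: tt_gates_snoc)
    ultimately show ?case unfolding eq by simp
  }
  {
    case 2
    then show ?case unfolding eq using ge snoc.IH by (subst nth_gate_vals_old) (auto simp: vs_def)
  }
  {
    case 3
    then show ?case unfolding eq using ge snoc.IH by (subst nth_gate_vals_old) (auto simp: vs_def)
  }
qed

lemma circuit_fun_tt:
  assumes "length y = I" "l \<le> I" "\<forall>x \<in> set xs. length x = l" "distinct xs"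
  shows "circuit_fun (tt_circuit I xs) y \<longleftrightarrow> rev (take l y) \<in> set xs"
  using gate_vals_tt(1)[OF assms] by (simp add: circuit_fun_gate_vals tt_circuit_def)

section \<open>Emitting gates\<close>

definition un :: "nat \<Rightarrow> bool list" where
  "un k = replicate k True"

lemma un_simps [simp]: "un 0 = []" "un (Suc k) = un k @ [True]" "length (un k) = k"
    "un (numeral m) = un (pred_numeral m) @ [True]"
  by (simp_all add: un_def replicate_append_same numeral_eq_Suc)

lemma un_add_numeral [simp]: "un (k + numeral m) = un (k + pred_numeral m) @ [True]"
  using un_simps(2)[of "k + pred_numeral m"] by (simp add: numeral_eq_Suc)

lemma un_eq_Nil [simp]: "un k = [] \<longleftrightarrow> k = 0"
  by (simp add: un_def)

lemma un_add: "un (a + b) = un a @ un b"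
  by (simp add: un_def replicate_add)

lemma enc_nat_un: "enc_nat a = un a @ [False]"
  by (simp add: enc_nat_def un_def)

definition enc_gates :: "gate list \<Rightarrow> bool list" where
  "enc_gates gs = concat (map enc_gate gs)"

lemma enc_gates_simps [simp]: "enc_gates [] = []" "enc_gates (g # gs) = enc_gate g @ enc_gates gs"
  "enc_gates (gs @ hs) = enc_gates gs @ enc_gates hs"
  by (simp_all add: enc_gates_def)

lemma length_enc_gate: "\<forall>j \<in> gate_args g. j \<le> N \<Longrightarrow> length (enc_gate g) \<le> 2 * N + 4"
  by (cases g) (auto simp: enc_nat_def)

lemma length_enc_gates: "gates_ok n gs \<Longrightarrow> length (enc_gates gs) \<le> length gs * (2 * (n + length gs) + 4)"
proof (induction gs rule: rev_induct)
  case (snoc g gs)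
  have "length (enc_gate g) \<le> 2 * (n + length gs) + 4"
    using snoc.prems by (intro length_enc_gate) (auto simp: gates_ok_snoc)
  then have "length (enc_gates (gs @ [g])) \<le> length gs * (2 * (n + length gs) + 4) + (2 * (n + length gs) + 4)"
    using snoc by (auto simp: gates_ok_snoc)
  also have "\<dots> \<le> length (gs @ [g]) * (2 * (n + length (gs @ [g])) + 4)" by (simp add: algebra_simps)
  finally show ?case .
qed simp

text \<open>
  The registers: \<open>0\<close> the input and later the encoded circuit, \<open>1\<close> the query, \<open>2\<close> the padding of the
  queries, \<open>3\<close> the length of the input in binary, \<open>4\<close> the current point, \<open>5\<close> its bits already used
  (during the initialisation: its length in unary), \<open>6\<close> the carries of the counter, \<open>7\<close> the exponent
  of the threshold, \<open>12\<close> the encoded gates, \<open>14\<close> the overflow of the counter; and in unary: \<open>8\<close> the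
  number of inputs, \<open>9\<close> the index of the next gate minus 2, \<open>10\<close> the node that sums the minterms, \<open>11\<close>
  the index of the current literal, \<open>13\<close> the number of gates.
\<close>

definition lit_ops :: "bool \<Rightarrow> op list" where
  "lit_ops b = [Pop 4, Push 5 b, Push 12 True, Push 12 True, App 11 12, Push 12 False, App 8 12] @
     (if b then [Push 12 True] else []) @ [Push 12 False, Push 13 True, Push 9 True]"

text \<open>If the literal just emitted is node q, register 9 now holds q - 1. So it supplies the
  first operand as it is, and the second one with an additional \<open>True\<close>; this is the
  reason for the offset 2 of that register.\<close>

definition and_ops :: "op list" where
  "and_ops = [Push 12 True, Push 12 False, App 9 12, Push 12 False, App 9 12, Push 12 True, Push 12 False,
     Push 13 True, Push 9 True, Push 11 True]"

definition chain_com :: com where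
  "chain_com = CWhile 4 (\<lambda>s. s \<noteq> 0)
     (CSeq (CIf 4 (\<lambda>s. s = 2) (ops_com (lit_ops True)) (ops_com (lit_ops False))) (ops_com and_ops))"

text \<open>\<open>K\<close> bounds the registers copied anywhere in the chain, so every literal has
  the same time bound. The bits are moved to register 5 as they are used, from where the point is
  restored afterwards.\<close>

lemma rexec_chain:
  assumes "j + length bs + I + 2 * (p + 2 * length bs) \<le> K"
  shows "rexec M chain_com
    [w, q, pad, bb, rev bs, ys, z, h, un I, un p, acc, un j, g, un cnt, ov]
    (length bs * (10 * K + 400) + 1)
    [w, q, pad, bb, [], ys @ bs, z, h, un I, un (p + 2 * length bs), acc, un (j + length bs),
      g @ enc_gates (chain_gates I (p + 2) j bs), un (cnt + 2 * length bs), ov]"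
  using assms
proof (induction bs arbitrary: j p g cnt ys)
  case Nil
  then show ?case unfolding chain_com_def by (auto intro!: rexec_while_end)
next
  case (Cons b bs)
  let ?R = "[w, q, pad, bb, rev (b # bs), ys, z, h, un I, un p, acc, un j, g, un cnt, ov]"
  let ?R1 = "[w, q, pad, bb, rev bs, ys @ [b], z, h, un I, un (p + 1), acc, un j,
    g @ enc_gate (Xor j (if b then Suc I else I)), un (cnt + 1), ov]"
  let ?R2 = "[w, q, pad, bb, rev bs, ys @ [b], z, h, un I, un (p + 2), acc, un (j + 1),
    g @ enc_gate (Xor j (if b then Suc I else I)) @ enc_gate (And (p + 1) (p + 2)), un (cnt + 2), ov]"
  have "rexec M (ops_com (lit_ops b)) ?R (10 * j + 10 * I + 140) ?R1"
    by (rule rexec_ops') (auto simp: lit_ops_def enc_nat_un)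
  then have 1: "rexec M (CIf 4 (\<lambda>s. s = 2) (ops_com (lit_ops True)) (ops_com (lit_ops False))) ?R
      (10 * j + 10 * I + 141) ?R1"
    by (intro rexec_if) (cases b, auto)
  have 2: "rexec M (ops_com and_ops) ?R1 (20 * p + 160) ?R2"
    by (rule rexec_ops') (auto simp: and_ops_def enc_nat_un)
  have 3: "rexec M chain_com ?R2 (length bs * (10 * K + 400) + 1)
    [w, q, pad, bb, [], (ys @ [b]) @ bs, z, h, un I, un ((p + 2) + 2 * length bs), acc, un ((j + 1) + length bs),
      (g @ enc_gate (Xor j (if b then Suc I else I)) @ enc_gate (And (p + 1) (p + 2))) @
        enc_gates (chain_gates I ((p + 2) + 2) (j + 1) bs), un ((cnt + 2) + 2 * length bs), ov]"
    by (rule Cons.IH) (use Cons.prems in simp)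
  have 4: "[w, q, pad, bb, [], (ys @ [b]) @ bs, z, h, un I, un ((p + 2) + 2 * length bs), acc, un ((j + 1) + length bs),
      (g @ enc_gate (Xor j (if b then Suc I else I)) @ enc_gate (And (p + 1) (p + 2))) @
        enc_gates (chain_gates I ((p + 2) + 2) (j + 1) bs), un ((cnt + 2) + 2 * length bs), ov] =
     [w, q, pad, bb, [], ys @ (b # bs), z, h, un I, un (p + 2 * length (b # bs)), acc, un (j + length (b # bs)),
      g @ enc_gates (chain_gates I (p + 2) j (b # bs)), un (cnt + 2 * length (b # bs)), ov]"
    by simp
  show ?case unfolding chain_com_def
    by (rule rexec_while_step[OF _ _ _ rexec_seq[OF 1 2 order.refl] 3[unfolded 4 chain_com_def]])
      (use Cons.prems in auto)
qed

definition restore_com :: com where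
  "restore_com = CWhile 5 (\<lambda>s. s \<noteq> 0)
     (CIf 5 (\<lambda>s. s = 2) (ops_com [Pop 5, Push 4 True]) (ops_com [Pop 5, Push 4 False]))"

lemma rexec_restore:
  "rexec M restore_com [w, q, pad, bb, x, ys, z, h, i, p, acc, j, g, cnt, ov] (length ys * 40 + 1)
     [w, q, pad, bb, x @ rev ys, [], z, h, i, p, acc, j, g, cnt, ov]"
proof (induction ys arbitrary: x rule: rev_induct)
  case Nil
  then show ?case unfolding restore_com_def by (auto intro!: rexec_while_end)
next
  case (snoc b ys)
  let ?R = "[w, q, pad, bb, x, ys @ [b], z, h, i, p, acc, j, g, cnt, ov]"
  let ?R1 = "[w, q, pad, bb, x @ [b], ys, z, h, i, p, acc, j, g, cnt, ov]"
  have "rexec M (ops_com [Pop 5, Push 4 b]) ?R 22 ?R1"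
    by (rule rexec_ops') auto
  then have 1: "rexec M (CIf 5 (\<lambda>s. s = 2) (ops_com [Pop 5, Push 4 True]) (ops_com [Pop 5, Push 4 False])) ?R 23 ?R1"
    by (intro rexec_if) (cases b, auto)
  have eq: "(x @ [b]) @ rev ys = x @ rev (ys @ [b])" by simp
  show ?case unfolding restore_com_def
    by (rule rexec_while_step[OF _ _ _ 1 snoc.IH[of "x @ [b]", unfolded restore_com_def eq]]) auto
qed

text \<open>The last operations make the gate just emitted the new sum: register 10 becomes one more
  than register 9, which is the index of the last gate.\<close>

definition emit_com :: com where
  "emit_com = CSeq (ops_com [Push 12 False, Push 12 False, Push 13 True, Push 9 True])
     (CSeq chain_com (CSeq restore_com (ops_com
       [Clear 11, Push 12 True, Push 12 True, App 10 12, Push 12 False, App 9 12, Push 12 True,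
        Push 12 False, Push 13 True, Push 9 True, Clear 10, App 9 10, Push 10 True])))"

text \<open>The state between two points. The two constant gates are always present and
  \<open>c\<close> counts the others, so the latest gate, which is the current sum, is node
  \<open>I + c + 1\<close>.\<close>

definition main_regs ::
  "nat \<Rightarrow> bool list \<Rightarrow> bool list \<Rightarrow> bool list \<Rightarrow> nat \<Rightarrow> bool list \<Rightarrow> bool list \<Rightarrow> bool list \<Rightarrow> bool list list" where
  "main_regs I h pad x c g q ov =
     [[], q, pad, [], x, [], [], h, un I, un (I + c), un (I + c + 1), [], g, un (c + 2), ov]"

lemma rexec_emit:
  assumes "length x + I + 2 * (I + c + 1 + 2 * length x) \<le> K"
  shows "rexec M emit_com (main_regs I h pad x c g q ov) ((length x + 1) * (100 * K + 700))
    (main_regs I h pad x (c + 2 * length x + 2) (g @ enc_gates (point_gates I (I + c + 2) x)) q ov)"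
proof -
  let ?l = "length x"
  have 1: "rexec M (ops_com [Push 12 False, Push 12 False, Push 13 True, Push 9 True])
    (main_regs I h pad x c g q ov) 50
    [[], q, pad, [], x, [], [], h, un I, un (I + c + 1), un (I + c + 1), un 0, g @ [False, False], un (c + 3), ov]"
    by (rule rexec_ops') (auto simp: main_regs_def)
  have 2: "rexec M chain_com
    [[], q, pad, [], rev (rev x), [], [], h, un I, un (I + c + 1), un (I + c + 1), un 0, g @ [False, False], un (c + 3), ov]
    (length (rev x) * (10 * K + 400) + 1)
    [[], q, pad, [], [], [] @ rev x, [], h, un I, un (I + c + 1 + 2 * length (rev x)), un (I + c + 1), un (0 + length (rev x)),
      (g @ [False, False]) @ enc_gates (chain_gates I (I + c + 1 + 2) 0 (rev x)), un (c + 3 + 2 * length (rev x)), ov]"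
    by (rule rexec_chain) (use assms in simp)
  define g2 where "g2 = (g @ [False, False]) @ enc_gates (chain_gates I (I + c + 1 + 2) 0 (rev x))"
  define d where "d = c + 2 * ?l"
  have d: "I + c + 1 + 2 * length (rev x) = I + d + 1" "c + 3 + 2 * length (rev x) = d + 3"
    by (simp_all add: d_def)
  have two: "rexec M chain_com
    [[], q, pad, [], x, [], [], h, un I, un (I + c + 1), un (I + c + 1), un 0, g @ [False, False], un (c + 3), ov]
    (?l * (10 * K + 400) + 1)
    [[], q, pad, [], [], rev x, [], h, un I, un (I + d + 1), un (I + c + 1), un ?l,
      g2, un (d + 3), ov]"
    using 2 unfolding d g2_def[symmetric] by simp
  have 3: "rexec M restore_com [[], q, pad, [], [], rev x, [], h, un I, un (I + d + 1), un (I + c + 1), un ?l,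
      g2, un (d + 3), ov] (?l * 40 + 1)
     [[], q, pad, [], x, [], [], h, un I, un (I + d + 1), un (I + c + 1), un ?l,
      g2, un (d + 3), ov]"
    using rexec_restore[of M "[]" q pad "[]" "[]" "rev x"] by simp
  have g3: "g @ enc_gates (point_gates I (I + c + 2) x) = g2 @ enc_gate (Xor (I + c + 1) (I + d + 2))"
    by (simp add: g2_def point_gates_def d_def add_ac)
  have 4: "rexec M (ops_com [Clear 11, Push 12 True, Push 12 True, App 10 12, Push 12 False, App 9 12, Push 12 True,
        Push 12 False, Push 13 True, Push 9 True, Clear 10, App 9 10, Push 10 True])
     [[], q, pad, [], x, [], [], h, un I, un (I + d + 1), un (I + c + 1), un ?l,
      g2, un (d + 3), ov] (40 * K + 200)
     (main_regs I h pad x (d + 2) (g @ enc_gates (point_gates I (I + c + 2) x)) q ov)"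
  proof (rule rexec_ops')
    show "ops_sem [Clear 11, Push 12 True, Push 12 True, App 10 12, Push 12 False, App 9 12, Push 12 True,
        Push 12 False, Push 13 True, Push 9 True, Clear 10, App 9 10, Push 10 True]
      [[], q, pad, [], x, [], [], h, un I, un (I + d + 1), un (I + c + 1), un ?l,
       g2, un (d + 3), ov] =
      main_regs I h pad x (d + 2) (g @ enc_gates (point_gates I (I + c + 2) x)) q ov"
      unfolding g3 by (simp add: main_regs_def enc_nat_un)
  qed (use assms in \<open>auto simp: d_def\<close>)
  have "d + 2 = c + 2 * ?l + 2" by (simp add: d_def)
  from 4[unfolded this] show ?thesis unfolding emit_com_def
    by (intro rexec_seq[OF 1 rexec_seq[OF two rexec_seq[OF 3 _ order.refl] order.refl]])
      (auto simp: algebra_simps)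
qed

definition prep_ops :: "op list" where
  "prep_ops = [Clear 1, App 4 1, App 2 1]"

text \<open>Asking a query means running out of commands. So after preparing the query the program
  simply ends, and only the overflow of the counter hands over to \<open>fin\<close>.\<close>

definition next_com :: "com \<Rightarrow> com" where
  "next_com fin = CSeq (cinc 4 6 (ops_com [Push 14 True])) (CIf 14 (\<lambda>s. s = 0) (ops_com prep_ops) fin)"

lemma rexec_next:
  assumes "x = ys @ False # replicate m True" "x' = ys @ True # replicate m False"
  shows "rexec M (next_com fin) (main_regs I h pad x c g q [])
    (80 * length x + 10 * length pad + 10 * length q + 100) (main_regs I h pad x' c g (x' @ pad) [])"
proof -
  let ?R = "main_regs I h pad x c g q []"
  have 1: "rexec M (cinc 4 6 (ops_com [Push 14 True])) ?R (60 * m + 50) (?R[4 := ys @ True # replicate m False])"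
    by (rule rexec_inc) (auto simp: main_regs_def assms)
  have eq: "?R[4 := ys @ True # replicate m False] = main_regs I h pad x' c g q []"
    by (simp add: main_regs_def assms)
  have "rexec M (ops_com prep_ops) (main_regs I h pad x' c g q [])
      (10 * length q + 10 * length x + 10 * length pad + 40) (main_regs I h pad x' c g (x' @ pad) [])"
    by (rule rexec_ops') (auto simp: main_regs_def prep_ops_def assms)
  then have 2: "rexec M (CIf 14 (\<lambda>s. s = 0) (ops_com prep_ops) fin) (main_regs I h pad x' c g q [])
      (10 * length q + 10 * length x + 10 * length pad + 41) (main_regs I h pad x' c g (x' @ pad) [])"
    by (intro rexec_if) (auto simp: main_regs_def)
  show ?thesis unfolding next_com_def
    by (rule rexec_seq[OF 1[unfolded eq] 2]) (simp add: assms)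
qed

lemma exec_reaches: "exec M c T t T' \<Longrightarrow> \<exists>u \<le> t. reaches M (c # k, T) u (k, T')"
  by (simp add: exec_def)

text \<open>\<open>exec\<close> describes commands that give control back. Programs that end in
  \<open>CHalt\<close> never do, so they are followed with \<open>reaches\<close>, one sequenced
  command at a time.\<close>

lemma reaches_seq:
  assumes "exec M c T t T'" shows "\<exists>u \<le> t + 1. reaches M (CSeq c d # k, T) u (d # k, T')"
proof -
  obtain u where u: "u \<le> t" "reaches M (c # d # k, T) u (d # k, T')"
    using exec_reaches[OF assms] by blast
  then have "reaches M (CSeq c d # k, T) (Suc u) (d # k, T')"
    by (intro reaches.step) (auto simp: active_def prog_step_def)
  then show ?thesis using u(1) by auto
qed

lemma reaches_if: "reaches M (CIf j P c d # k, T) 1 ((if P (scan T j) then c else d) # k, T)"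
  by (rule reaches_single) (auto simp: active_def prog_step_def)

lemma reaches_next_overflow:
  "\<exists>t \<le> 60 * l + 60. reaches M (next_com fin # k, regs (main_regs I h pad (replicate l True) c g q [])) t
     (fin # k, regs (main_regs I h pad (replicate l False) c g q [True]))"
proof -
  let ?R = "main_regs I h pad (replicate l True) c g q []"
  let ?R' = "main_regs I h pad (replicate l False) c g q [True]"
  have "rexec M (cinc 4 6 (ops_com [Push 14 True])) ?R (60 * l + 50)
    (let R' = ?R[4 := []]; R'' = R'[14 := R' ! 14 @ [True]] in R''[4 := R'' ! 4 @ replicate l False])"
    by (rule rexec_inc_overflow) (auto simp: main_regs_def)
  then have "exec M (cinc 4 6 (ops_com [Push 14 True])) (regs ?R) (60 * l + 50) (regs ?R')"
    by (simp add: rexec_def main_regs_def)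
  from reaches_seq[OF this, of "CIf 14 (\<lambda>s. s = 0) (ops_com prep_ops) fin" k]
  obtain u where u: "u \<le> 60 * l + 50 + 1" "reaches M (next_com fin # k, regs ?R) u
      (CIf 14 (\<lambda>s. s = 0) (ops_com prep_ops) fin # k, regs ?R')"
    unfolding next_com_def by blast
  have "reaches M (CIf 14 (\<lambda>s. s = 0) (ops_com prep_ops) fin # k, regs ?R') 1
      ((if scan (regs ?R') 14 = 0 then ops_com prep_ops else fin) # k, regs ?R')"
    by (rule reaches_if)
  moreover have "scan (regs ?R') 14 = bit_sym True" by (subst scan_regs) (auto simp: main_regs_def)
  ultimately have "reaches M (CIf 14 (\<lambda>s. s = 0) (ops_com prep_ops) fin # k, regs ?R') 1 (fin # k, regs ?R')"
    by simp
  from reaches_trans[OF u(2) this] u(1) show ?thesis by (intro exI[of _ "u + 1"]) simp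
qed

section \<open>Enumerating the points\<close>

fun all_points :: "nat \<Rightarrow> bool list list" where
  "all_points 0 = [[]]"
| "all_points (Suc l) = map (Cons False) (all_points l) @ map (Cons True) (all_points l)"

lemma length_all_points [simp]: "length (all_points l) = 2 ^ l"
  by (induction l) auto

lemma set_all_points: "set (all_points l) = bit_strings l"
proof (induction l)
  case (Suc l)
  have "x \<in> Cons False ` bit_strings l \<union> Cons True ` bit_strings l \<longleftrightarrow> x \<in> bit_strings (Suc l)" for x
    by (cases x; cases "hd x") (auto simp: bit_strings_def)
  then show ?case using Suc by auto
qed (auto simp: bit_strings_def)

lemma distinct_all_points: "distinct (all_points l)"
  by (induction l) (auto simp: distinct_map)

lemma all_points_first: "all_points l ! 0 = replicate l False"
proof (induction l)
  case (Suc l)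
  have "0 < length (all_points l)" by simp
  then show ?case using Suc by (simp add: nth_append del: length_all_points)
qed simp

lemma all_points_last: "all_points l ! (2 ^ l - 1) = replicate l True"
proof (induction l)
  case (Suc l)
  have "2 ^ Suc l - 1 = 2 ^ l + (2 ^ l - 1 :: nat)" by simp
  then show ?case using Suc by (simp add: nth_append)
qed simp

text \<open>Lexicographic order is the order of counting: successive points are related exactly as
  by the binary counter.\<close>

lemma all_points_Suc:
  "Suc i < 2 ^ l \<Longrightarrow> \<exists>ys m. all_points l ! i = ys @ False # replicate m True \<and>
     all_points l ! Suc i = ys @ True # replicate m False"
proof (induction l arbitrary: i)
  case (Suc l)
  consider "Suc i < 2 ^ l" | "Suc i = 2 ^ l" | "2 ^ l \<le> i" by linarith
  then show ?case
  proof cases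
    case 1
    then obtain ys m where "all_points l ! i = ys @ False # replicate m True"
      "all_points l ! Suc i = ys @ True # replicate m False" using Suc.IH by blast
    then show ?thesis using 1
      by (intro exI[of _ "False # ys"] exI[of _ m]) (auto simp: nth_append)
  next
    \<comment> \<open>The carry passes through all lower bits into the leading one.\<close>
    case 2
    then have "i = 2 ^ l - 1" "i < 2 ^ l" by auto
    then have "all_points (Suc l) ! i = False # replicate l True"
      "all_points (Suc l) ! Suc i = True # replicate l False"
      using 2 all_points_last[of l] all_points_first[of l] by (auto simp: nth_append)
    then show ?thesis by (intro exI[of _ "[]"] exI[of _ l]) auto
  next
    case 3
    then have "Suc (i - 2 ^ l) < 2 ^ l" using Suc.prems by auto
    then obtain ys m where *: "all_points l ! (i - 2 ^ l) = ys @ False # replicate m True"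
      "all_points l ! Suc (i - 2 ^ l) = ys @ True # replicate m False" using Suc.IH by blast
    have "Suc i - 2 ^ l = Suc (i - 2 ^ l)" using 3 by simp
    then show ?thesis using 3 Suc.prems *
      by (intro exI[of _ "True # ys"] exI[of _ m]) (auto simp: nth_append)
  qed
qed simp

lemma length_all_points_nth: "i < 2 ^ l \<Longrightarrow> length (all_points l ! i) = l"
  using nth_mem[of i "all_points l"] by (simp add: set_all_points bit_strings_def)

lemma tape_bits_reg: "tape_bits (reg_tape (-1) bs) = bs"
proof -
  have "(LEAST i. cells (-1) bs (int i) \<notin> {1, 2}) = length bs"
  proof (rule Least_equality)
    show "cells (-1) bs (int (length bs)) \<notin> {1, 2}" by (simp add: cells_def)
    fix i assume "cells (-1) bs (int i) \<notin> {1, 2}"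
    then show "length bs \<le> i" by (rule contrapos_np) (auto simp: cells_def bit_sym_def)
  qed
  then show ?thesis unfolding tape_bits_def reg_tape_def
    by (intro nth_equalityI) (auto simp: cells_def bit_sym_def)
qed

lemma tape_bits_query: "tape_bits (regs (main_regs I h pad x c g q ov) 1) = q"
  using regs_nth[of 1 "main_regs I h pad x c g q ov"]
  by (simp add: main_regs_def reg_offset_def tape_bits_reg)

text \<open>Invariant: before the i-th query the registers hold the encoded truth-table circuit of
  the earlier points that were answered positively. \<open>K\<close> bounds all registers copied in
  any round, so all rounds share one time bound.\<close>

lemma main_loop:
  fixes M :: tm and p fin :: com and I l :: nat and h pad :: "bool list" and Q :: "bool list \<Rightarrow> bool"
  defines "p1 \<equiv> CSeq emit_com (next_com fin)" and "p0 \<equiv> next_com fin"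
  defines "A \<equiv> prog_tm M p p1 p0" and "cf \<equiv> prog_config M p p1 p0"
  defines "acc \<equiv> \<lambda>i. filter (\<lambda>x. Q (x @ pad)) (take i (all_points l))"
  defines "st \<equiv> \<lambda>i x q ov. regs (main_regs I h pad x (length (tt_gates I (acc i)) - 2)
      (enc_gates (tt_gates I (acc i))) q ov)"
  defines "K \<equiv> l + I + 2 * (I + 2 ^ l * (2 * l + 2) + 1 + 2 * l)"
  assumes wf: "wf_tm M" and ok: "prog_ok M p" "prog_ok M p1" "prog_ok M p0"
    and i: "i < 2 ^ l"
  shows "\<exists>t \<le> (2 ^ l - i) * ((l + 1) * (100 * K + 900) + 20 * length pad). tm_steps A Q
    (cf ([], st i (all_points l ! i) (all_points l ! i @ pad) [])) t
    (cf ([fin], st (2 ^ l) (replicate l False) (replicate l True @ pad) [True]))"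
proof -
  define \<tau> where "\<tau> = (l + 1) * (100 * K + 900) + 20 * length pad"
  have acc_len: "length (acc j) \<le> 2 ^ l" "\<forall>x \<in> set (acc j). length x = l" for j
  proof -
    show "length (acc j) \<le> 2 ^ l" unfolding acc_def
      by (rule order.trans[OF length_filter_le]) simp
    have "set (acc j) \<subseteq> bit_strings l" using set_take_subset[of j "all_points l"]
      by (auto simp: acc_def set_all_points)
    then show "\<forall>x \<in> set (acc j). length x = l" by (auto simp: bit_strings_def)
  qed
  \<comment> \<open>The two answer programs differ only in whether they emit gates for the point;
    both then proceed to the next one.\<close>
  have mid: "\<exists>t \<le> (l + 1) * (100 * K + 700) + 1.
      reaches M ([if Q (x @ pad) then p1 else p0], st j x q []) t ([next_com fin], st (Suc j) x q [])"
    if "j < 2 ^ l" "x = all_points l ! j" for j x q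
  proof (cases "Q (x @ pad)")
    case True
    have lx: "length x = l" using that length_all_points_nth by simp
    have accS: "acc (Suc j) = acc j @ [x]" using that True by (simp add: acc_def take_Suc_conv_app_nth)
    define c where "c = length (tt_gates I (acc j)) - 2"
    have c: "length (tt_gates I (acc j)) = c + 2" using length_tt_gates_ge[of I "acc j"] by (simp add: c_def)
    have "c = length (acc j) * (2 * l + 2)"
      using length_tt_gates[OF acc_len(2)[of j], of I] by (simp add: c_def)
    also have "\<dots> \<le> 2 ^ l * (2 * l + 2)" by (intro mult_right_mono acc_len) simp
    finally have cb: "c \<le> 2 ^ l * (2 * l + 2)" .
    have "rexec M emit_com (main_regs I h pad x c (enc_gates (tt_gates I (acc j))) q []) ((length x + 1) * (100 * K + 700))
      (main_regs I h pad x (c + 2 * length x + 2)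
        (enc_gates (tt_gates I (acc j)) @ enc_gates (point_gates I (I + c + 2) x)) q [])"
      by (rule rexec_emit) (use cb lx in \<open>simp add: K_def\<close>)
    moreover have "length (tt_gates I (acc (Suc j))) - 2 = c + 2 * length x + 2"
      by (simp add: accS tt_gates_snoc c)
    moreover have "enc_gates (tt_gates I (acc (Suc j))) =
        enc_gates (tt_gates I (acc j)) @ enc_gates (point_gates I (I + c + 2) x)"
      by (simp add: accS tt_gates_snoc c)
    ultimately have "exec M emit_com (st j x q []) ((l + 1) * (100 * K + 700)) (st (Suc j) x q [])"
      by (simp add: st_def rexec_def lx c_def)
    from reaches_seq[OF this, of "next_com fin" "[]"] show ?thesis using True by (simp add: p1_def)
  next
    case False
    have "acc (Suc j) = acc j" using that False by (simp add: acc_def take_Suc_conv_app_nth)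
    then have "reaches M ([if Q (x @ pad) then p1 else p0], st j x q []) 0 ([next_com fin], st (Suc j) x q [])"
      using False by (simp add: st_def p0_def reaches.refl)
    then show ?thesis by blast
  qed
  have mid_tm: "\<exists>t \<le> (l + 1) * (100 * K + 700) + 3.
      tm_steps A Q (cf ([], st j x (x @ pad) [])) t (cf ([next_com fin], st (Suc j) x (x @ pad) []))"
    if "j < 2 ^ l" "x = all_points l ! j" for j x
  proof -
    note mid_j = mid[OF that]
    obtain t where t: "t \<le> (l + 1) * (100 * K + 700) + 1"
      "reaches M ([if Q (x @ pad) then p1 else p0], st j x (x @ pad) []) t ([next_com fin], st (Suc j) x (x @ pad) [])"
      using mid_j by blast
    have "[if Q (x @ pad) then p1 else p0] \<in> prog_states M p p1 p0"
      using prog_states_start(2,3)[of p1 M p p0] prog_states_start(3)[of p0 M p p1] by auto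
    then have 1: "tm_steps A Q (cf ([if Q (x @ pad) then p1 else p0], st j x (x @ pad) [])) t
        (cf ([next_com fin], st (Suc j) x (x @ pad) []))"
      using reaches_tm_steps[OF wf ok t(2)] by (simp add: A_def cf_def)
    have 2: "tm_steps A Q (cf ([], st j x (x @ pad) [])) 2 (cf ([if Q (x @ pad) then p1 else p0], st j x (x @ pad) []))"
      using query_steps[OF wf ok, of Q "st j x (x @ pad) []"] unfolding st_def tape_bits_query A_def cf_def .
    show ?thesis using tm_steps_trans[OF 2 1] t(1) by (intro exI[of _ "2 + t"]) simp
  qed
  have p0_state: "[next_com fin] \<in> prog_states M p p1 p0"
    using prog_states_start(3)[of p0 M p p1] by (simp add: p0_def)
  have "\<exists>t \<le> (2 ^ l - j) * \<tau>. tm_steps A Q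
    (cf ([], st j (all_points l ! j) (all_points l ! j @ pad) [])) t
    (cf ([fin], st (2 ^ l) (replicate l False) (replicate l True @ pad) [True]))" if "j < 2 ^ l" for j
    using that
  \<comment> \<open>Induction on the number of points still to come, to which the time bound is
    proportional.\<close>
  proof (induction "2 ^ l - Suc j" arbitrary: j)
    case 0
    then have j: "Suc j = 2 ^ l" by simp
    then have x: "all_points l ! j = replicate l True" using all_points_last[of l] by (metis diff_Suc_1)
    obtain t where t: "t \<le> (l + 1) * (100 * K + 700) + 3"
      "tm_steps A Q (cf ([], st j (replicate l True) (replicate l True @ pad) [])) t
        (cf ([next_com fin], st (Suc j) (replicate l True) (replicate l True @ pad) []))"
      using mid_tm[OF 0(2)] x by metis
    obtain u where u: "u \<le> 60 * l + 60" "reaches M ([next_com fin], st (Suc j) (replicate l True) (replicate l True @ pad) []) u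
        ([fin], st (2 ^ l) (replicate l False) (replicate l True @ pad) [True])"
      unfolding st_def j using reaches_next_overflow by blast
    have "tm_steps A Q (cf ([next_com fin], st (Suc j) (replicate l True) (replicate l True @ pad) [])) u
        (cf ([fin], st (2 ^ l) (replicate l False) (replicate l True @ pad) [True]))"
      using reaches_tm_steps[OF wf ok u(2)] p0_state by (simp add: A_def cf_def)
    from tm_steps_trans[OF t(2) this] have "tm_steps A Q
      (cf ([], st j (all_points l ! j) (all_points l ! j @ pad) [])) (t + u)
      (cf ([fin], st (2 ^ l) (replicate l False) (replicate l True @ pad) [True]))" by (simp add: x)
    moreover have "t + u \<le> (2 ^ l - j) * \<tau>"
    proof -
      have "2 ^ l - j = 1" using j by simp
      then show ?thesis using t(1) u(1) by (simp add: \<tau>_def algebra_simps)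
    qed
    ultimately show ?case by blast
  next
    case (Suc d)
    then have j: "Suc j < 2 ^ l" by simp
    define x x' where "x = all_points l ! j" and "x' = all_points l ! Suc j"
    obtain ys m where xs: "x = ys @ False # replicate m True" "x' = ys @ True # replicate m False"
      using all_points_Suc[OF j] unfolding x_def x'_def by blast
    have lx: "length x = l" using Suc.prems length_all_points_nth by (simp add: x_def)
    obtain t where t: "t \<le> (l + 1) * (100 * K + 700) + 3"
      "tm_steps A Q (cf ([], st j x (x @ pad) [])) t (cf ([next_com fin], st (Suc j) x (x @ pad) []))"
      using mid_tm[OF Suc.prems x_def] by blast
    have "exec M (next_com fin) (st (Suc j) x (x @ pad) []) (80 * length x + 10 * length pad + 10 * length (x @ pad) + 100)
        (st (Suc j) x' (x' @ pad) [])"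
      using rexec_next[OF xs] unfolding rexec_def st_def by blast
    from exec_reaches[OF this] obtain u where u: "u \<le> 80 * l + 10 * length pad + 10 * (l + length pad) + 100"
      "reaches M ([next_com fin], st (Suc j) x (x @ pad) []) u ([], st (Suc j) x' (x' @ pad) [])"
      using lx by auto
    have 1: "tm_steps A Q (cf ([next_com fin], st (Suc j) x (x @ pad) [])) u (cf ([], st (Suc j) x' (x' @ pad) []))"
      using reaches_tm_steps[OF wf ok u(2)] p0_state by (simp add: A_def cf_def)
    have "d = 2 ^ l - Suc (Suc j)" using Suc.hyps(2) by simp
    from Suc.hyps(1)[OF this j] obtain v where v: "v \<le> (2 ^ l - Suc j) * \<tau>"
      "tm_steps A Q (cf ([], st (Suc j) x' (x' @ pad) [])) v
        (cf ([fin], st (2 ^ l) (replicate l False) (replicate l True @ pad) [True]))"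
      unfolding x'_def by blast
    have "t + u \<le> \<tau>" using t(1) u(1) by (simp add: \<tau>_def algebra_simps)
    moreover have "(2 ^ l - j) * \<tau> = (2 ^ l - Suc j) * \<tau> + \<tau>"
    proof -
      have "2 ^ l - j = Suc (2 ^ l - Suc j)" using j by simp
      then show ?thesis by simp
    qed
    ultimately have "t + u + v \<le> (2 ^ l - j) * \<tau>" using v(1) by simp
    then show ?case using tm_steps_trans[OF tm_steps_trans[OF t(2) 1] v(2)] unfolding x_def by blast
  qed
  then show ?thesis using i unfolding \<tau>_def by blast
qed

section \<open>Initialisation\<close>

lemma bits_tape_cells: "bits_tape w = (cells (-1) w, 0)"
  by (auto simp: bits_tape_def cells_def bit_sym_def)

definition init_tapes :: "bool list \<Rightarrow> nat \<Rightarrow> tape" where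
  "init_tapes w j = (if j = 0 then bits_tape w else bits_tape [])"

lemma init_config_tapes: "snd (init_config A w) = map (init_tapes w) [0..<ntapes A]" if "ntapes A \<ge> 1"
  using that by (intro nth_equalityI) (auto simp: init_config_def init_tapes_def nth_Cons split: nat.split)

text \<open>Registers on tapes 0 and 1 begin in cell 0, so the empty query register needs its head
  on cell -1, and the head of the input tape has to be brought to the last symbol.\<close>

definition start_com :: com where
  "start_com = CSeq (CAct 1 3 (-1)) (CSeq (CWhile 0 (\<lambda>s. s \<noteq> 0) (CAct 0 3 1)) (CAct 0 3 (-1)))"

lemma exec_start:
  "exec M start_com (init_tapes w) (2 * length w + 6) (regs (w # replicate 14 []))"
proof -
  let ?T = "\<lambda>h. (regs (w # replicate 14 []))(0 := (cells (-1) w, h))"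
  have 1: "exec M (CAct 1 3 (-1)) (init_tapes w) 1 (?T 0)"
  proof (rule exec_move)
    show "?T 0 = (init_tapes w)(1 := (fst (init_tapes w 1), snd (init_tapes w 1) + sgn (-1)))"
      by (rule ext) (auto simp: init_tapes_def bits_tape_cells regs_def reg_offset_def reg_tape_def
          cells_def[abs_def] nth_Cons split: nat.split)
  qed
  have loop: "exec M (CWhile 0 (\<lambda>s. s \<noteq> 0) (CAct 0 3 1)) (?T (int (length w - m))) (2 * m + 1) (?T (int (length w)))"
    if "m \<le> length w" for m
    using that
  proof (induction m)
    case 0
    have "exec M (CWhile 0 (\<lambda>s. s \<noteq> 0) (CAct 0 3 1)) (?T (int (length w))) 1 (?T (int (length w)))"
      by (rule exec_while_end) (simp add: cells_def)
    then show ?case by (simp del: fun_upd_apply)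
  next
    case (Suc m)
    have a: "exec M (CAct 0 3 1) (?T (int (length w - Suc m))) 1 (?T (int (length w - m)))"
      by (rule exec_move) (use Suc.prems in \<open>simp add: of_nat_diff\<close>)
    have b: "scan (?T (int (length w - Suc m))) 0 \<noteq> 0"
      using Suc.prems by (simp add: cells_def)
    have c: "exec M (CWhile 0 (\<lambda>s. s \<noteq> 0) (CAct 0 3 1)) (?T (int (length w - m))) (2 * m + 1) (?T (int (length w)))"
      using Suc by (simp del: fun_upd_apply)
    show ?case
      by (rule exec_mono[OF exec_while_step[where P = "\<lambda>s. s \<noteq> 0", OF b a c]]) simp
  qed
  have 2: "exec M (CWhile 0 (\<lambda>s. s \<noteq> 0) (CAct 0 3 1)) (?T 0) (2 * length w + 1) (?T (int (length w)))"
    using loop[of "length w"] by (simp del: fun_upd_apply)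
  have 3: "exec M (CAct 0 3 (-1)) (?T (int (length w))) 1 (regs (w # replicate 14 []))"
    by (rule exec_move) (rule ext, simp add: regs_def reg_offset_def reg_tape_def)
  show ?thesis unfolding start_com_def
    by (rule exec_mono[OF exec_seq[OF 1 exec_seq[OF 2 3]]]) simp
qed

section \<open>Binary numerals and their length\<close>

definition bin_value :: "bool list \<Rightarrow> nat" where
  "bin_value xs = foldl (\<lambda>a b. 2 * a + of_bool b) 0 xs"

lemma foldl_bin: "foldl (\<lambda>a b. 2 * a + of_bool b) a xs = a * 2 ^ length xs + bin_value xs"
proof (induction xs rule: rev_induct)
  case (snoc x xs)
  then show ?case by (simp add: bin_value_def algebra_simps)
qed (simp add: bin_value_def)

lemma bin_value_append: "bin_value (xs @ ys) = bin_value xs * 2 ^ length ys + bin_value ys"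
  using foldl_bin[of "bin_value xs" ys] by (simp add: bin_value_def)

lemma bin_value_Cons: "bin_value (b # xs) = of_bool b * 2 ^ length xs + bin_value xs"
  using bin_value_append[of "[b]" xs] by (simp add: bin_value_def)

lemma bin_value_less: "bin_value xs < 2 ^ length xs"
  by (induction xs) (auto simp: bin_value_Cons, simp add: bin_value_def)

lemma bin_value_True: "Suc (bin_value (replicate m True)) = 2 ^ m"
  by (induction m) (simp_all add: bin_value_Cons, simp add: bin_value_def)

lemma bin_value_False: "bin_value (replicate m False) = 0"
  by (induction m) (simp_all add: bin_value_Cons, simp add: bin_value_def)

text \<open>Leading zeros are excluded in order that the length of the counter is determined by its
  value.\<close>

definition bin_of :: "bool list \<Rightarrow> nat \<Rightarrow> bool" where
  "bin_of xs k \<longleftrightarrow> bin_value xs = k \<and> (xs = [] \<or> hd xs)"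

text \<open>This is the number of binary digits of \<open>n\<close>, a logarithm that a machine
  obtains as the length of a counter.\<close>

definition bit_len :: "nat \<Rightarrow> nat" where
  "bit_len n = (LEAST L. n < 2 ^ L)"

lemma bit_len_upper: "n < 2 ^ bit_len n"
  unfolding bit_len_def by (rule LeastI[of _ n]) (rule less_exp)

lemma bit_len_lower: "L < bit_len n \<Longrightarrow> 2 ^ L \<le> n"
  using not_less_Least[of L "\<lambda>L. n < 2 ^ L"] unfolding bit_len_def by simp

lemma bin_of_length:
  assumes "bin_of xs n" shows "length xs = bit_len n"
proof -
  have up: "n < 2 ^ length xs" using assms bin_value_less[of xs] by (simp add: bin_of_def)
  have "\<not> n < 2 ^ L" if L: "L < length xs" for L
  proof (cases xs)
    case (Cons b ys)
    have "(2::nat) ^ L \<le> 2 ^ length ys" using L Cons by (intro power_increasing) auto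
    also have "\<dots> \<le> n" using assms Cons by (auto simp: bin_of_def bin_value_Cons)
    finally show ?thesis by simp
  qed (use L in simp)
  then show ?thesis unfolding bit_len_def using up
    by (intro Least_equality[symmetric]) (auto simp: not_less[symmetric])
qed

lemma bit_len_le: "bit_len n \<le> n"
  unfolding bit_len_def by (rule Least_le) (rule less_exp)

lemma trailing_True_cases:
  obtains (zero) ys m where "xs = ys @ False # replicate m True" | (ones) m where "xs = replicate m True"
proof (induction xs arbitrary: thesis rule: rev_induct)
  case Nil
  show ?case by (rule Nil(2)[of 0]) simp
next
  case (snoc b xs)
  show ?case
  proof (cases b)
    case True
    show ?thesis
    proof (rule snoc.IH)
      fix ys m assume "xs = ys @ False # replicate m True"
      then show thesis using True by (intro snoc.prems(1)[of ys "Suc m"]) (simp add: replicate_append_same)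
    next
      fix m assume "xs = replicate m True"
      then show thesis using True by (intro snoc.prems(2)[of "Suc m"]) (simp add: replicate_append_same)
    qed
  next
    case False
    then show ?thesis by (intro snoc.prems(1)[of xs 0]) simp
  qed
qed

text \<open>The unary input is consumed while it is counted in binary; at the same time
  \<open>n\<close> zeros are laid out as raw material for the padding of the queries.\<close>

definition count_com :: com where
  "count_com = CWhile 0 (\<lambda>s. s \<noteq> 0)
     (CSeq (ops_com [Pop 0, Push 2 False]) (cinc 3 6 (ops_com [Push 3 True])))"

lemma rexec_count_inc:
  assumes "bin_of B k"
  shows "\<exists>B'. bin_of B' (Suc k) \<and> rexec M (cinc 3 6 (ops_com [Push 3 True]))
    [w, [], pad, B, [], [], [], [], [], [], [], [], [], [], []] (60 * k + 50)
    [w, [], pad, B', [], [], [], [], [], [], [], [], [], [], []]"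
proof -
  let ?R = "\<lambda>B. [w, [], pad, B, [], [], [], [], [], [], [], [], [], [], []]"
  have len: "length B \<le> k" using bin_of_length[OF assms] bit_len_le[of k] by simp
  show ?thesis
  proof (cases B rule: trailing_True_cases)
    case (zero ys m)
    let ?B = "ys @ True # replicate m False"
    have "rexec M (cinc 3 6 (ops_com [Push 3 True])) (?R B) (60 * m + 50) ((?R B)[3 := ?B])"
      by (rule rexec_inc) (auto simp: zero)
    from rexec_mono[OF this, of "60 * k + 50"]
    have "rexec M (cinc 3 6 (ops_com [Push 3 True])) (?R B) (60 * k + 50) (?R ?B)"
      using len zero by simp
    moreover have "bin_of ?B (Suc k)"
      using assms bin_value_True[of m] unfolding zero bin_of_def bin_value_append bin_value_Cons bin_value_False
      by (cases ys) auto
    ultimately show ?thesis by blast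
  next
    case (ones m)
    let ?B = "True # replicate m False"
    have "rexec M (cinc 3 6 (ops_com [Push 3 True])) (?R B) (60 * m + 50)
      (let R' = (?R B)[3 := []]; R'' = R'[3 := R' ! 3 @ [True]] in R''[3 := R'' ! 3 @ replicate m False])"
      by (rule rexec_inc_overflow) (auto simp: ones)
    from rexec_mono[OF this, of "60 * k + 50"]
    have "rexec M (cinc 3 6 (ops_com [Push 3 True])) (?R B) (60 * k + 50) (?R ?B)"
      using len ones by simp
    moreover have "bin_of ?B (Suc k)"
      using assms bin_value_True[of m] unfolding ones bin_of_def bin_value_Cons bin_value_False
      by auto
    ultimately show ?thesis by blast
  qed
qed

lemma rexec_count:
  "bin_of B k \<Longrightarrow> \<exists>B'. bin_of B' (k + m) \<and> rexec M count_com
    [un m, [], replicate u False, B, [], [], [], [], [], [], [], [], [], [], []] (m * (60 * (k + m) + 100) + 1)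
    [[], [], replicate (u + m) False, B', [], [], [], [], [], [], [], [], [], [], []]"
proof (induction m arbitrary: B k u)
  case 0
  then show ?case unfolding count_com_def by (intro exI[of _ B]) (auto intro!: rexec_while_end)
next
  case (Suc m)
  let ?R = "\<lambda>m u B. [un m, [], replicate u False, B, [], [], [], [], [], [], [], [], [], [], []]"
  have 1: "rexec M (ops_com [Pop 0, Push 2 False]) (?R (Suc m) u B) 22 (?R m (Suc u) B)"
    by (rule rexec_ops') (auto simp: replicate_append_same)
  obtain B1 where B1: "bin_of B1 (Suc k)"
    "rexec M (cinc 3 6 (ops_com [Push 3 True])) (?R m (Suc u) B) (60 * k + 50) (?R m (Suc u) B1)"
    using rexec_count_inc[OF Suc.prems] by blast
  obtain B2 where B2: "bin_of B2 (Suc k + m)"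
    "rexec M count_com (?R m (Suc u) B1) (m * (60 * (Suc k + m) + 100) + 1) (?R 0 (Suc u + m) B2)"
    using Suc.IH[OF B1(1), of "Suc u"] by auto
  have "rexec M count_com (?R (Suc m) u B) (Suc m * (60 * (k + Suc m) + 100) + 1) (?R 0 (Suc u + m) B2)"
    unfolding count_com_def
    by (rule rexec_while_step[OF _ _ _ rexec_seq[OF 1 B1(2) order.refl] B2(2)[unfolded count_com_def]])
      (auto simp: algebra_simps)
  then show ?case using B2(1) by (intro exI[of _ B2]) auto
qed

lemma ops_sem_append: "ops_sem (xs @ ys) R = ops_sem ys (ops_sem xs R)"
  by (induction xs arbitrary: R) auto

lemma ops_sem_replicate_Push:
  "j < length R \<Longrightarrow> ops_sem (replicate m (Push j b)) R = R[j := R ! j @ replicate m b]"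
  by (induction m arbitrary: R) auto

lemma ops_sem_replicate_Pop:
  "j < length R \<Longrightarrow> R ! j = replicate k b \<Longrightarrow> ops_sem (replicate m (Pop j)) R = R[j := replicate (k - m) b]"
proof (induction m arbitrary: R k)
  case 0
  then show ?case using list_update_id[of R j] by simp
next
  case (Suc m)
  have "butlast (replicate k b) = replicate (k - 1) b" by (cases k) (auto simp: replicate_append_same[symmetric])
  then show ?case using Suc.prems Suc.IH[of "R[j := replicate (k - 1) b]" "k - 1"] by simp
qed

lemma ops_time_const:
  "list_all (\<lambda>x. \<exists>j b. x = Push j b \<or> x = Pop j) xs \<Longrightarrow> ops_time xs R = 10 * length xs + 1"
  by (induction xs arbitrary: R) auto

text \<open>One round per binary digit multiplies \<open>bit_len n\<close> by the constants
  \<open>a\<close> and \<open>b\<close>. Register 2 loses as many zeros as the points have bits, so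
  that a padded query has length \<open>n\<close> as soon as l \<le> n.\<close>

definition widen_ops :: "nat \<Rightarrow> nat \<Rightarrow> op list" where
  "widen_ops a b = Pop 3 # replicate a (Push 4 False) @ replicate a (Push 5 True) @
     replicate a (Pop 2) @ replicate b (Push 7 False)"

definition widen_com :: "nat \<Rightarrow> nat \<Rightarrow> com" where
  "widen_com a b = CWhile 3 (\<lambda>s. s \<noteq> 0) (ops_com (widen_ops a b))"

lemma rexec_widen:
  "rexec M (widen_com a b)
    [[], [], replicate k False, B, replicate u False, un u, [], replicate v False, [], [], [], [], [], [], []]
    (length B * (30 * a + 10 * b + 20) + 1)
    [[], [], replicate (k - a * length B) False, [], replicate (u + a * length B) False, un (u + a * length B),
      [], replicate (v + b * length B) False, [], [], [], [], [], [], []]"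
proof (induction B arbitrary: k u v rule: rev_induct)
  case Nil
  then show ?case unfolding widen_com_def by (auto intro!: rexec_while_end)
next
  case (snoc c B)
  let ?R = "\<lambda>k B u v. [[], [], replicate k False, B, replicate u False, un u, [], replicate v False, [], [], [], [], [], [], []]"
  have "ops_sem (widen_ops a b) (?R k (B @ [c]) u v) = ?R (k - a) B (u + a) (v + b)"
    by (simp add: widen_ops_def ops_sem_append ops_sem_replicate_Push ops_sem_replicate_Pop[where k = k and b = False]
        replicate_add un_add) (simp add: un_def)
  moreover have "ops_time (widen_ops a b) (?R k (B @ [c]) u v) \<le> 30 * a + 10 * b + 11"
    by (subst ops_time_const) (auto simp: widen_ops_def list_all_iff)
  ultimately have 1: "rexec M (ops_com (widen_ops a b)) (?R k (B @ [c]) u v) (30 * a + 10 * b + 11) (?R (k - a) B (u + a) (v + b))"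
    by (intro rexec_ops') (auto simp: widen_ops_def list_all_iff)
  have eq: "?R (k - a - a * length B) [] (u + a + a * length B) (v + b + b * length B) =
      ?R (k - a * length (B @ [c])) [] (u + a * length (B @ [c])) (v + b * length (B @ [c]))"
    by (simp add: algebra_simps)
  show ?case unfolding widen_com_def
    by (rule rexec_while_step[OF _ _ _ 1 snoc.IH[of "k - a" "u + a" "v + b", unfolded widen_com_def eq]]) auto
qed

definition init_regs :: "nat \<Rightarrow> bool list \<Rightarrow> bool list \<Rightarrow> nat \<Rightarrow> bool list list" where
  "init_regs l h pad I = [[], [], pad, [], replicate l False, un l, [], h, un I, [], [], [], [], [], []]"

definition narrow_com :: com where
  "narrow_com = ops_com [App 5 8]"

text \<open>For the decision problem the number of inputs must be at least the number of gates. The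
  point counter itself counts the 2^l additions of 2 l + 2; after its overflow it is back at zero,
  ready for the enumeration.\<close>

definition pad_com :: com where
  "pad_com = CSeq (ops_com [Push 8 True, Push 8 True]) (CSeq
     (CWhile 14 (\<lambda>s. s = 0) (CSeq (ops_com [App 5 8, App 5 8, Push 8 True, Push 8 True])
        (cinc 4 6 (ops_com [Push 14 True]))))
     (ops_com [Pop 14]))"

lemma rexec_narrow: "rexec M narrow_com (init_regs l h pad 0) (10 * l + 20) (init_regs l h pad l)"
  unfolding narrow_com_def by (rule rexec_ops') (auto simp: init_regs_def)

lemma rexec_pad:
  "rexec M pad_com (init_regs l h pad 0) (2 ^ l * (80 * l + 120) + 50)
    (init_regs l h pad (2 + 2 ^ l * (2 * l + 2)))"
proof -
  let ?R = "\<lambda>x I ov. [[], [], pad, [], x, un l, [], h, un I, [], [], [], [], [], ov]"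
  let ?b = "CSeq (ops_com [App 5 8, App 5 8, Push 8 True, Push 8 True]) (cinc 4 6 (ops_com [Push 14 True]))"
  have 1: "rexec M (ops_com [Push 8 True, Push 8 True]) (init_regs l h pad 0) 22 (?R (replicate l False) 2 [])"
    by (rule rexec_ops') (auto simp: init_regs_def)
  have app: "rexec M (ops_com [App 5 8, App 5 8, Push 8 True, Push 8 True]) (?R x I []) (20 * l + 50) (?R x (I + (2 * l + 2)) [])"
    for x I by (rule rexec_ops') (auto simp: un_add mult_2)
  have "rexec M (CWhile 14 (\<lambda>s. s = 0) ?b) (?R (all_points l ! i) I []) ((2 ^ l - i) * (80 * l + 110) + 1)
     (?R (replicate l False) (I + (2 ^ l - i) * (2 * l + 2)) [True])" if "i < 2 ^ l" for i I
    using that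
  proof (induction "2 ^ l - Suc i" arbitrary: i I)
    case 0
    then have i: "Suc i = 2 ^ l" by simp
    then have x: "all_points l ! i = replicate l True" using all_points_last[of l] by (metis diff_Suc_1)
    let ?S = "?R (replicate l True) (I + (2 * l + 2)) []"
    have "rexec M (cinc 4 6 (ops_com [Push 14 True])) ?S (60 * l + 50)
      (let R' = ?S[4 := []]; R'' = R'[14 := R' ! 14 @ [True]] in R''[4 := R'' ! 4 @ replicate l False])"
      by (rule rexec_inc_overflow) auto
    then have inc: "rexec M (cinc 4 6 (ops_com [Push 14 True])) ?S (60 * l + 50) (?R (replicate l False) (I + (2 * l + 2)) [True])"
      by simp
    have stop: "rexec M (CWhile 14 (\<lambda>s. s = 0) ?b) (?R (replicate l False) (I + (2 * l + 2)) [True]) 1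
       (?R (replicate l False) (I + (2 * l + 2)) [True])"
      by (rule rexec_while_end) auto
    have one: "2 ^ l - i = 1" using i by simp
    show ?case unfolding x one mult_1
      by (rule rexec_while_step[OF _ _ _ rexec_seq[OF app inc order.refl] stop]) auto
  next
    case (Suc d)
    then have i: "Suc i < 2 ^ l" by simp
    obtain ys m where xs: "all_points l ! i = ys @ False # replicate m True"
      "all_points l ! Suc i = ys @ True # replicate m False"
      using all_points_Suc[OF i] by blast
    have m: "m \<le> l" using length_all_points_nth[of i l] Suc.prems xs(1) by simp
    let ?S = "?R (all_points l ! i) (I + (2 * l + 2)) []"
    have "rexec M (cinc 4 6 (ops_com [Push 14 True])) ?S (60 * m + 50) (?S[4 := ys @ True # replicate m False])"
      by (rule rexec_inc) (auto simp: xs)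
    from rexec_mono[OF this, of "60 * l + 50"]
    have inc: "rexec M (cinc 4 6 (ops_com [Push 14 True])) ?S (60 * l + 50) (?R (all_points l ! Suc i) (I + (2 * l + 2)) [])"
      using m by (simp add: xs)
    have "d = 2 ^ l - Suc (Suc i)" using Suc.hyps(2) by simp
    note IH = Suc.hyps(1)[OF this i, of "I + (2 * l + 2)"]
    have e: "2 ^ l - i = Suc (2 ^ l - Suc i)" using i by simp
    have eq: "I + (2 * l + 2) + (2 ^ l - Suc i) * (2 * l + 2) = I + (2 ^ l - i) * (2 * l + 2)"
      unfolding e by simp
    show ?case
      by (rule rexec_while_step[OF _ _ _ rexec_seq[OF app inc order.refl] IH[unfolded eq]])
        (auto simp: e)
  qed
  from this[of 0 2] have 2: "rexec M (CWhile 14 (\<lambda>s. s = 0) ?b) (?R (replicate l False) 2 []) (2 ^ l * (80 * l + 110) + 1)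
     (?R (replicate l False) (2 + 2 ^ l * (2 * l + 2)) [True])"
    by (simp add: all_points_first del: un_simps un_add_numeral)
  have 3: "rexec M (ops_com [Pop 14]) (?R (replicate l False) I [True]) 11 (init_regs l h pad I)" for I
    by (rule rexec_ops') (auto simp: init_regs_def)
  show ?thesis unfolding pad_com_def
    by (rule rexec_seq[OF 1 rexec_seq[OF 2 3 order.refl]]) (simp add: algebra_simps)
qed

definition start_ops :: "op list" where
  "start_ops = [Clear 5, App 8 9, Push 12 False, Push 12 False, Push 12 True, Push 12 True, App 8 12, Push 12 False,
     App 8 12, Push 12 False, Push 13 True, Push 13 True, App 9 10, Push 10 True, App 4 1, App 2 1]"

lemma rexec_start_ops:
  "rexec M (ops_com start_ops) (init_regs l h pad I) (20 * l + 40 * I + 10 * length pad + 200)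
    (main_regs I h pad (replicate l False) 0 (enc_gates [One, Xor I I]) (replicate l False @ pad) [])"
  by (rule rexec_ops') (auto simp: init_regs_def main_regs_def start_ops_def enc_nat_un)

definition init_com :: "nat \<Rightarrow> nat \<Rightarrow> com \<Rightarrow> com" where
  "init_com a b c = CSeq start_com (CSeq count_com (CSeq (widen_com a b) (CSeq c (ops_com start_ops))))"

lemma exec_init:
  fixes n a b :: nat
  defines "l \<equiv> a * bit_len n"
  defines "h \<equiv> replicate (b * bit_len n) False" and "pad \<equiv> replicate (n - l) False"
  assumes c: "rexec M c (init_regs l h pad 0) t (init_regs l h pad I)"
  shows "exec M (init_com a b c) (init_tapes (un n))
    (2 * n + n * (60 * n + 100) + n * (30 * a + 10 * b + 20) + t + 20 * l + 40 * I + 10 * n + 300)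
    (regs (main_regs I h pad (replicate l False) 0 (enc_gates (tt_gates I [])) (replicate l False @ pad) []))"
proof -
  have 1: "exec M start_com (init_tapes (un n)) (2 * n + 6)
     (regs [un n, [], [], [], [], [], [], [], [], [], [], [], [], [], []])"
    using exec_start[of M "un n"] by (simp add: eval_nat_numeral del: un_simps(2))
  have "bin_of [] 0" by (simp add: bin_of_def bin_value_def)
  from rexec_count[OF this, of n M 0] obtain B where B: "bin_of B n"
    "rexec M count_com [un n, [], [], [], [], [], [], [], [], [], [], [], [], [], []] (n * (60 * n + 100) + 1)
     [[], [], replicate n False, B, [], [], [], [], [], [], [], [], [], [], []]" by auto
  note L = bin_of_length[OF B(1)]
  have 2: "exec M count_com (regs [un n, [], [], [], [], [], [], [], [], [], [], [], [], [], []]) (n * (60 * n + 100) + 1)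
     (regs [[], [], replicate n False, B, [], [], [], [], [], [], [], [], [], [], []])"
    using B(2) by (simp add: rexec_def)
  have "rexec M (widen_com a b) [[], [], replicate n False, B, [], [], [], [], [], [], [], [], [], [], []]
     (length B * (30 * a + 10 * b + 20) + 1) (init_regs l h pad 0)"
    using rexec_widen[of M a b n B 0 0] by (simp add: init_regs_def l_def h_def pad_def L)
  then have 3: "exec M (widen_com a b) (regs [[], [], replicate n False, B, [], [], [], [], [], [], [], [], [], [], []])
     (length B * (30 * a + 10 * b + 20) + 1) (regs (init_regs l h pad 0))"
    by (simp add: rexec_def)
  have 4: "exec M c (regs (init_regs l h pad 0)) t (regs (init_regs l h pad I))"
    using c by (simp add: rexec_def)
  have 5: "exec M (ops_com start_ops) (regs (init_regs l h pad I)) (20 * l + 40 * I + 10 * length pad + 200)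
      (regs (main_regs I h pad (replicate l False) 0 (enc_gates (tt_gates I [])) (replicate l False @ pad) []))"
    using rexec_start_ops[of M l h pad I] by (simp add: rexec_def tt_gates_Nil)
  have "length B * (30 * a + 10 * b + 20) \<le> n * (30 * a + 10 * b + 20)"
    using L bit_len_le[of n] by (intro mult_right_mono) auto
  moreover have "length pad \<le> n" by (simp add: pad_def)
  ultimately have "2 * n + 6 + (n * (60 * n + 100) + 1 + (length B * (30 * a + 10 * b + 20) + 1 +
      (t + (20 * l + 40 * I + 10 * length pad + 200) + 1) + 1) + 1) + 1 \<le>
      2 * n + n * (60 * n + 100) + n * (30 * a + 10 * b + 20) + t + 20 * l + 40 * I + 10 * n + 300"
    by linarith
  then show ?thesis unfolding init_com_def
    by (rule exec_mono[OF exec_seq[OF 1 exec_seq[OF 2 exec_seq[OF 3 exec_seq[OF 4 5]]]]])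
qed

section \<open>Handing the circuit to the machine\<close>

text \<open>For the decision problem the word ends with the zeros of register 7 and a one, the
  numeral of the threshold. For the approximation register 7 is kept for the comparison
  afterwards.\<close>

definition fin_ops :: "bool \<Rightarrow> op list" where
  "fin_ops dec = [App 8 0, Push 0 False, App 13 0, Push 0 False, App 12 0, App 10 0, Push 0 False] @
     (if dec then [App 7 0, Push 0 True] else [])"

definition fin_com :: "bool \<Rightarrow> com \<Rightarrow> com \<Rightarrow> com" where
  "fin_com dec c d = CSeq (ops_com (fin_ops dec)) (CSeq (cleft 0) (CSeq (CAct 0 3 1)
     (CSeq (CAct 15 2 0) (CMach 0 True c d))))"

lemma cells_Nil: "cells o' [] = (\<lambda>_. 0)"
  by (auto simp: cells_def)

text \<open>This sets up the start of the simulation: the word on tape 0 with the head on cell 0,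
  and blank tapes from 16 on. Register 7 survives untouched.\<close>

lemma reaches_fin:
  fixes h g :: "bool list" and I cc :: nat and dec :: bool
  defines "w \<equiv> un I @ False # un (cc + 2) @ False # g @ un (I + cc + 1) @ False # (if dec then h @ [True] else [])"
  shows "\<exists>T t. t \<le> 20 * length w + 200 \<and>
    reaches M (fin_com dec c d # k, regs (main_regs I h pad x cc g q ov)) t (CMach 0 True c d # k, T) \<and>
    T 0 = bits_tape w \<and> T 15 = mark_tape 0 \<and> T 7 = reg_tape 0 h \<and> (\<forall>j \<ge> 16. T j = bits_tape [])"
proof -
  let ?R = "main_regs I h pad x cc g q ov"
  let ?R' = "?R[0 := w]"
  let ?T = "\<lambda>p. (regs ?R')(0 := (cells (-1) w, p))"
  have "rexec M (ops_com (fin_ops dec)) ?R (10 * length w + 100) ?R'"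
    by (rule rexec_ops') (auto simp: fin_ops_def main_regs_def w_def)
  then have "exec M (ops_com (fin_ops dec)) (regs ?R) (10 * length w + 100) (regs ?R')"
    by (simp add: rexec_def)
  moreover have r0: "regs ?R' 0 = (cells (-1) w, -1 + int (length w))"
    by (simp add: regs_def main_regs_def reg_offset_def reg_tape_def)
  then have "regs ?R' = ?T (-1 + int (length w))" by (metis fun_upd_triv)
  ultimately have 1: "exec M (ops_com (fin_ops dec)) (regs ?R) (10 * length w + 100) (?T (-1 + int (length w)))"
    by simp
  have 2: "exec M (cleft 0) (?T (-1 + int (length w))) (2 * length w + 1) (?T (-1))"
    by (rule exec_left) simp
  have 3: "exec M (CAct 0 3 1) (?T (-1)) 1 (?T 0)" by (rule exec_move) simp
  let ?F = "(?T 0)(15 := mark_tape 0)"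
  \<comment> \<open>This writes the mark by which cell 0 is recognised later.\<close>
  have 4: "exec M (CAct 15 2 0) (?T 0) 1 ?F"
  proof (rule exec_act')
    have "?T 0 15 = (\<lambda>_. 0, 0)"
      by (simp add: regs_def main_regs_def reg_offset_def reg_tape_def cells_Nil)
    then have "mark_tape 0 = act (if (2::nat) < 3 then 2 else scan (?T 0) 15, sgn 0) (?T 0 15)"
      by (simp add: act_def mark_tape_def fun_eq_iff del: fun_upd_apply) simp
    then show "?F = (?T 0)(15 := act (if (2::nat) < 3 then 2 else scan (?T 0) 15, sgn 0) (?T 0 15))"
      by (simp only:)
  qed
  obtain t1 where t1: "t1 \<le> 10 * length w + 100 + 1" "reaches M (fin_com dec c d # k, regs ?R) t1
    (CSeq (cleft 0) (CSeq (CAct 0 3 1) (CSeq (CAct 15 2 0) (CMach 0 True c d))) # k, ?T (-1 + int (length w)))"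
    using reaches_seq[OF 1] unfolding fin_com_def by blast
  obtain t2 where t2: "t2 \<le> 2 * length w + 1 + 1" "reaches M
    (CSeq (cleft 0) (CSeq (CAct 0 3 1) (CSeq (CAct 15 2 0) (CMach 0 True c d))) # k, ?T (-1 + int (length w))) t2
    (CSeq (CAct 0 3 1) (CSeq (CAct 15 2 0) (CMach 0 True c d)) # k, ?T (-1))"
    using reaches_seq[OF 2] by blast
  obtain t3 where t3: "t3 \<le> 1 + 1" "reaches M
    (CSeq (CAct 0 3 1) (CSeq (CAct 15 2 0) (CMach 0 True c d)) # k, ?T (-1)) t3
    (CSeq (CAct 15 2 0) (CMach 0 True c d) # k, ?T 0)"
    using reaches_seq[OF 3] by blast
  obtain t4 where t4: "t4 \<le> 1 + 1" "reaches M
    (CSeq (CAct 15 2 0) (CMach 0 True c d) # k, ?T 0) t4 (CMach 0 True c d # k, ?F)"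
    using reaches_seq[OF 4] by blast
  have "reaches M (fin_com dec c d # k, regs ?R) (t1 + t2 + t3 + t4) (CMach 0 True c d # k, ?F)"
    by (rule reaches_trans[OF reaches_trans[OF reaches_trans[OF t1(2) t2(2)] t3(2)] t4(2)])
  moreover have "t1 + t2 + t3 + t4 \<le> 20 * length w + 200" using t1 t2 t3 t4 by simp
  moreover have "?F 0 = bits_tape w" by (simp add: bits_tape_cells)
  moreover have "?F 7 = reg_tape 0 h" by (simp add: regs_def main_regs_def reg_offset_def)
  moreover have "\<forall>j \<ge> 16. ?F j = bits_tape []"
    by (auto simp: regs_def main_regs_def reg_offset_def reg_tape_def bits_tape_cells cells_Nil)
  ultimately show ?thesis by (intro exI[of _ ?F] exI[of _ "t1 + t2 + t3 + t4"]) auto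
qed

lemma runs_on_init:
  assumes "wf_tm M" "T 0 = bits_tape w" "T 15 = mark_tape 0" "\<forall>j \<ge> 16. T j = bits_tape []"
  shows "runs_on M (snd (init_config M w)) T"
  unfolding runs_on_def
proof (intro conjI allI impI)
  have n: "ntapes M \<ge> 2" using assms(1) by (simp add: wf_tm_def)
  then show "length (snd (init_config M w)) = ntapes M" by (simp add: init_config_def)
  show "T 15 = mark_tape (snd (snd (init_config M w) ! 0))"
    using assms(3) by (simp add: init_config_def bits_tape_def)
  fix i assume "i < ntapes M"
  then show "T (tape_index i) = snd (init_config M w) ! i"
    using assms(2,4) by (cases i) (auto simp: init_config_def tape_index_def)
qed

lemma enc_tt_circuit:
  "enc_circuit (tt_circuit I xs) = un I @ False # un (length (tt_gates I xs) - 2 + 2) @ False #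
     enc_gates (tt_gates I xs) @ un (I + (length (tt_gates I xs) - 2) + 1) @ [False]"
proof -
  have "length (tt_gates I xs) - 2 + 2 = length (tt_gates I xs)"
    "I + (length (tt_gates I xs) - 2) + 1 = I + length (tt_gates I xs) - 1"
    using length_tt_gates_ge[of I xs] by auto
  then show ?thesis
    by (simp add: enc_circuit_def tt_circuit_def num_gates_def enc_nat_un enc_gates_def
        del: un_simps un_add_numeral)
qed

section \<open>Comparing the output with a power of two\<close>

text \<open>Tapes 0 and 15 move in parallel until the mark is seen. The search ends only if
  \<open>s\<close> points towards cell 0, which is why \<open>CMach\<close> distinguishes the side
  on which the machine has halted.\<close>

definition cseek :: "int \<Rightarrow> com" where
  "cseek s = CWhile 15 (\<lambda>s. s \<noteq> 2) (CSeq (CAct 0 3 s) (CAct 15 3 s))"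

lemma scan_mark: "fst (mark_tape p) (snd (mark_tape p)) = 2 \<longleftrightarrow> p = 0"
  by (simp add: mark_tape_def)

lemma exec_move_pair:
  assumes "T 0 = (f, p)" "T 15 = mark_tape p"
  shows "exec M (CSeq (CAct 0 3 s) (CAct 15 3 s)) T 3 (T(0 := (f, p + sgn s), 15 := mark_tape (p + sgn s)))"
proof -
  have 1: "exec M (CAct 0 3 s) T 1 (T(0 := (f, p + sgn s)))" by (rule exec_move) (simp add: assms)
  have 2: "exec M (CAct 15 3 s) (T(0 := (f, p + sgn s))) 1 (T(0 := (f, p + sgn s), 15 := mark_tape (p + sgn s)))"
    by (rule exec_move) (simp add: assms mark_tape_def)
  show ?thesis by (rule exec_mono[OF exec_seq[OF 1 2]]) simp
qed

lemma exec_seek: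
  assumes "s = 1 \<or> s = -1"
  shows "T 0 = (f, - s * int m) \<Longrightarrow> T 15 = mark_tape (- s * int m) \<Longrightarrow>
    exec M (cseek s) T (4 * m + 1) (T(0 := (f, 0), 15 := mark_tape 0))"
proof (induction m arbitrary: T)
  case 0
  then have "T(0 := (f, 0), 15 := mark_tape 0) = T" by (auto simp: fun_eq_iff)
  moreover have "exec M (cseek s) T 1 T" unfolding cseek_def
    by (rule exec_while_end) (simp add: 0 scan_mark)
  ultimately show ?case by (simp del: fun_upd_apply)
next
  case (Suc m)
  let ?T = "T(0 := (f, - s * int m), 15 := mark_tape (- s * int m))"
  have p: "- s * int (Suc m) + sgn s = - s * int m" using assms by auto
  have 1: "exec M (CSeq (CAct 0 3 s) (CAct 15 3 s)) T 3 ?T"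
    using exec_move_pair[OF Suc.prems, of M s] unfolding p .
  have 2: "exec M (cseek s) ?T (4 * m + 1) (T(0 := (f, 0), 15 := mark_tape 0))"
  proof -
    have "?T 0 = (f, - s * int m)" "?T 15 = mark_tape (- s * int m)" by simp_all
    from Suc.IH[OF this] have "exec M (cseek s) ?T (4 * m + 1) (?T(0 := (f, 0), 15 := mark_tape 0))" .
    moreover have "?T(0 := (f, 0), 15 := mark_tape 0) = T(0 := (f, 0), 15 := mark_tape 0)"
      by (simp add: fun_eq_iff)
    ultimately show ?thesis by (simp only:)
  qed
  have 3: "scan T 15 \<noteq> 2" using assms by (auto simp: Suc.prems scan_mark)
  show ?case unfolding cseek_def
    by (rule exec_mono[OF exec_while_step[where P = "\<lambda>s. s \<noteq> 2", OF 3 1 2[unfolded cseek_def]]]) simp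
qed

text \<open>Each zero of register 7 pays for one bit of the output. An output with fewer bits than
  the exponent holds the head at its end.\<close>

definition skip_com :: com where
  "skip_com = CWhile 7 (\<lambda>s. s \<noteq> 0) (CSeq (CAct 7 0 (-1))
     (CIf 0 (\<lambda>s. s \<in> {1, 2}) (CSeq (CAct 0 3 1) (CAct 15 3 1)) (CAct 0 3 0)))"

text \<open>Since the position stays put behind the last bit, \<open>j\<close> iterations from 0
  lead to the minimum of \<open>j\<close> and the length of the output.\<close>

definition advance :: "(int \<Rightarrow> nat) \<Rightarrow> nat \<Rightarrow> nat" where
  "advance f i = (if f (int i) \<in> {1, 2} then Suc i else i)"

definition at_pos :: "(nat \<Rightarrow> tape) \<Rightarrow> (int \<Rightarrow> nat) \<Rightarrow> nat \<Rightarrow> bool list \<Rightarrow> (nat \<Rightarrow> tape)" where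
  "at_pos T f i h = T(0 := (f, int i), 15 := mark_tape (int i), 7 := reg_tape 0 h)"

lemma at_pos_simps [simp]: "at_pos T f i h 0 = (f, int i)" "at_pos T f i h 15 = mark_tape (int i)"
    "at_pos T f i h 7 = reg_tape 0 h"
  by (simp_all add: at_pos_def)

lemma exec_skip:
  "exec M skip_com (at_pos T f i (replicate m False)) (10 * m + 1) (at_pos T f ((advance f ^^ m) i) [])"
proof (induction m arbitrary: i)
  case 0
  have "exec M skip_com (at_pos T f i []) 1 (at_pos T f i [])" unfolding skip_com_def
    by (rule exec_while_end) (simp add: scan_reg_tape)
  then show ?case by simp
next
  case (Suc m)
  let ?T = "at_pos T f i (replicate (Suc m) False)"
  let ?T1 = "at_pos T f i (replicate m False)"
  let ?T2 = "at_pos T f (advance f i) (replicate m False)"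
  have "exec M (CAct 7 0 (-1)) ?T 1 (?T(7 := reg_tape 0 (butlast (replicate (Suc m) False))))"
    by (rule exec_pop_nonempty) auto
  moreover have "?T(7 := reg_tape 0 (butlast (replicate (Suc m) False))) = ?T1"
    by (simp add: at_pos_def butlast_conv_take min_def take_replicate del: replicate_Suc)
  ultimately have 1: "exec M (CAct 7 0 (-1)) ?T 1 ?T1" by simp
  have "exec M (if f (int i) \<in> {1, 2} then CSeq (CAct 0 3 1) (CAct 15 3 1) else CAct 0 3 0) ?T1 3 ?T2"
  proof (cases "f (int i) \<in> {1, 2}")
    case True
    have "?T1(0 := (f, int i + sgn 1), 15 := mark_tape (int i + sgn 1)) = ?T2"
      using True by (auto simp: at_pos_def advance_def fun_eq_iff add.commute)
    with exec_move_pair[of ?T1 f "int i" M 1] True show ?thesis by simp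
  next
    case False
    have "exec M (CAct 0 3 0) ?T1 1 ?T1" by (rule exec_move) (simp add: at_pos_def fun_eq_iff)
    then show ?thesis using False exec_mono[of M "CAct 0 3 0" ?T1 1 ?T1 3] by (auto simp: advance_def)
  qed
  then have 2: "exec M (CIf 0 (\<lambda>s. s \<in> {1, 2}) (CSeq (CAct 0 3 1) (CAct 15 3 1)) (CAct 0 3 0)) ?T1 (3 + 1) ?T2"
    by (intro exec_if) simp
  have 3: "scan ?T 7 \<noteq> 0" by (simp add: scan_reg_tape)
  have eq: "(advance f ^^ m) (advance f i) = (advance f ^^ Suc m) i" by (simp add: funpow_swap1)
  show ?case unfolding skip_com_def
    by (rule exec_mono[OF exec_while_step[where P = "\<lambda>s. s \<noteq> 0", OF 3 exec_seq[OF 1 2]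
            Suc.IH[of "advance f i", unfolded skip_com_def eq]]]) simp
qed

definition zeros_com :: com where
  "zeros_com = CWhile 0 (\<lambda>s. s = 1) (CSeq (CAct 0 3 1) (CAct 15 3 1))"

lemma exec_zeros:
  "f (int (i + m)) \<noteq> 1 \<Longrightarrow> (\<And>j. i \<le> j \<Longrightarrow> j < i + m \<Longrightarrow> f (int j) = 1) \<Longrightarrow>
    exec M zeros_com (at_pos T f i []) (4 * m + 1) (at_pos T f (i + m) [])"
proof (induction m arbitrary: i)
  case 0
  have "exec M zeros_com (at_pos T f i []) 1 (at_pos T f i [])" unfolding zeros_com_def
    by (rule exec_while_end) (use 0 in simp)
  then show ?case by simp
next
  case (Suc m)
  have "(at_pos T f i [])(0 := (f, int i + sgn 1), 15 := mark_tape (int i + sgn 1)) = at_pos T f (Suc i) []"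
    by (auto simp: at_pos_def fun_eq_iff add.commute)
  with exec_move_pair[of "at_pos T f i []" f "int i" M 1]
  have 1: "exec M (CSeq (CAct 0 3 1) (CAct 15 3 1)) (at_pos T f i []) 3 (at_pos T f (Suc i) [])" by simp
  have 2: "exec M zeros_com (at_pos T f (Suc i) []) (4 * m + 1) (at_pos T f (Suc i + m) [])"
    by (rule Suc.IH) (use Suc.prems in auto)
  have 3: "scan (at_pos T f i []) 0 = 1" using Suc.prems(2)[of i] by simp
  have eq: "Suc i + m = i + Suc m" by simp
  show ?case unfolding zeros_com_def
    by (rule exec_mono[OF exec_while_step[where P = "\<lambda>s. s = 1", OF 3 1 2[unfolded zeros_com_def eq]]]) simp
qed

text \<open>Numerals start with the least significant bit, so a value is below 2^j iff no one occurs
  from position j on. After skipping j bits and the zeros that follow, a symbol 2 therefore means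
  rejection. The output \<open>[True]\<close> is written as a one followed by a blank; for rejection
  a blank in cell 0 gives the empty output.\<close>

definition post_com :: com where
  "post_com = CSeq skip_com (CSeq zeros_com (CIf 0 (\<lambda>s. s = 2)
     (CSeq (cseek (-1)) (CSeq (CAct 0 0 0) CHalt))
     (CSeq (cseek (-1)) (CSeq (CAct 0 2 1) (CSeq (CAct 0 0 0) CHalt)))))"

lemma horner_less_power:
  "horner_sum of_bool (2::nat) v < 2 ^ j \<longleftrightarrow> (\<forall>i. j \<le> i \<longrightarrow> i < length v \<longrightarrow> \<not> v ! i)"
proof (induction v arbitrary: j)
  case Nil
  then show ?case by simp
next
  case (Cons b v)
  show ?case
  proof (cases j)
    case 0
    have "horner_sum of_bool (2::nat) v = 0 \<longleftrightarrow> (\<forall>i < length v. \<not> v ! i)"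
      using Cons.IH[of 0] by auto
    then show ?thesis using 0 by (auto simp: nth_Cons split: nat.splits)
  next
    case (Suc k)
    have "horner_sum of_bool (2::nat) (b # v) < 2 ^ j \<longleftrightarrow> horner_sum of_bool (2::nat) v < 2 ^ k"
      using Suc by (cases b) auto
    moreover have "(\<forall>i. j \<le> i \<longrightarrow> i < length (b # v) \<longrightarrow> \<not> (b # v) ! i) \<longleftrightarrow>
        (\<forall>i. k \<le> i \<longrightarrow> i < length v \<longrightarrow> \<not> v ! i)"
      using Suc by (auto simp: nth_Cons split: nat.splits)
    ultimately show ?thesis using Cons.IH by simp
  qed
qed

lemma tape_bits_eqI:
  assumes "\<And>i. i < length v \<Longrightarrow> fst tp (int i) = bit_sym (v ! i)" "fst tp (int (length v)) \<notin> {1, 2}"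
  shows "tape_bits tp = v"
proof -
  have "(LEAST i. fst tp (int i) \<notin> {1, 2}) = length v"
  proof (rule Least_equality)
    fix i assume "fst tp (int i) \<notin> {1, 2}"
    then show "length v \<le> i" using assms(1)[of i] by (cases "i < length v") (auto simp: bit_sym_def split: if_splits)
  qed (use assms in simp)
  then show ?thesis unfolding tape_bits_def using assms(1) by (intro nth_equalityI) auto
qed

text \<open>The cell \<open>N\<close> witnesses that some cell is not a bit, without which the least
  such cell would be meaningless.\<close>

lemma tape_bits_cells:
  fixes f :: "int \<Rightarrow> nat" and p :: int
  assumes "f (int N) \<notin> {1, 2}"
  defines "v \<equiv> tape_bits (f, p)"
  shows "length v \<le> N" "f (int (length v)) \<notin> {1, 2}" "\<And>i. i < length v \<Longrightarrow> f (int i) = bit_sym (v ! i)"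
proof -
  have len: "length v = (LEAST i. f (int i) \<notin> {1, 2})" by (simp add: v_def tape_bits_def)
  show "length v \<le> N" unfolding len using assms(1) by (intro Least_le)
  show "f (int (length v)) \<notin> {1, 2}" unfolding len using assms(1) by (rule LeastI)
  fix i assume i: "i < length v"
  have "f (int i) \<in> {1, 2}" using not_less_Least[of i "\<lambda>i. f (int i) \<notin> {1, 2}"] i len by auto
  moreover have "v ! i = (f (int i) = 2)" using i by (simp add: v_def tape_bits_def)
  ultimately show "f (int i) = bit_sym (v ! i)" by (auto simp: bit_sym_def)
qed

lemma reaches_post:
  fixes f :: "int \<Rightarrow> nat" and p :: int
  assumes "f (int N) \<notin> {1, 2}"
  defines "v \<equiv> tape_bits (f, p)"
  shows "\<exists>T' t. t \<le> 10 * j + 10 * N + 50 \<and>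
    reaches M (post_com # k, at_pos T f 0 (replicate j False)) t (CHalt # k, T') \<and>
    tape_bits (T' 0) = (if horner_sum of_bool (2::nat) v < 2 ^ j then [True] else [])"
proof -
  note cells = tape_bits_cells[where f = f and N = N and p = p, OF assms(1), folded v_def]
  have adv: "(advance f ^^ m) 0 = min m (length v)" for m
  proof (induction m)
    case (Suc m)
    then show ?case using cells(2) cells(3)[of m]
      by (cases "m < length v") (auto simp: advance_def min_def bit_sym_def)
  qed simp
  \<comment> \<open>A short output stops the skipping at its end.\<close>
  define i where "i = min j (length v)"
  have ex: "\<exists>m. f (int (i + m)) \<noteq> 1" using cells(2) by (intro exI[of _ "length v - i"]) (auto simp: i_def)
  define m where "m = (LEAST m. f (int (i + m)) \<noteq> 1)"
  have m1: "f (int (i + m)) \<noteq> 1" unfolding m_def using LeastI_ex[OF ex] .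
  have m2: "f (int (i + m')) = 1" if "m' < m" for m'
    using not_less_Least[of m' "\<lambda>m. f (int (i + m)) \<noteq> 1"] that by (auto simp: m_def)
  have m3: "i + m \<le> length v"
  proof -
    have il: "i \<le> length v" by (simp add: i_def)
    then have "f (int (i + (length v - i))) \<noteq> 1" using cells(2) by simp
    then have "m \<le> length v - i" unfolding m_def by (rule Least_le)
    then show ?thesis using il by simp
  qed
  have ones: "f (int j') = 1" if "i \<le> j'" "j' < i + m" for j'
    using m2[of "j' - i"] that by simp
  let ?T0 = "at_pos T f 0 (replicate j False)"
  let ?T1 = "at_pos T f i []"
  let ?T2 = "at_pos T f (i + m) []"
  have 1: "exec M skip_com ?T0 (10 * j + 1) ?T1" using exec_skip[of M T f 0 j] by (simp add: adv i_def)
  have 2: "exec M zeros_com ?T1 (4 * m + 1) ?T2" by (rule exec_zeros[of f i m]) (use m1 ones in auto)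
  \<comment> \<open>The first symbol other than a zero bit is either a one at a position of at least
    \<open>j\<close> or the end of the output.\<close>
  have key: "f (int (i + m)) = 2 \<longleftrightarrow> \<not> horner_sum of_bool (2::nat) v < 2 ^ j"
  proof
    assume f2: "f (int (i + m)) = 2"
    then have lt: "i + m < length v" using m3 cells(2) by (cases "i + m = length v") auto
    then have "v ! (i + m)" using cells(3)[OF lt] f2 by (simp del: of_nat_add)
    moreover have "j \<le> i + m" using lt by (auto simp: i_def)
    ultimately show "\<not> horner_sum of_bool (2::nat) v < 2 ^ j" unfolding horner_less_power using lt by blast
  next
    assume "\<not> horner_sum of_bool (2::nat) v < 2 ^ j"
    then obtain i' where i': "j \<le> i'" "i' < length v" "v ! i'" unfolding horner_less_power by blast
    then have i: "i = j" by (simp add: i_def)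
    have fi': "f (int i') = 2" using cells(3)[OF i'(2)] i'(3) by (simp add: bit_sym_def)
    have "i + m \<le> i'" using ones[of i'] fi' i' i by (cases "i' < i + m") auto
    then have lt: "i + m < length v" using i' by simp
    show "f (int (i + m)) = 2" using cells(3)[OF lt] m1 by (auto simp: bit_sym_def split: if_splits)
  qed
  let ?c2 = "CIf 0 (\<lambda>s. s = 2) (CSeq (cseek (-1)) (CSeq (CAct 0 0 0) CHalt))
     (CSeq (cseek (-1)) (CSeq (CAct 0 2 1) (CSeq (CAct 0 0 0) CHalt)))"
  obtain t1 where t1: "t1 \<le> 10 * j + 1 + 1" "reaches M (post_com # k, ?T0) t1 (CSeq zeros_com ?c2 # k, ?T1)"
    using reaches_seq[OF 1] unfolding post_com_def by blast
  obtain t2 where t2: "t2 \<le> 4 * m + 1 + 1" "reaches M (CSeq zeros_com ?c2 # k, ?T1) t2 (?c2 # k, ?T2)"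
    using reaches_seq[OF 2] by blast
  let ?T3 = "?T2(0 := (f, 0), 15 := mark_tape 0)"
  have 3: "exec M (cseek (-1)) ?T2 (4 * (i + m) + 1) ?T3"
    by (rule exec_seek) auto
  have "reaches M (?c2 # k, ?T2) 1 ((if scan ?T2 0 = 2 then CSeq (cseek (-1)) (CSeq (CAct 0 0 0) CHalt)
     else CSeq (cseek (-1)) (CSeq (CAct 0 2 1) (CSeq (CAct 0 0 0) CHalt))) # k, ?T2)"
    by (rule reaches_if)
  then have t3: "reaches M (?c2 # k, ?T2) 1 ((if horner_sum of_bool (2::nat) v < 2 ^ j
     then CSeq (cseek (-1)) (CSeq (CAct 0 2 1) (CSeq (CAct 0 0 0) CHalt))
     else CSeq (cseek (-1)) (CSeq (CAct 0 0 0) CHalt)) # k, ?T2)"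
    using key by (cases "horner_sum of_bool (2::nat) v < 2 ^ j") (simp_all del: of_nat_add)
  have "\<exists>T' t. t \<le> 4 * (i + m) + 10 \<and> reaches M ((if horner_sum of_bool (2::nat) v < 2 ^ j
     then CSeq (cseek (-1)) (CSeq (CAct 0 2 1) (CSeq (CAct 0 0 0) CHalt))
     else CSeq (cseek (-1)) (CSeq (CAct 0 0 0) CHalt)) # k, ?T2) t (CHalt # k, T') \<and>
    tape_bits (T' 0) = (if horner_sum of_bool (2::nat) v < 2 ^ j then [True] else [])"
  proof (cases "horner_sum of_bool (2::nat) v < 2 ^ j")
    case True
    let ?T4 = "?T3(0 := (f(0 := 2), 1))"
    let ?T5 = "?T3(0 := (f(0 := 2, 1 := 0), 1))"
    have 4: "exec M (CAct 0 2 1) ?T3 1 ?T4" by (rule exec_act') (simp add: act_def fun_eq_iff)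
    have 5: "exec M (CAct 0 0 0) ?T4 1 ?T5" by (rule exec_act') (simp add: act_def fun_eq_iff)
    obtain u1 where u1: "u1 \<le> 4 * (i + m) + 1 + 1" "reaches M
      (CSeq (cseek (-1)) (CSeq (CAct 0 2 1) (CSeq (CAct 0 0 0) CHalt)) # k, ?T2) u1
      (CSeq (CAct 0 2 1) (CSeq (CAct 0 0 0) CHalt) # k, ?T3)" using reaches_seq[OF 3] by blast
    obtain u2 where u2: "u2 \<le> 1 + 1" "reaches M (CSeq (CAct 0 2 1) (CSeq (CAct 0 0 0) CHalt) # k, ?T3) u2
      (CSeq (CAct 0 0 0) CHalt # k, ?T4)" using reaches_seq[OF 4] by blast
    obtain u3 where u3: "u3 \<le> 1 + 1" "reaches M (CSeq (CAct 0 0 0) CHalt # k, ?T4) u3 (CHalt # k, ?T5)"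
      using reaches_seq[OF 5] by blast
    have "tape_bits (?T5 0) = [True]" by (rule tape_bits_eqI) (auto simp: bit_sym_def)
    then show ?thesis using True reaches_trans[OF reaches_trans[OF u1(2) u2(2)] u3(2)] u1(1) u2(1) u3(1)
      by (intro exI[of _ ?T5] exI[of _ "u1 + u2 + u3"]) (simp del: fun_upd_apply)
  next
    case False
    let ?T4 = "?T3(0 := (f(0 := 0), 0))"
    have 4: "exec M (CAct 0 0 0) ?T3 1 ?T4" by (rule exec_act') (simp add: act_def fun_eq_iff)
    obtain u1 where u1: "u1 \<le> 4 * (i + m) + 1 + 1" "reaches M
      (CSeq (cseek (-1)) (CSeq (CAct 0 0 0) CHalt) # k, ?T2) u1
      (CSeq (CAct 0 0 0) CHalt # k, ?T3)" using reaches_seq[OF 3] by blast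
    obtain u2 where u2: "u2 \<le> 1 + 1" "reaches M (CSeq (CAct 0 0 0) CHalt # k, ?T3) u2 (CHalt # k, ?T4)"
      using reaches_seq[OF 4] by blast
    have "tape_bits (?T4 0) = []" by (rule tape_bits_eqI) (auto simp: bit_sym_def)
    then show ?thesis using False reaches_trans[OF u1(2) u2(2)] u1(1) u2(1)
      by (intro exI[of _ ?T4] exI[of _ "u1 + u2"]) (simp del: fun_upd_apply)
  qed
  then obtain T' t where t: "t \<le> 4 * (i + m) + 10" "reaches M ((if horner_sum of_bool (2::nat) v < 2 ^ j
     then CSeq (cseek (-1)) (CSeq (CAct 0 2 1) (CSeq (CAct 0 0 0) CHalt))
     else CSeq (cseek (-1)) (CSeq (CAct 0 0 0) CHalt)) # k, ?T2) t (CHalt # k, T')"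
    "tape_bits (T' 0) = (if horner_sum of_bool (2::nat) v < 2 ^ j then [True] else [])" by blast
  have "reaches M (post_com # k, ?T0) (t1 + t2 + 1 + t) (CHalt # k, T')"
    by (rule reaches_trans[OF reaches_trans[OF reaches_trans[OF t1(2) t2(2)] t3] t(2)])
  moreover have "t1 + t2 + 1 + t \<le> 10 * j + 10 * N + 50"
    using t1(1) t2(1) t(1) m3 cells(1) by simp
  ultimately show ?thesis using t(3) by blast
qed

section \<open>Distinguishing machines\<close>

text \<open>No head gets this far in the given time, so such a cell bounds the length of any
  output.\<close>

lemma tape0_blank:
  assumes "wf_tm M" "p \<ge> int (length w + length cs)"
  shows "fst (snd (run M Q w cs) ! 0) p = 0"
  using assms(2)
proof (induction cs rule: rev_induct)
  case Nil
  then show ?case by (simp add: run_def init_config_def bits_tape_def)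
next
  case (snoc b cs)
  have n: "0 < ntapes M" using assms(1) by (simp add: wf_tm_def)
  obtain q tps where c: "run M Q w cs = (q, tps)" by fastforce
  have wf: "wf_config M (q, tps)" using wf_config_run[OF assms(1), of Q w cs] c by simp
  have "snd (tps ! 0) \<noteq> p" using head_bound_run[OF assms(1) n, of Q w cs] snoc.prems c by auto
  moreover have "fst (tps ! 0) p = 0" using snoc c by simp
  ultimately show ?case
    using wf_config_delta(2)[OF assms(1) wf, of b] n wf
    by (auto simp: run_snoc c step_simps act_def wf_config_def)
qed

section \<open>Admissibility of the programs\<close>

lemma prog_ok_op: "op_ok x \<Longrightarrow> prog_ok M (op_com x)"
  by (cases x) (auto simp: cpush_def cpop_def cclear_def capp_def cleft_def)

lemma prog_ok_ops: "list_all op_ok xs \<Longrightarrow> prog_ok M (ops_com xs)"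
  by (induction xs) (auto simp: prog_ok_op)

lemma prog_ok_cinc: "x < 15 \<Longrightarrow> z < 15 \<Longrightarrow> prog_ok M ov \<Longrightarrow> prog_ok M (cinc x z ov)"
  by (simp add: cinc_def prog_ok_op del: op_com.simps)

lemma prog_ok_emit: "prog_ok M emit_com"
  by (simp add: emit_com_def chain_com_def restore_com_def lit_ops_def and_ops_def prog_ok_op del: op_com.simps)

lemma prog_ok_next: "prog_ok M fin \<Longrightarrow> prog_ok M (next_com fin)"
  by (simp add: next_com_def prog_ok_cinc prep_ops_def prog_ok_op del: op_com.simps)

lemma prog_ok_init: "prog_ok M c \<Longrightarrow> prog_ok M (init_com a b c)"
  by (auto simp: init_com_def start_com_def count_com_def prog_ok_cinc widen_com_def start_ops_def prog_ok_op
      widen_ops_def list_all_iff intro!: prog_ok_ops prog_ok_cinc simp del: op_com.simps ops_com.simps)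

lemma prog_ok_narrow: "prog_ok M narrow_com"
  by (simp add: narrow_com_def prog_ok_op del: op_com.simps)

lemma prog_ok_pad: "prog_ok M pad_com"
  by (simp add: pad_com_def prog_ok_cinc prog_ok_op del: op_com.simps)

lemma prog_ok_fin: "wf_tm M \<Longrightarrow> prog_ok M c \<Longrightarrow> prog_ok M d \<Longrightarrow> prog_ok M (fin_com dec c d)"
  by (auto simp: fin_com_def fin_ops_def cleft_def wf_tm_def intro!: prog_ok_ops simp del: op_com.simps ops_com.simps)

lemma prog_ok_post: "prog_ok M (CSeq (cseek s) post_com)"
  by (simp add: cseek_def post_com_def skip_com_def zeros_com_def)

section \<open>The assembled testing machine\<close>

definition tester_points :: "nat \<Rightarrow> nat \<Rightarrow> (bool list \<Rightarrow> bool) \<Rightarrow> bool list list" where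
  "tester_points a n Q =
     filter (\<lambda>x. Q (x @ replicate (n - a * bit_len n) False)) (all_points (a * bit_len n))"

definition loop_time :: "nat \<Rightarrow> nat \<Rightarrow> nat \<Rightarrow> nat \<Rightarrow> nat \<Rightarrow> nat" where
  "loop_time a b n I t = (let l = a * bit_len n in
     2 * n + n * (60 * n + 100) + n * (30 * a + 10 * b + 20) + t + 20 * l + 40 * I + 10 * n + 301 +
     2 ^ l * ((l + 1) * (100 * (l + I + 2 * (I + 2 ^ l * (2 * l + 2) + 1 + 2 * l)) + 900) + 20 * n))"

definition tester_tm :: "tm \<Rightarrow> nat \<Rightarrow> nat \<Rightarrow> com \<Rightarrow> com \<Rightarrow> tm" where
  "tester_tm M a b c fin = prog_tm M (init_com a b c) (CSeq emit_com (next_com fin)) (next_com fin)"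

definition tester_config :: "tm \<Rightarrow> nat \<Rightarrow> nat \<Rightarrow> com \<Rightarrow> com \<Rightarrow> state \<Rightarrow> config" where
  "tester_config M a b c fin = prog_config M (init_com a b c) (CSeq emit_com (next_com fin)) (next_com fin)"

lemma wf_tester_tm:
  assumes "wf_tm M" "prog_ok M c" "prog_ok M fin" shows "wf_tm (tester_tm M a b c fin)"
  unfolding tester_tm_def
  by (rule wf_prog_tm) (use assms in \<open>auto simp: prog_ok_init prog_ok_emit prog_ok_next\<close>)

lemma tester_loop:
  fixes n a b I :: nat and Q :: "bool list \<Rightarrow> bool"
  defines "l \<equiv> a * bit_len n"
  defines "h \<equiv> replicate (b * bit_len n) False" and "pad \<equiv> replicate (n - l) False"
  defines "gs \<equiv> tt_gates I (tester_points a n Q)"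
  assumes wf: "wf_tm M" and ok: "prog_ok M c" "prog_ok M fin"
    and c: "rexec M c (init_regs l h pad 0) tc (init_regs l h pad I)"
  shows "\<exists>t \<le> loop_time a b n I tc. tm_steps (tester_tm M a b c fin) Q
    (init_config (tester_tm M a b c fin) (unary_input n)) t
    (tester_config M a b c fin ([fin], regs (main_regs I h pad (replicate l False) (length gs - 2)
      (enc_gates gs) (replicate l True @ pad) [True])))"
proof -
  let ?pi = "init_com a b c" and ?py = "CSeq emit_com (next_com fin)" and ?pn = "next_com fin"
  let ?A = "tester_tm M a b c fin" and ?cf = "tester_config M a b c fin"
  have ok': "prog_ok M ?pi" "prog_ok M ?py" "prog_ok M ?pn"
    using ok by (auto simp: prog_ok_init prog_ok_emit prog_ok_next)
  let ?T1 = "regs (main_regs I h pad (replicate l False) 0 (enc_gates (tt_gates I [])) (replicate l False @ pad) [])"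
  define t0 where "t0 = 2 * n + n * (60 * n + 100) + n * (30 * a + 10 * b + 20) + tc + 20 * l + 40 * I + 10 * n + 300"
  have "exec M ?pi (init_tapes (un n)) t0 ?T1"
    unfolding t0_def l_def h_def pad_def
    by (rule exec_init) (use c in \<open>simp add: l_def h_def pad_def\<close>)
  from exec_reaches[OF this, of "[]"] obtain t1 where
    t1: "t1 \<le> t0" "reaches M ([?pi], init_tapes (un n)) t1 ([], ?T1)" by blast
  have s1: "tm_steps ?A Q (?cf ([?pi], init_tapes (un n))) t1 (?cf ([], ?T1))"
    using reaches_tm_steps[OF wf ok' t1(2), of Q] prog_states_start(1)
    by (simp add: tester_tm_def tester_config_def)
  have nt: "ntapes ?A = ntapes M + 15" by (simp add: tester_tm_def prog_tm_def[OF wf])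
  have "init_config ?A (unary_input n) = (0, map (init_tapes (un n)) [0..<ntapes M + 15])"
    using init_config_tapes[of ?A "unary_input n"] nt by (auto simp: init_config_def un_def prod_eq_iff)
  then have s0: "tm_steps ?A Q (init_config ?A (unary_input n)) 1 (?cf ([?pi], init_tapes (un n)))"
    using start_steps[OF wf, where p = ?pi and ?p1.0 = ?py and ?p0.0 = ?pn and Q = Q and T = "init_tapes (un n)"] ok'
    by (simp add: tester_tm_def tester_config_def)
  have pts0: "all_points l ! 0 = replicate l False" by (rule all_points_first)
  define K where "K = l + I + 2 * (I + 2 ^ l * (2 * l + 2) + 1 + 2 * l)"
  obtain t2 where t2: "t2 \<le> 2 ^ l * ((l + 1) * (100 * K + 900) + 20 * length pad)"
    "tm_steps ?A Q (?cf ([], ?T1)) t2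
      (?cf ([fin], regs (main_regs I h pad (replicate l False) (length gs - 2) (enc_gates gs) (replicate l True @ pad) [True])))"
  proof -
    have c0: "length (tt_gates I []) - 2 = 0" by (simp add: tt_gates_Nil)
    have gs: "tt_gates I (filter (\<lambda>x. Q (x @ pad)) (take (2 ^ l) (all_points l))) = gs"
      by (simp add: gs_def tester_points_def l_def pad_def)
    have i0: "(0::nat) < 2 ^ l" by simp
    have "\<exists>t \<le> 2 ^ l * ((l + 1) * (100 * K + 900) + 20 * length pad). tm_steps ?A Q (?cf ([], ?T1)) t
      (?cf ([fin], regs (main_regs I h pad (replicate l False) (length gs - 2) (enc_gates gs) (replicate l True @ pad) [True])))"
      using main_loop[OF wf ok' i0, where Q = Q and pad = pad and I = I and h = h]
      unfolding pts0 take_0 filter.simps c0 gs diff_zero K_def tester_tm_def tester_config_def .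
    then show ?thesis using that by blast
  qed
  have "tm_steps ?A Q (init_config ?A (unary_input n)) (1 + t1 + t2)
      (?cf ([fin], regs (main_regs I h pad (replicate l False) (length gs - 2) (enc_gates gs) (replicate l True @ pad) [True])))"
    by (rule tm_steps_trans[OF tm_steps_trans[OF s0 s1] t2(2)])
  moreover have "1 + t1 + t2 \<le> loop_time a b n I tc"
  proof -
    have "2 ^ l * ((l + 1) * (100 * K + 900) + 20 * length pad) \<le> 2 ^ l * ((l + 1) * (100 * K + 900) + 20 * n)"
      by (intro mult_left_mono add_left_mono) (auto simp: pad_def)
    then have "t2 \<le> 2 ^ l * ((l + 1) * (100 * K + 900) + 20 * n)" using t2(1) by linarith
    then show ?thesis using t1(1)
      by (simp only: loop_time_def Let_def l_def[symmetric] t0_def K_def)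
  qed
  ultimately show ?thesis by blast
qed

lemma tester_fin_state:
  assumes "wf_tm M" "prog_ok M c" "prog_ok M fin" "reaches M ([fin], T) t (CHalt # k, T')"
    "[fin] \<in> prog_states M (init_com a b c) (CSeq emit_com (next_com fin)) (next_com fin)"
  shows "tm_steps (tester_tm M a b c fin) Q (tester_config M a b c fin ([fin], T)) t
      (tester_config M a b c fin (CHalt # k, T'))"
  using reaches_tm_steps[OF assms(1) _ _ _ assms(4), of "init_com a b c" "CSeq emit_com (next_com fin)" "next_com fin" Q]
    assms by (simp add: tester_tm_def tester_config_def prog_ok_init prog_ok_emit prog_ok_next)

lemma fin_state:
  "[fin] \<in> prog_states M p p1 (next_com fin)"
  using conts_self[of fin "[]" M] by (auto simp: prog_states_def next_com_def)

lemma tm_output_tester: "tm_output (tester_config M a b c fin (s, T)) = tape_bits (T 0)"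
proof -
  have "[0..<ntapes M + 15] = 0 # [1..<ntapes M + 15]" by (simp add: upt_conv_Cons)
  then show ?thesis by (simp add: tm_output_def tester_config_def prog_config_def)
qed

definition tester_word :: "nat \<Rightarrow> nat \<Rightarrow> nat \<Rightarrow> nat \<Rightarrow> (bool list \<Rightarrow> bool) \<Rightarrow> bool \<Rightarrow> bool list" where
  "tester_word a b n I Q dec = enc_circuit (tt_circuit I (tester_points a n Q)) @
     (if dec then replicate (b * bit_len n) False @ [True] else [])"

text \<open>The last clause leaves open what happens after the simulated machine has halted, so that
  the two testers, which differ there, share everything before.\<close>

lemma tester_run:
  fixes n a b :: nat
  defines "l \<equiv> a * bit_len n"
  defines "h \<equiv> replicate (b * bit_len n) False" and "pad \<equiv> replicate (n - l) False"
  assumes det: "deterministic_tm M" and ok: "prog_ok M c" "prog_ok M d1" "prog_ok M d2"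
    and c: "rexec M c (init_regs l h pad 0) tc (init_regs l h pad I)"
    and halt: "halted (run M (\<lambda>_. False) (tester_word a b n I Q dec) (replicate \<tau> False))"
  shows "\<exists>t T s. t \<le> loop_time a b n I tc + 20 * length (tester_word a b n I Q dec) + 200 + \<tau> \<and>
    runs_on M (snd (run M (\<lambda>_. False) (tester_word a b n I Q dec) (replicate \<tau> False))) T \<and>
    side_ok s (snd (run M (\<lambda>_. False) (tester_word a b n I Q dec) (replicate \<tau> False))) \<and>
    T 7 = reg_tape 0 h \<and>
    (\<forall>u T'. reaches M ([if s then d1 else d2], T) u ([CHalt], T') \<longrightarrow>
      tm_steps (tester_tm M a b c (fin_com dec d1 d2)) Q
        (init_config (tester_tm M a b c (fin_com dec d1 d2)) (unary_input n)) (t + u)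
        (tester_config M a b c (fin_com dec d1 d2) ([CHalt], T')))"
proof -
  let ?w = "tester_word a b n I Q dec"
  let ?fin = "fin_com dec d1 d2"
  have wf: "wf_tm M" using det by (simp add: deterministic_tm_def)
  have okf: "prog_ok M ?fin" using ok wf by (intro prog_ok_fin)
  define gs where "gs = tt_gates I (tester_points a n Q)"
  let ?R = "main_regs I h pad (replicate l False) (length gs - 2) (enc_gates gs) (replicate l True @ pad) [True]"
  obtain t1 where t1: "t1 \<le> loop_time a b n I tc" "tm_steps (tester_tm M a b c ?fin) Q
    (init_config (tester_tm M a b c ?fin) (unary_input n)) t1 (tester_config M a b c ?fin ([?fin], regs ?R))"
    using tester_loop[OF wf ok(1) okf, where n = n and a = a and b = b and I = I and tc = tc and Q = Q,
        folded l_def, folded h_def pad_def gs_def, OF c]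
    by (elim exE conjE) (rule that)
  have w: "?w = un I @ False # un (length gs - 2 + 2) @ False # enc_gates gs @ un (I + (length gs - 2) + 1) @
      False # (if dec then h @ [True] else [])"
    unfolding tester_word_def enc_tt_circuit gs_def h_def by simp
  obtain T t2 where t2: "t2 \<le> 20 * length ?w + 200"
    "reaches M ([?fin], regs ?R) t2 ([CMach 0 True d1 d2], T)"
    "T 0 = bits_tape ?w" "T 15 = mark_tape 0" "T 7 = reg_tape 0 h" "\<forall>j \<ge> 16. T j = bits_tape []"
    using reaches_fin[where I = I and cc = "length gs - 2" and g = "enc_gates gs" and dec = dec and h = h
        and M = M and c = d1 and d = d2 and k = "[]" and pad = pad and x = "replicate l False"
        and q = "replicate l True @ pad" and ov = "[True]", folded w]
    by (elim exE conjE) (rule that)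
  have on: "runs_on M (snd (init_config M ?w)) T" by (rule runs_on_init[OF wf t2(3,4,6)])
  obtain t3 s T3 where t3: "t3 \<le> \<tau>"
    "\<And>k. reaches M (CMach 0 True d1 d2 # k, T) t3 ((if s then d1 else d2) # k, T3)"
    "runs_on M (snd (run M (\<lambda>_. False) ?w (replicate \<tau> False))) T3"
    "side_ok s (snd (run M (\<lambda>_. False) ?w (replicate \<tau> False)))"
    "\<And>j. 0 < j \<Longrightarrow> j < 15 \<Longrightarrow> T3 j = T j"
    by (rule reaches_mach[OF det on halt, where c = d1 and d = d2]) (rule that)
  have r: "reaches M ([?fin], regs ?R) (t2 + t3) ([if s then d1 else d2], T3)"
    by (rule reaches_trans[OF t2(2) t3(2)])
  have "tm_steps (tester_tm M a b c ?fin) Q (init_config (tester_tm M a b c ?fin) (unary_input n))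
      (t1 + t2 + t3 + u) (tester_config M a b c ?fin ([CHalt], T'))"
    if "reaches M ([if s then d1 else d2], T3) u ([CHalt], T')" for u T'
    using tm_steps_trans[OF t1(2) tester_fin_state[OF wf ok(1) okf reaches_trans[OF r that] fin_state]]
    by (simp add: add.assoc)
  moreover have "T3 7 = reg_tape 0 h" using t3(5)[of 7] t2(5) by simp
  ultimately show ?thesis using t1(1) t2(1) t3(1,3,4)
    by (intro exI[of _ "t1 + t2 + t3"] exI[of _ T3] exI[of _ s]) auto
qed

lemma halted_tester: "wf_tm M \<Longrightarrow> halted (tester_config M a b c fin (CHalt # k, T))"
  by (simp add: halted_def tester_config_def prog_config_def enc_state_def)

lemma runs_on_0: "runs_on M tps T \<Longrightarrow> wf_tm M \<Longrightarrow> T 0 = tps ! 0"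
  by (auto simp: runs_on_def tape_index_def wf_tm_def dest: spec[of _ 0])

text \<open>The largest possible number of gates of a truth-table circuit on \<open>l\<close> bits.
  With as many inputs, the bound on the gates in \<open>decides_MC\<close> holds for every exponent
  k \<ge> 1.\<close>

definition pad_inputs :: "nat \<Rightarrow> nat" where
  "pad_inputs l = 2 + 2 ^ l * (2 * l + 2)"

text \<open>The answer of \<open>M\<close> already stands on tape 0 in the required form, so both
  continuations halt at once, wherever the head is.\<close>

lemma decider_tester:
  fixes n a b :: nat and M :: tm
  defines "l \<equiv> a * bit_len n"
  defines "A \<equiv> tester_tm M a b pad_com (fin_com True CHalt CHalt)"
  assumes det: "deterministic_tm M"
    and out: "outputs_within M (tester_word a b n (pad_inputs l) Q True) \<tau> v"
  shows "\<exists>t c. t \<le> loop_time a b n (pad_inputs l) (2 ^ l * (80 * l + 120) + 50) +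
      20 * length (tester_word a b n (pad_inputs l) Q True) + 200 + \<tau> \<and>
    tm_steps A Q (init_config A (unary_input n)) t c \<and> halted c \<and> tm_output c = v"
proof -
  let ?r = "run M (\<lambda>_. False) (tester_word a b n (pad_inputs l) Q True) (replicate \<tau> False)"
  have wf: "wf_tm M" using det by (simp add: deterministic_tm_def)
  have r: "halted ?r" "tm_output ?r = v" using out by (auto simp: outputs_within_def Let_def)
  obtain t T s where t: "t \<le> loop_time a b n (pad_inputs l) (2 ^ l * (80 * l + 120) + 50) +
      20 * length (tester_word a b n (pad_inputs l) Q True) + 200 + \<tau>"
    "runs_on M (snd ?r) T"
    "\<And>u T'. reaches M ([if s then CHalt else CHalt], T) u ([CHalt], T') \<Longrightarrow>
      tm_steps A Q (init_config A (unary_input n)) (t + u)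
        (tester_config M a b pad_com (fin_com True CHalt CHalt) ([CHalt], T'))"
    using tester_run[OF det prog_ok_pad _ _ rexec_pad[of M, folded pad_inputs_def] r(1)[unfolded l_def], of CHalt CHalt]
    unfolding A_def l_def by auto
  have "tm_steps A Q (init_config A (unary_input n)) t
      (tester_config M a b pad_com (fin_com True CHalt CHalt) ([CHalt], T))"
    using t(3)[of 0 T] reaches.refl[of M "([CHalt], T)"] by simp
  moreover have "tape_bits (T 0) = v" using runs_on_0[OF t(2) wf] r(2) by (simp add: tm_output_def)
  ultimately show ?thesis using t(1) halted_tester[OF wf] tm_output_tester by blast
qed

lemma approx_tester:
  fixes n a b :: nat and M :: tm
  defines "l \<equiv> a * bit_len n"
  defines "A \<equiv> tester_tm M a b narrow_com
    (fin_com False (CSeq (cseek (-1)) post_com) (CSeq (cseek 1) post_com))"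
  assumes det: "deterministic_tm M"
    and out: "outputs_within M (tester_word a b n l Q False) \<tau> v"
  shows "\<exists>t c. t \<le> loop_time a b n l (10 * l + 20) + 40 * length (tester_word a b n l Q False) +
      20 * \<tau> + 10 * (b * bit_len n) + 300 \<and>
    tm_steps A Q (init_config A (unary_input n)) t c \<and> halted c \<and>
    tm_output c = (if horner_sum of_bool (2::nat) v < 2 ^ (b * bit_len n) then [True] else [])"
proof -
  let ?w = "tester_word a b n l Q False"
  let ?r = "run M (\<lambda>_. False) ?w (replicate \<tau> False)"
  let ?d1 = "CSeq (cseek (-1)) post_com" and ?d2 = "CSeq (cseek 1) post_com"
  let ?j = "b * bit_len n"
  have wf: "wf_tm M" using det by (simp add: deterministic_tm_def)
  have r: "halted ?r" "tm_output ?r = v" using out by (auto simp: outputs_within_def Let_def)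
  obtain t T s where t: "t \<le> loop_time a b n l (10 * l + 20) + 20 * length ?w + 200 + \<tau>"
    "runs_on M (snd ?r) T" "side_ok s (snd ?r)" "T 7 = reg_tape 0 (replicate ?j False)"
    "\<And>u T'. reaches M ([if s then ?d1 else ?d2], T) u ([CHalt], T') \<Longrightarrow>
      tm_steps A Q (init_config A (unary_input n)) (t + u)
        (tester_config M a b narrow_com (fin_com False ?d1 ?d2) ([CHalt], T'))"
    using tester_run[OF det prog_ok_narrow prog_ok_post prog_ok_post rexec_narrow[of M] r(1)[unfolded l_def]]
    unfolding A_def l_def by blast
  obtain f p where fp: "snd ?r ! 0 = (f, p)" by fastforce
  have n0: "0 < ntapes M" using wf by (simp add: wf_tm_def)
  have p: "\<bar>p\<bar> \<le> int \<tau>" using head_bound_run[OF wf n0, of "\<lambda>_. False" ?w "replicate \<tau> False"] fp by simp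
  define N where "N = length ?w + \<tau>"
  have N: "f (int N) \<notin> {1, 2}"
    using tape0_blank[OF wf, of ?w "replicate \<tau> False" "int N" "\<lambda>_. False"] fp by (simp add: N_def)
  have T0: "T 0 = (f, p)" using runs_on_0[OF t(2) wf] fp by simp
  have T15: "T 15 = mark_tape p" using t(2) fp by (simp add: runs_on_def)
  define m where "m = nat \<bar>p\<bar>"
  \<comment> \<open>The search for cell 0 goes in the direction opposite to the side of the
    head.\<close>
  define \<sigma> :: int where "\<sigma> = (if s then -1 else 1)"
  have pm: "p = - \<sigma> * int m" using t(3) by (auto simp: side_ok_def fp \<sigma>_def m_def)
  have "exec M (cseek \<sigma>) T (4 * m + 1) (T(0 := (f, 0), 15 := mark_tape 0))"
    by (rule exec_seek) (use T0 T15 pm in \<open>auto simp: \<sigma>_def\<close>)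
  moreover have "T(0 := (f, 0), 15 := mark_tape 0) = at_pos T f 0 (replicate ?j False)"
    using t(4) by (auto simp: at_pos_def fun_eq_iff)
  ultimately have "exec M (cseek \<sigma>) T (4 * m + 1) (at_pos T f 0 (replicate ?j False))" by simp
  from reaches_seq[OF this] obtain u1 where u1: "u1 \<le> 4 * m + 1 + 1"
    "reaches M ([CSeq (cseek \<sigma>) post_com], T) u1 ([post_com], at_pos T f 0 (replicate ?j False))" by blast
  obtain T' u2 where u2: "u2 \<le> 10 * ?j + 10 * N + 50"
    "reaches M ([post_com], at_pos T f 0 (replicate ?j False)) u2 ([CHalt], T')"
    "tape_bits (T' 0) = (if horner_sum of_bool (2::nat) (tape_bits (f, p)) < 2 ^ ?j then [True] else [])"
    using reaches_post[of f N, OF N, of ?j M "[]" T] by blast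
  have d: "(if s then ?d1 else ?d2) = CSeq (cseek \<sigma>) post_com" by (simp add: \<sigma>_def)
  have "reaches M ([if s then ?d1 else ?d2], T) (u1 + u2) ([CHalt], T')"
    unfolding d by (rule reaches_trans[OF u1(2) u2(2)])
  note st = t(5)[OF this]
  have "tape_bits (f, p) = v" using r(2) fp by (simp add: tm_output_def)
  moreover have "t + (u1 + u2) \<le> loop_time a b n l (10 * l + 20) + 40 * length ?w + 20 * \<tau> + 10 * ?j + 300"
    using t(1) u1(1) u2(1) p by (simp add: m_def N_def)
  ultimately show ?thesis using st u2(3) halted_tester[OF wf] tm_output_tester by metis
qed

section \<open>Polynomial bounds\<close>

text \<open>The base \<open>n + 2\<close> is at least 2 for every \<open>n\<close>, so a single
  exponent absorbs all constants and closure under sums and products needs no case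
  distinction.\<close>

definition poly_bounded :: "(nat \<Rightarrow> nat) \<Rightarrow> bool" where
  "poly_bounded f \<longleftrightarrow> (\<exists>c. \<forall>n. f n \<le> (n + 2) ^ c)"

lemma poly_bounded_mono: "poly_bounded g \<Longrightarrow> (\<And>n. f n \<le> g n) \<Longrightarrow> poly_bounded f"
  unfolding poly_bounded_def by (meson order.trans)

lemma poly_bounded_const [intro]: "poly_bounded (\<lambda>_. k)"
proof -
  have "k \<le> (n + 2) ^ k" for n
    using less_exp[of k] power_mono[of 2 "n + 2" k] by linarith
  then show ?thesis unfolding poly_bounded_def by blast
qed

lemma poly_bounded_id [intro]: "poly_bounded (\<lambda>n. n)"
  unfolding poly_bounded_def by (intro exI[of _ 1]) auto

lemma poly_bounded_mult [intro]:
  assumes "poly_bounded f" "poly_bounded g" shows "poly_bounded (\<lambda>n. f n * g n)"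
proof -
  obtain c d where c: "\<And>n. f n \<le> (n + 2) ^ c" and d: "\<And>n. g n \<le> (n + 2) ^ d"
    using assms by (auto simp: poly_bounded_def)
  have "f n * g n \<le> (n + 2) ^ (c + d)" for n
    unfolding power_add using c[of n] d[of n] by (intro mult_mono) auto
  then show ?thesis unfolding poly_bounded_def by blast
qed

lemma poly_bounded_add [intro]:
  assumes "poly_bounded f" "poly_bounded g" shows "poly_bounded (\<lambda>n. f n + g n)"
proof -
  obtain c d where c: "\<And>n. f n \<le> (n + 2) ^ c" and d: "\<And>n. g n \<le> (n + 2) ^ d"
    using assms by (auto simp: poly_bounded_def)
  have "f n + g n \<le> (n + 2) ^ (c + d + 1)" for n
  proof -
    have "(n + 2) ^ c \<le> (n + 2) ^ (c + d)" "(n + 2) ^ d \<le> (n + 2) ^ (c + d)"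
      by (intro power_increasing; simp)+
    then have "f n + g n \<le> 2 * (n + 2) ^ (c + d)" using c[of n] d[of n] by linarith
    also have "\<dots> \<le> (n + 2) * (n + 2) ^ (c + d)" by (rule mult_right_mono) auto
    finally show ?thesis by simp
  qed
  then show ?thesis unfolding poly_bounded_def by blast
qed

lemma poly_bounded_power [intro]: "poly_bounded f \<Longrightarrow> poly_bounded (\<lambda>n. f n ^ k)"
  by (induction k) (auto simp: poly_bounded_const)

text \<open>This returns to the shape of the time bounds in the definitions, whose additive constant
  takes care of n = 0.\<close>

lemma poly_bounded_standard:
  assumes "poly_bounded f" obtains c where "\<And>n. f n \<le> c * n ^ c + c"
proof -
  obtain d where d: "\<And>n. f n \<le> (n + 2) ^ d" using assms by (auto simp: poly_bounded_def)
  define c where "c = 3 ^ d + d"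
  have "f n \<le> c * n ^ c + c" for n
  proof (cases "n = 0")
    case True
    have "(2::nat) ^ d \<le> 3 ^ d" by (rule power_mono) auto
    then have "f 0 \<le> c" using d[of 0, unfolded add_0] unfolding c_def by linarith
    then show ?thesis using True by simp
  next
    case False
    have "(n + 2) ^ d \<le> (3 * n) ^ d" using False by (intro power_mono) auto
    also have "\<dots> = 3 ^ d * n ^ d" by (rule power_mult_distrib)
    also have "\<dots> \<le> c * n ^ c" using False by (intro mult_mono power_increasing) (auto simp: c_def)
    finally show ?thesis using d[of n] by linarith
  qed
  then show ?thesis by (rule that)
qed

lemma exp_bit_len_le: "2 ^ bit_len n \<le> 2 * n + 1"
proof (cases "bit_len n")
  case (Suc L)
  then have "2 ^ L \<le> n" using bit_len_lower[of L n] by simp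
  then show ?thesis using Suc by simp
qed simp

lemma poly_bounded_bit_len [intro]: "poly_bounded bit_len"
  by (rule poly_bounded_mono[OF poly_bounded_id bit_len_le])

lemma poly_bounded_exp_bit_len [intro]: "poly_bounded (\<lambda>n. 2 ^ (a * bit_len n))"
proof (rule poly_bounded_mono)
  show "poly_bounded (\<lambda>n. (2 * n + 1) ^ a)"
    by (intro poly_bounded_power poly_bounded_add poly_bounded_mult poly_bounded_const poly_bounded_id)
  show "2 ^ (a * bit_len n) \<le> (2 * n + 1) ^ a" for n
    using power_mono[OF exp_bit_len_le[of n], of a] by (simp add: power_mult[symmetric] mult.commute)
qed

lemmas poly_bounded_intros = poly_bounded_power poly_bounded_add poly_bounded_mult poly_bounded_const
  poly_bounded_id poly_bounded_exp_bit_len poly_bounded_bit_len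

section \<open>Polynomial bounds for the tester\<close>

lemma poly_bounded_loop_time:
  "poly_bounded I \<Longrightarrow> poly_bounded t \<Longrightarrow> poly_bounded (\<lambda>n. loop_time a b n (I n) (t n))"
  unfolding loop_time_def Let_def by (intro poly_bounded_intros)

lemma poly_bounded_pad_inputs: "poly_bounded (\<lambda>n. pad_inputs (a * bit_len n))"
  unfolding pad_inputs_def by (intro poly_bounded_intros)

lemma tester_points_props:
  "\<forall>x \<in> set (tester_points a n Q). length x = a * bit_len n" "distinct (tester_points a n Q)"
  "length (tester_points a n Q) \<le> 2 ^ (a * bit_len n)"
  "x \<in> set (tester_points a n Q) \<longleftrightarrow> length x = a * bit_len n \<and> Q (x @ replicate (n - a * bit_len n) False)"
proof -
  have s: "set (tester_points a n Q) = {x \<in> bit_strings (a * bit_len n). Q (x @ replicate (n - a * bit_len n) False)}"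
    by (auto simp: tester_points_def set_all_points)
  show "\<forall>x \<in> set (tester_points a n Q). length x = a * bit_len n"
    "x \<in> set (tester_points a n Q) \<longleftrightarrow> length x = a * bit_len n \<and> Q (x @ replicate (n - a * bit_len n) False)"
    by (auto simp: s bit_strings_def)
  show "distinct (tester_points a n Q)" by (simp add: tester_points_def distinct_all_points)
  show "length (tester_points a n Q) \<le> 2 ^ (a * bit_len n)"
    unfolding tester_points_def by (rule order.trans[OF length_filter_le]) simp
qed

lemma num_gates_tester:
  "num_gates (tt_circuit I (tester_points a n Q)) \<le> pad_inputs (a * bit_len n)"
proof -
  have "num_gates (tt_circuit I (tester_points a n Q)) =
      2 + length (tester_points a n Q) * (2 * (a * bit_len n) + 2)"
    using length_tt_gates[OF tester_points_props(1)] by (simp add: num_gates_def tt_circuit_def)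
  also have "\<dots> \<le> pad_inputs (a * bit_len n)"
    unfolding pad_inputs_def by (intro add_left_mono mult_right_mono tester_points_props(3)) simp
  finally show ?thesis .
qed

lemma wf_tester: "a * bit_len n \<le> I \<Longrightarrow> wf_circuit (tt_circuit I (tester_points a n Q))"
  using tester_points_props(1)[of a n Q] by (intro wf_tt_circuit) auto

definition word_bound :: "nat \<Rightarrow> nat \<Rightarrow> nat \<Rightarrow> nat \<Rightarrow> nat" where
  "word_bound a b n I = (let m = pad_inputs (a * bit_len n) in
     2 * I + 2 * m + 3 + m * (2 * (I + m) + 4) + b * bit_len n)"

lemma length_tester_word:
  assumes "a * bit_len n \<le> I" shows "length (tester_word a b n I Q dec) \<le> word_bound a b n I"
proof -
  define gs where "gs = tt_gates I (tester_points a n Q)"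
  let ?m = "pad_inputs (a * bit_len n)"
  have m: "length gs \<le> ?m" using num_gates_tester[of I a n Q] by (simp add: num_gates_def tt_circuit_def gs_def)
  have "gates_ok I gs" unfolding gs_def
    by (rule gates_ok_tt) (use tester_points_props(1)[of a n Q] assms in auto)
  then have "length (enc_gates gs) \<le> length gs * (2 * (I + length gs) + 4)" by (rule length_enc_gates)
  also have "\<dots> \<le> ?m * (2 * (I + ?m) + 4)" using m by (intro mult_mono) auto
  finally have g: "length (enc_gates gs) \<le> ?m * (2 * (I + ?m) + 4)" .
  have ge: "2 \<le> length gs" using length_tt_gates_ge by (simp add: gs_def)
  have "length (tester_word a b n I Q dec) \<le> I + 1 + (length gs - 2 + 2 + 1 + (length (enc_gates gs) +
      (I + (length gs - 2) + 1 + 1))) + (b * bit_len n + 1)"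
    unfolding tester_word_def enc_tt_circuit gs_def[symmetric]
    by (simp del: un_simps(1,2,4) un_add_numeral)
  also have "\<dots> \<le> word_bound a b n I" unfolding word_bound_def Let_def using g m ge by linarith
  finally show ?thesis .
qed

lemma poly_bounded_word: "poly_bounded I \<Longrightarrow> poly_bounded (\<lambda>n. word_bound a b n (I n))"
  unfolding word_bound_def Let_def by (intro poly_bounded_intros poly_bounded_pad_inputs)

section \<open>Distinguishers contradict pseudorandomness\<close>

lemma finite_bit_strings: "finite (bit_strings n)" and card_bit_strings: "card (bit_strings n) = 2 ^ n"
  using finite_lists_length_eq[of "UNIV :: bool set" n] card_lists_length_eq[of "UNIV :: bool set" n]
  by (simp_all add: bit_strings_def)

lemma bit_strings_nonempty: "bit_strings n \<noteq> {}"
  using card_bit_strings[of n] by (metis card.empty power_not_zero zero_neq_numeral)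

lemma finite_boolean_functions: "finite (boolean_functions n)"
  and card_boolean_functions: "card (boolean_functions n) = 2 ^ 2 ^ n"
  by (simp_all add: boolean_functions_def finite_PiE finite_bit_strings card_PiE card_bit_strings)

lemma boolean_functions_nonempty: "boolean_functions n \<noteq> {}"
  using card_boolean_functions[of n] by (metis card.empty power_not_zero zero_neq_numeral)

lemma tm_steps_halted:
  assumes "tm_steps A Q c t c'" "halted c'" "t \<le> t'" "length coins = t'"
  shows "foldl (step A Q) c coins = c'"
  using tm_steps_trans[OF assms(1) halted_steps[OF assms(2), of A Q "t' - t"]] assms(3,4)
  by (simp add: tm_steps_def)

text \<open>For large n the machine accepts every member of the family and at most half of all
  functions, whatever the coins, so its advantage is at least 1/2.\<close>

lemma no_distinguisher:
  assumes pseudo: "pseudorandom_family f" and wf: "wf_tm A" and bound: "poly_bounded B"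
    and out: "\<And>n g. \<exists>t c. t \<le> B n \<and> tm_steps A (oracle_fun n g) (init_config A (unary_input n)) t c \<and>
      halted c \<and> (tm_output c = [True] \<longleftrightarrow> acc n g)"
    and low: "\<forall>\<^sub>F n in sequentially. \<forall>k \<in> bit_strings n. acc n (f n k)"
    and high: "\<forall>\<^sub>F n in sequentially.
      2 * card {g \<in> boolean_functions n. acc n g} \<le> card (boolean_functions n)"
  shows False
proof -
  obtain c where c: "\<And>n. B n \<le> c * n ^ c + c" using poly_bounded_standard[OF bound] by blast
  define T where "T n = c * n ^ c + c" for n
  have run: "halted (run A (oracle_fun n g) (unary_input n) coins) \<and>
      (tm_output (run A (oracle_fun n g) (unary_input n) coins) = [True] \<longleftrightarrow> acc n g)"
    if "length coins = T n" for n g coins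
  proof -
    obtain t d where d: "t \<le> B n" "tm_steps A (oracle_fun n g) (init_config A (unary_input n)) t d"
      "halted d" "tm_output d = [True] \<longleftrightarrow> acc n g" using out by blast
    have "run A (oracle_fun n g) (unary_input n) coins = d"
      unfolding run_def using tm_steps_halted[OF d(2,3) _ that] d(1) c[of n] by (simp add: T_def)
    then show ?thesis using d(3,4) by simp
  qed
  have "oracle_time_bound A (\<lambda>n. c * n ^ c + c)"
    unfolding oracle_time_bound_def using run by (simp add: T_def)
  then have "negligible (\<lambda>n. advantage A (T n) f n)"
    using pseudo wf by (simp add: pseudorandom_family_def T_def)
  then obtain h :: "nat \<Rightarrow> real" where h: "filterlim h at_top sequentially"
    "\<forall>\<^sub>F n in sequentially. advantage A (T n) f n \<le> real n powr (- h n)"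
    unfolding negligible_def by blast
  have fin: "finite (bit_strings t)" "bit_strings t \<noteq> {}" for t
    using finite_bit_strings bit_strings_nonempty by auto
  have "\<forall>\<^sub>F n in sequentially. accept_prob A (T n) n (map_pmf (f n) (pmf_of_set (bit_strings n))) = 1"
    using low
  proof eventually_elim
    case (elim n)
    have "tm_output (run A (oracle_fun n g) (unary_input n) coins) = [True]"
      if "(g, coins) \<in> set_pmf (pair_pmf (map_pmf (f n) (pmf_of_set (bit_strings n))) (pmf_of_set (bit_strings (T n))))"
      for g coins
    proof -
      have "g \<in> f n ` bit_strings n" "coins \<in> bit_strings (T n)"
        using that fin by (auto simp: set_pmf_of_set)
      then show ?thesis using run[of coins n g] elim by (auto simp: bit_strings_def)
    qed
    then show ?case unfolding accept_prob_def
      by (subst measure_pmf.prob_eq_1) (auto simp: AE_measure_pmf_iff)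
  qed
  moreover have "\<forall>\<^sub>F n in sequentially. accept_prob A (T n) n (pmf_of_set (boolean_functions n)) \<le> 1 / 2"
    using high
  proof eventually_elim
    case (elim n)
    let ?G = "pmf_of_set (boolean_functions n)" and ?C = "pmf_of_set (bit_strings (T n))"
    have set: "coins \<in> bit_strings (T n)" if "(g, coins) \<in> set_pmf (pair_pmf ?G ?C)" for g coins
      using that fin by (auto simp: set_pmf_of_set)
    have "accept_prob A (T n) n ?G \<le> measure_pmf.prob (pair_pmf ?G ?C) (fst -` {g. acc n g})"
      unfolding accept_prob_def
    proof (rule measure_pmf.finite_measure_mono_AE)
      show "AE p in measure_pmf (pair_pmf ?G ?C). p \<in> {(g, coins).
          tm_output (run A (oracle_fun n g) (unary_input n) coins) = [True]} \<longrightarrow> p \<in> fst -` {g. acc n g}"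
        unfolding AE_measure_pmf_iff
      proof (intro ballI impI)
        fix q assume q: "q \<in> set_pmf (pair_pmf ?G ?C)"
          "q \<in> {(g, coins). tm_output (run A (oracle_fun n g) (unary_input n) coins) = [True]}"
        obtain g coins where gc: "q = (g, coins)" by (cases q)
        have "length coins = T n" using set[of g coins] q(1) gc by (simp add: bit_strings_def)
        then show "q \<in> fst -` {g. acc n g}" using run[of coins n g] q(2) gc by simp
      qed
    qed simp
    also have "\<dots> = measure_pmf.prob ?G {g. acc n g}"
      by (subst measure_map_pmf[symmetric]) (simp add: map_fst_pair_pmf)
    also have "\<dots> = card (boolean_functions n \<inter> {g. acc n g}) / card (boolean_functions n)"
      by (rule measure_pmf_of_set[OF boolean_functions_nonempty finite_boolean_functions])
    also have "boolean_functions n \<inter> {g. acc n g} = {g \<in> boolean_functions n. acc n g}" by auto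
    also have "real (card {g \<in> boolean_functions n. acc n g}) / card (boolean_functions n) \<le> 1 / 2"
    proof -
      have "0 < card (boolean_functions n)" by (simp add: card_boolean_functions)
      moreover have "2 * real (card {g \<in> boolean_functions n. acc n g}) \<le> card (boolean_functions n)"
        using elim by linarith
      ultimately show ?thesis by (simp add: field_simps)
    qed
    finally show ?case .
  qed
  ultimately have "\<forall>\<^sub>F n in sequentially. advantage A (T n) f n \<ge> 1 / 2"
    by eventually_elim (simp add: advantage_def)
  moreover have "\<forall>\<^sub>F n in sequentially. h n \<ge> 1"
    using h(1) by (simp add: filterlim_at_top)
  moreover have "\<forall>\<^sub>F n in sequentially. n \<ge> (3::nat)" by (rule eventually_ge_at_top)
  ultimately have "\<forall>\<^sub>F n :: nat in sequentially. False"
    using h(2)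
  proof eventually_elim
    case (elim n)
    have n: "real n \<ge> 3" using elim(3) by simp
    \<comment> \<open>Exponent 1 and n \<ge> 3 already give the bound 1/3, less than the
      advantage.\<close>
    have "real n powr (- h n) \<le> real n powr (- 1)" using elim(2) n by (intro powr_mono) auto
    also have "\<dots> = 1 / real n" using n by (simp add: powr_minus divide_inverse)
    also have "\<dots> \<le> 1 / 3" using n by (intro divide_left_mono) auto
    finally show ?case using elim by linarith
  qed
  then show False by simp
qed

section \<open>Growth of the parameters\<close>

lemma square_le_exp: "4 \<le> L \<Longrightarrow> L ^ 2 \<le> (2::nat) ^ L"
proof (induction L rule: dec_induct)
  case (step L)
  have "4 * L \<le> L ^ 2" using step(1) unfolding power2_eq_square by (intro mult_right_mono) auto
  then have "2 * L + 1 \<le> L ^ 2" using step(1) by linarith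
  then have "Suc L ^ 2 \<le> 2 * L ^ 2" by (simp add: power2_eq_square)
  then show ?case using step by simp
qed simp

lemma eventually_bit_len: "\<forall>\<^sub>F n in sequentially. L \<le> bit_len n"
  using eventually_ge_at_top[of "2 ^ L"]
proof eventually_elim
  case (elim n)
  show ?case
  proof (rule ccontr)
    assume "\<not> L \<le> bit_len n"
    then have "(2::nat) ^ bit_len n \<le> 2 ^ L" by (intro power_increasing) auto
    then show False using bit_len_upper[of n] elim by linarith
  qed
qed

text \<open>For L \<ge> max 4 (2 a) we have 2 a L \<le> L^2 \<le> 2^L, and 2^(L - 1) \<le>
  n.\<close>

lemma eventually_bit_len_le: "\<forall>\<^sub>F n in sequentially. a * bit_len n \<le> n"
  using eventually_bit_len[of "max 4 (2 * a + 1)"]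
proof eventually_elim
  case (elim n)
  define L where "L = bit_len n"
  have L: "4 \<le> L" "2 * a \<le> L" using elim by (auto simp: L_def)
  have "2 * (a * L) \<le> L ^ 2" using mult_right_mono[OF L(2), of L] by (simp add: power2_eq_square)
  also have "\<dots> \<le> 2 ^ L" by (rule square_le_exp[OF L(1)])
  also have "\<dots> = 2 * 2 ^ (L - 1)" using L(1) by (cases L) auto
  finally have "a * L \<le> 2 ^ (L - 1)" by simp
  also have "\<dots> \<le> n" using L(1) by (intro bit_len_lower) (simp add: L_def)
  finally show ?case by (simp add: L_def)
qed

text \<open>The factor 2 in the exponent comes from n + 2 \<le> 2 * 2^L \<le> 4^L.\<close>

lemma power_le_exp_bit_len: "1 \<le> bit_len n \<Longrightarrow> (n + 2) ^ e \<le> 2 ^ (2 * e * bit_len n)"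
proof -
  assume L: "1 \<le> bit_len n"
  have "n + 2 \<le> 2 * 2 ^ bit_len n" using bit_len_upper[of n] L by (cases "bit_len n") auto
  also have "\<dots> \<le> 2 ^ bit_len n * 2 ^ bit_len n" using power_increasing[OF L, of "2::nat"] by (intro mult_right_mono) auto
  finally have "(n + 2) ^ e \<le> (2 ^ bit_len n * 2 ^ bit_len n) ^ e" by (rule power_mono) simp
  also have "\<dots> = 2 ^ (2 * e * bit_len n)"
    by (simp add: power_mult[symmetric] power_add[symmetric] algebra_simps)
  finally show ?thesis .
qed

section \<open>Multiplicative complexity of restrictions\<close>

lemma mult_complexity_cong:
  "(\<And>x. length x = n \<Longrightarrow> f x = g x) \<Longrightarrow> mult_complexity n f = mult_complexity n g"
  unfolding mult_complexity_def computes_def by (metis (mono_tags, lifting))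

lemma take_eq_map_nth: "l \<le> length y \<Longrightarrow> take l y = map ((!) y) [0..<l]"
  by (intro nth_equalityI) auto

lemma circuit_fun_tester:
  assumes "a * bit_len n \<le> n" "a * bit_len n \<le> I" "length y = I"
  shows "circuit_fun (tt_circuit I (tester_points a n (oracle_fun n g))) y =
    g (rev (map ((!) y) [0..<a * bit_len n]) @ replicate (n - a * bit_len n) False)"
proof -
  let ?l = "a * bit_len n"
  have "circuit_fun (tt_circuit I (tester_points a n (oracle_fun n g))) y \<longleftrightarrow>
      rev (take ?l y) \<in> set (tester_points a n (oracle_fun n g))"
    by (rule circuit_fun_tt[OF assms(3,2) tester_points_props(1,2)])
  also have "\<dots> \<longleftrightarrow> g (rev (take ?l y) @ replicate (n - ?l) False)"
    using assms by (simp add: tester_points_props(4) oracle_fun_def)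
  finally show ?thesis using assms take_eq_map_nth[of ?l y] by simp
qed

text \<open>For a fixed key the word \<open>k @ x\<close> consists of constants, input bits and
  zeros, all affine, so the simulation applies. Its cost depends only on the running time for length
  \<open>n\<close>; hence one \<open>e\<close> works for all \<open>a\<close> and all numbers of
  inputs.\<close>

lemma poly_time_low_complexity:
  assumes "poly_time_family f"
  obtains e where "\<And>n a I k. a * bit_len n \<le> n \<Longrightarrow> a * bit_len n \<le> I \<Longrightarrow> k \<in> bit_strings n \<Longrightarrow>
    mult_complexity I (circuit_fun (tt_circuit I (tester_points a n (oracle_fun n (f n k))))) \<le> (n + 2) ^ e"
proof -
  obtain MF c where MF: "deterministic_tm MF"
    "\<And>n k x. k \<in> bit_strings n \<Longrightarrow> x \<in> bit_strings n \<Longrightarrow> outputs_within MF (k @ x) (c * n ^ c + c) [f n k x]"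
    using assms unfolding poly_time_family_def by blast
  have wf: "wf_tm MF" using MF(1) by (simp add: deterministic_tm_def)
  obtain D where D: "\<And>(w :: bool list \<Rightarrow> bool list) N B f T. (\<And>x. length (w x) = N) \<Longrightarrow>
    (\<And>i. i < N \<Longrightarrow> (\<lambda>x. w x ! i) \<in> affine_span B) \<Longrightarrow>
    (\<And>x. outputs_within MF (w x) T [f x]) \<Longrightarrow> f \<in> and_reach B (D * (2 * T + 1) ^ 3)"
    by (rule tm_output_reach[OF wf]) (erule that)
  have "poly_bounded (\<lambda>n. D * (2 * (c * n ^ c + c) + 1) ^ 3)" by (intro poly_bounded_intros)
  then obtain e where e: "\<And>n. D * (2 * (c * n ^ c + c) + 1) ^ 3 \<le> (n + 2) ^ e"
    unfolding poly_bounded_def by blast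
  have "mult_complexity I (circuit_fun (tt_circuit I (tester_points a n (oracle_fun n (f n k))))) \<le> (n + 2) ^ e"
    if l: "a * bit_len n \<le> n" "a * bit_len n \<le> I" and k: "k \<in> bit_strings n" for n a I k
  proof -
    define l where "l = a * bit_len n"
    define w where "w y = k @ rev (map ((!) y) [0..<l]) @ replicate (n - l) False" for y :: "bool list"
    define g where "g y = f n k (rev (map ((!) y) [0..<l]) @ replicate (n - l) False)" for y :: "bool list"
    define B :: "(bool list \<Rightarrow> bool) set" where "B = (\<lambda>i x. x ! i) ` {..<I}"
    have lk: "length k = n" using k by (simp add: bit_strings_def)
    have len: "length (w y) = n + n" for y using l(1) lk by (simp add: w_def l_def)
    have sp: "(\<lambda>y. w y ! i) \<in> affine_span B" if "i < n + n" for i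
    proof -
      consider "i < n" | "n \<le> i" "i < n + l" | "n + l \<le> i" by linarith
      then show ?thesis
      proof cases
        case 1
        then have "(\<lambda>y. w y ! i) = (\<lambda>_. k ! i)" using lk by (simp add: w_def nth_append)
        then show ?thesis by (simp add: affine_span_const)
      next
        case 2
        \<comment> \<open>The bits of a point are the inputs in reverse order.\<close>
        define j where "j = l - Suc (i - n)"
        have j: "j < l" using 2 by (simp add: j_def)
        have "i - n < l" using 2 by linarith
        then have "w y ! i = y ! j" for y using 2 lk j by (simp add: w_def nth_append rev_nth j_def)
        then have "(\<lambda>y. w y ! i) = (\<lambda>x. x ! j)" by (rule ext)
        moreover have "(\<lambda>x. x ! j) \<in> B" unfolding B_def using j l(2) by (intro imageI) (simp add: l_def)
        ultimately show ?thesis by (simp add: affine_span.base)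
      next
        case 3
        then have "\<not> i - n < l" by linarith
        then have "(\<lambda>y. w y ! i) = (\<lambda>_. False)" using 3 lk that by (simp add: w_def nth_append)
        then show ?thesis by (simp add: affine_span_const)
      qed
    qed
    have out: "outputs_within MF (w y) (c * n ^ c + c) [g y]" for y
      unfolding w_def g_def by (rule MF(2)[OF k]) (use l(1) in \<open>simp add: bit_strings_def l_def\<close>)
    have "g \<in> and_reach B (D * (2 * (c * n ^ c + c) + 1) ^ 3)" by (rule D[OF len sp out])
    then have "mult_complexity I g \<le> D * (2 * (c * n ^ c + c) + 1) ^ 3"
      unfolding B_def by (rule mult_complexity_le_reach)
    moreover have "mult_complexity I (circuit_fun (tt_circuit I (tester_points a n (oracle_fun n (f n k))))) =
        mult_complexity I g"
      by (rule mult_complexity_cong) (simp add: circuit_fun_tester[OF l] g_def l_def)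
    ultimately show ?thesis using e[of n] by linarith
  qed
  then show ?thesis by (rule that)
qed

text \<open>A function is determined by its restriction and its values at the other 2^n - 2^l
  points. So the share of functions whose restriction lies in \<open>S\<close> is at most |S| /
  2^(2^l), stated here without division.\<close>

lemma card_restrictions:
  assumes "finite S" and l: "l \<le> n"
  defines "\<Phi> \<equiv> \<lambda>(g :: bool list \<Rightarrow> bool) (y :: bool list). g (rev (map ((!) y) [0..<l]) @ replicate (n - l) False)"
  shows "card {g \<in> boolean_functions n. \<Phi> g \<in> S} * 2 ^ 2 ^ l \<le> card S * card (boolean_functions n)"
proof -
  define Z where "Z = (\<lambda>x. x @ replicate (n - l) False) ` bit_strings l"
  have Z: "Z \<subseteq> bit_strings n" "card Z = 2 ^ l"
  proof -
    show "Z \<subseteq> bit_strings n" using l by (auto simp: Z_def bit_strings_def)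
    have "inj_on (\<lambda>x :: bool list. x @ replicate (n - l) False) (bit_strings l)" by (auto simp: inj_on_def)
    then show "card Z = 2 ^ l" unfolding Z_def by (simp add: card_image card_bit_strings)
  qed
  define R where "R = (bit_strings n - Z) \<rightarrow>\<^sub>E (UNIV :: bool set)"
  have cR: "finite R" "card R = 2 ^ (2 ^ n - 2 ^ l)"
    using Z finite_bit_strings[of n] finite_subset[OF Z(1) finite_bit_strings]
    by (simp_all add: R_def finite_PiE card_PiE card_Diff_subset card_bit_strings)
  let ?X = "{g \<in> boolean_functions n. \<Phi> g \<in> S}"
  let ?F = "\<lambda>g. (\<Phi> g, restrict g (bit_strings n - Z))"
  have "inj_on ?F ?X"
  proof (rule inj_onI)
    fix g g' assume g: "g \<in> ?X" "g' \<in> ?X" and eq: "?F g = ?F g'"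
    have ext: "g \<in> extensional (bit_strings n)" "g' \<in> extensional (bit_strings n)"
      using g by (auto simp: boolean_functions_def PiE_def)
    show "g = g'"
    proof (rule extensionalityI[OF ext])
      fix x assume x: "x \<in> bit_strings n"
      show "g x = g' x"
      proof (cases "x \<in> Z")
        case True
        then obtain y where y: "length y = l" "x = y @ replicate (n - l) False"
          by (auto simp: Z_def bit_strings_def)
        have "rev (map ((!) (rev y)) [0..<l]) = y"
          using y(1) take_eq_map_nth[of l "rev y"] by simp
        then have "\<Phi> g (rev y) = g x" "\<Phi> g' (rev y) = g' x" by (simp_all add: \<Phi>_def y(2))
        then show ?thesis using eq by simp
      next
        case False
        then have "restrict g (bit_strings n - Z) x = restrict g' (bit_strings n - Z) x" using eq by simp
        then show ?thesis using x False by simp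
      qed
    qed
  qed
  moreover have "?F ` ?X \<subseteq> S \<times> R" by (auto simp: R_def)
  ultimately have "card ?X \<le> card (S \<times> R)"
    using assms(1) cR(1) by (intro card_inj_on_le) auto
  then have "card ?X * 2 ^ 2 ^ l \<le> card S * 2 ^ (2 ^ n - 2 ^ l) * 2 ^ 2 ^ l"
    by (intro mult_right_mono) (simp_all add: cR(2) card_cartesian_product)
  also have "\<dots> = card S * 2 ^ (2 ^ n - 2 ^ l + 2 ^ l)" by (simp add: power_add)
  also have "(2::nat) ^ n - 2 ^ l + 2 ^ l = 2 ^ n" using l by simp
  finally show ?thesis by (simp add: card_boolean_functions)
qed

text \<open>Here 2^l = 2^(2 L) s^2. As l \<le> 4 s, the left-hand side is below 64 s^2, and L \<ge>
  3 makes 2^(2 L) at least 64.\<close>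

lemma exponent_bound:
  fixes L b :: nat
  assumes "1 \<le> b" "3 \<le> L"
  defines "s \<equiv> 2 ^ (b * L)" and "l \<equiv> 2 * (b + 1) * L"
  shows "2 * s * (l + s) + l + s + 2 \<le> 2 ^ l"
proof -
  have s: "1 \<le> s" by (simp add: s_def)
  have "(b + 1) * L \<le> 2 * (b * L)" using assms(1) by simp
  also have "\<dots> \<le> 2 * s" using less_exp[of "b * L"] by (simp add: s_def)
  finally have l: "l \<le> 4 * s" by (simp add: l_def)
  have ss: "s \<le> s * s" "1 \<le> s * s" using s by auto
  have "2 * s * (l + s) + l + s + 2 \<le> 2 * s * (4 * s + s) + 4 * s + s + 2"
    using l by (intro add_mono mult_left_mono) auto
  also have "\<dots> = 10 * (s * s) + 5 * s + 2" by (simp add: algebra_simps)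
  also have "\<dots> \<le> 64 * (s * s)" using ss by linarith
  also have "\<dots> \<le> 2 ^ (2 * L) * (s * s)"
  proof (rule mult_right_mono)
    have "(2::nat) ^ (2 * 3) \<le> 2 ^ (2 * L)" using assms(2) by (intro power_increasing) auto
    then show "(64::nat) \<le> 2 ^ (2 * L)" by simp
  qed simp
  also have "\<dots> = 2 ^ l" by (simp add: s_def l_def power_add[symmetric] algebra_simps)
  finally show ?thesis .
qed

text \<open>The count must involve only the \<open>l\<close> relevant inputs: the padded circuit of
  the decision problem has more than 2^l inputs, and counting functions of all of them would exceed
  the number of functions on l bits.\<close>

lemma few_low_complexity:
  fixes n b I :: nat
  defines "a \<equiv> 2 * (b + 1)"
  assumes b: "1 \<le> b" and L: "3 \<le> bit_len n" and l: "a * bit_len n \<le> n" "a * bit_len n \<le> I"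
  shows "2 * card {g \<in> boolean_functions n. mult_complexity I
      (circuit_fun (tt_circuit I (tester_points a n (oracle_fun n g)))) \<le> 2 ^ (b * bit_len n)}
    \<le> card (boolean_functions n)"
proof -
  define l where "l = a * bit_len n"
  define s :: nat where "s = 2 ^ (b * bit_len n)"
  define \<Phi> where "\<Phi> g y = g (rev (map ((!) y) [0..<l]) @ replicate (n - l) False)"
    for g :: "bool list \<Rightarrow> bool" and y :: "bool list"
  define B :: "(bool list \<Rightarrow> bool) set" where "B = (\<lambda>i x. x ! i) ` {..<l}"
  define S where "S = and_reach B s"
  have B: "finite B" "card B \<le> l" using card_image_le[of "{..<l}" "\<lambda>i (x :: bool list). x ! i"] by (auto simp: B_def)
  have finS: "finite S" using card_and_reach[OF B(1)] by (simp add: S_def)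
  have "card S \<le> 2 ^ (2 * s * (card B + s) + card B + s + 1)"
    using card_and_reach[OF B(1), of s] by (simp add: S_def)
  also have "\<dots> \<le> 2 ^ (2 * s * (l + s) + l + s + 1)"
    using B(2) by (intro power_increasing add_mono mult_mono) auto
  \<comment> \<open>The additional factor 2 is what turns the bound into at most half of all
    functions.\<close>
  finally have "2 * card S \<le> 2 ^ (2 * s * (l + s) + l + s + 2)" by simp
  also have "\<dots> \<le> 2 ^ 2 ^ l"
    using exponent_bound[OF b L] unfolding s_def l_def a_def by (intro power_increasing) auto
  finally have cS: "2 * card S \<le> 2 ^ 2 ^ l" .
  let ?mc = "\<lambda>g. mult_complexity I (circuit_fun (tt_circuit I (tester_points a n (oracle_fun n g))))"
  have "\<Phi> g \<in> S" if mc: "?mc g \<le> s" for g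
  proof -
    \<comment> \<open>The inputs beyond \<open>l\<close> are fixed to 0, which costs no conjunction
      and leaves functions over \<open>B\<close>.\<close>
    define \<phi> where "\<phi> y = map (\<lambda>i. i < l \<and> y ! i) [0..<I]" for y :: "bool list"
    have sp: "(\<lambda>y. \<phi> y ! j) \<in> affine_span B" if "j < I" for j
    proof (cases "j < l")
      case True
      then have "(\<lambda>y. \<phi> y ! j) = (\<lambda>x. x ! j)" using that by (simp add: \<phi>_def)
      moreover have "(\<lambda>x. x ! j) \<in> B" unfolding B_def using True by (intro imageI) simp
      ultimately show ?thesis by (simp add: affine_span.base)
    next
      case False
      then have "(\<lambda>y. \<phi> y ! j) = (\<lambda>_. False)" using that by (simp add: \<phi>_def)
      then show ?thesis by (simp add: affine_span_const)
    qed
    have len: "length (\<phi> y) = I" for y by (simp add: \<phi>_def)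
    have "(\<lambda>y. circuit_fun (tt_circuit I (tester_points a n (oracle_fun n g))) (\<phi> y)) \<in> S"
      unfolding S_def
      by (rule and_reach_if_mult_complexity_le[OF wf_tester[OF l(2)] _ mc len sp]) (simp add: tt_circuit_def)
    moreover have "circuit_fun (tt_circuit I (tester_points a n (oracle_fun n g))) (\<phi> y) = \<Phi> g y" for y
    proof -
      have eq: "map ((!) (\<phi> y)) [0..<l] = map ((!) y) [0..<l]" using l(2) by (auto simp: \<phi>_def l_def)
      show ?thesis unfolding \<Phi>_def
        using circuit_fun_tester[OF l len, of g y, folded l_def] unfolding eq .
    qed
    ultimately show ?thesis by simp
  qed
  then have "card {g \<in> boolean_functions n. ?mc g \<le> s} \<le> card {g \<in> boolean_functions n. \<Phi> g \<in> S}"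
    by (intro card_mono) (auto simp: finite_boolean_functions)
  then have "2 * card {g \<in> boolean_functions n. ?mc g \<le> s} * 2 ^ 2 ^ l \<le>
      2 * (card {g \<in> boolean_functions n. \<Phi> g \<in> S} * 2 ^ 2 ^ l)"
    by simp
  also have "\<dots> \<le> 2 * (card S * card (boolean_functions n))"
    using card_restrictions[OF finS, of l n] l(1) by (intro mult_left_mono) (auto simp: \<Phi>_def[abs_def] l_def)
  also have "\<dots> = 2 * card S * card (boolean_functions n)" by simp
  also have "\<dots> \<le> 2 ^ 2 ^ l * card (boolean_functions n)" using cS by (rule mult_right_mono) simp
  finally have "2 * card {g \<in> boolean_functions n. ?mc g \<le> s} * 2 ^ 2 ^ l \<le> card (boolean_functions n) * 2 ^ 2 ^ l"
    by (simp add: mult.commute)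
  then show ?thesis by (simp add: s_def)
qed

section \<open>No deciders and no approximators\<close>

lemma enc_binary_power: "enc_binary (2 ^ j) = replicate j False @ [True]"
proof (induction j)
  case 0
  show ?case by (subst enc_binary.simps) (subst enc_binary.simps, simp)
next
  case (Suc j)
  then show ?case by (subst enc_binary.simps) simp
qed

lemma no_decider:
  assumes pseudo: "pseudorandom_family f" and k: "1 \<le> k" and dec: "decides_MC k M"
  shows False
proof -
  obtain c where det: "deterministic_tm M" and c: "\<And>C s. wf_circuit C \<Longrightarrow> num_gates C \<le> inputs C ^ k + k \<Longrightarrow>
      outputs_within M (enc_circuit C @ enc_binary s) (c * length (enc_circuit C @ enc_binary s) ^ c + c)
        [mult_complexity (inputs C) (circuit_fun C) \<le> s]"
    using dec unfolding decides_MC_def Let_def by blast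
  have wf: "wf_tm M" using det by (simp add: deterministic_tm_def)
  have "poly_time_family f" using pseudo by (simp add: pseudorandom_family_def)
  then obtain e where e: "\<And>n a I k. a * bit_len n \<le> n \<Longrightarrow> a * bit_len n \<le> I \<Longrightarrow> k \<in> bit_strings n \<Longrightarrow>
    mult_complexity I (circuit_fun (tt_circuit I (tester_points a n (oracle_fun n (f n k))))) \<le> (n + 2) ^ e"
    by (rule poly_time_low_complexity) (erule that)
  \<comment> \<open>The part \<open>2 * e\<close> covers the polynomial bound for the family; the
    summand 1 ensures b \<ge> 1 for the counting.\<close>
  define b where "b = 2 * e + 1"
  define a where "a = 2 * (b + 1)"
  define I where "I n = pad_inputs (a * bit_len n)" for n
  define acc where "acc n g \<longleftrightarrow> mult_complexity (I n)
      (circuit_fun (tt_circuit (I n) (tester_points a n (oracle_fun n g)))) \<le> 2 ^ (b * bit_len n)" for n g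
  define A where "A = tester_tm M a b pad_com (fin_com True CHalt CHalt)"
  define W where "W n = word_bound a b n (I n)" for n
  define T where "T n = loop_time a b n (I n) (2 ^ (a * bit_len n) * (80 * (a * bit_len n) + 120) + 50) +
      20 * W n + 200 + (c * W n ^ c + c)" for n
  have Ige: "a * bit_len n \<le> I n" for n
  proof -
    have "a * bit_len n \<le> 1 * (2 * (a * bit_len n) + 2)" by simp
    also have "\<dots> \<le> 2 ^ (a * bit_len n) * (2 * (a * bit_len n) + 2)" by (rule mult_right_mono) auto
    finally show ?thesis by (simp add: I_def pad_inputs_def)
  qed
  show False
  proof (rule no_distinguisher[OF pseudo])
    show "wf_tm A" unfolding A_def
      by (rule wf_tester_tm[OF wf prog_ok_pad prog_ok_fin]) (use wf in auto)
    have pI: "poly_bounded I" unfolding I_def by (rule poly_bounded_pad_inputs)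
    have "poly_bounded W" unfolding W_def by (rule poly_bounded_word[OF pI])
    then show "poly_bounded T" unfolding T_def
      by (intro poly_bounded_intros poly_bounded_loop_time pI)
    show "\<exists>t d. t \<le> T n \<and> tm_steps A (oracle_fun n g) (init_config A (unary_input n)) t d \<and>
      halted d \<and> (tm_output d = [True] \<longleftrightarrow> acc n g)" for n g
    proof -
      let ?C = "tt_circuit (I n) (tester_points a n (oracle_fun n g))"
      let ?w = "tester_word a b n (I n) (oracle_fun n g) True"
      have w: "enc_circuit ?C @ enc_binary (2 ^ (b * bit_len n)) = ?w"
        by (simp add: tester_word_def enc_binary_power)
      have ge1: "1 \<le> I n" by (simp add: I_def pad_inputs_def)
      \<comment> \<open>The padding pays off here: even exponent 1 would admit this circuit.\<close>
      have "num_gates ?C \<le> I n" unfolding I_def by (rule num_gates_tester)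
      also have "\<dots> \<le> I n ^ k + k" using self_le_power[OF ge1, of k] k by simp
      finally have "num_gates ?C \<le> inputs ?C ^ k + k" by (simp add: tt_circuit_def)
      from c[OF wf_tester[OF Ige] this, of "2 ^ (b * bit_len n)"]
      have out: "outputs_within M ?w (c * length ?w ^ c + c) [acc n g]"
        unfolding w acc_def by (simp add: tt_circuit_def)
      obtain t d where td: "t \<le> loop_time a b n (I n) (2 ^ (a * bit_len n) * (80 * (a * bit_len n) + 120) + 50) +
          20 * length ?w + 200 + (c * length ?w ^ c + c)"
        "tm_steps A (oracle_fun n g) (init_config A (unary_input n)) t d" "halted d" "tm_output d = [acc n g]"
        using decider_tester[OF det out[unfolded I_def], folded I_def A_def]
        by (elim exE conjE) (rule that)
      have lw: "length ?w \<le> W n" unfolding W_def by (rule length_tester_word[OF Ige])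
      then have "c * length ?w ^ c \<le> c * W n ^ c" by (intro mult_left_mono power_mono) auto
      then have "t \<le> T n" using td(1) lw unfolding T_def by linarith
      then show ?thesis using td(2-4) by (intro exI[of _ t] exI[of _ d]) auto
    qed
    show "\<forall>\<^sub>F n in sequentially. \<forall>k \<in> bit_strings n. acc n (f n k)"
      using eventually_bit_len_le[of a] eventually_bit_len[of 1]
    proof eventually_elim
      case (elim n)
      have "(n + 2) ^ e \<le> 2 ^ (2 * e * bit_len n)" by (rule power_le_exp_bit_len[OF elim(2)])
      also have "\<dots> \<le> 2 ^ (b * bit_len n)" by (rule power_increasing) (auto simp: b_def)
      finally show ?case using e[OF elim(1) Ige] unfolding acc_def by (meson order.trans)
    qed
    show "\<forall>\<^sub>F n in sequentially. 2 * card {g \<in> boolean_functions n. acc n g} \<le> card (boolean_functions n)"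
      using eventually_bit_len_le[of a] eventually_bit_len[of 3]
    proof eventually_elim
      case (elim n)
      show ?case unfolding acc_def
        using few_low_complexity[of b n "I n"] elim Ige[of n] by (simp add: b_def a_def)
    qed
  qed
qed

text \<open>Only an inequality, because for x = 0 and m = 0 the left side is 0 and the right side is
  1; base 0 does occur, namely for \<epsilon> = 2.\<close>

lemma powr_le_power: "0 \<le> (x::real) \<Longrightarrow> x powr real m \<le> x ^ m"
  by (cases "x = 0") (auto simp: powr_realpow)

lemma no_approximator:
  assumes pseudo: "pseudorandom_family f" and \<epsilon>: "0 < \<epsilon>" "\<epsilon> \<le> 2" and appr: "approximates_MC \<epsilon> M"
  shows False
proof -
  obtain c where det: "deterministic_tm M" and c: "\<And>C. wf_circuit C \<Longrightarrow>
      \<exists>v. outputs_within M (enc_circuit C) ((c * num_gates C ^ c + c) * 2 ^ (c * inputs C)) v \<and>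
        real (horner_sum of_bool 2 v) \<in> {real (mult_complexity (inputs C) (circuit_fun C)) ..
          (2 - \<epsilon>) powr (real (inputs C) / 2) * real (mult_complexity (inputs C) (circuit_fun C))}"
    using appr unfolding approximates_MC_def Let_def by blast
  have wf: "wf_tm M" using det by (simp add: deterministic_tm_def)
  have "poly_time_family f" using pseudo by (simp add: pseudorandom_family_def)
  then obtain e where e: "\<And>n a I k. a * bit_len n \<le> n \<Longrightarrow> a * bit_len n \<le> I \<Longrightarrow> k \<in> bit_strings n \<Longrightarrow>
    mult_complexity I (circuit_fun (tt_circuit I (tester_points a n (oracle_fun n (f n k))))) \<le> (n + 2) ^ e"
    by (rule poly_time_low_complexity) (erule that)
  define \<beta> where "\<beta> = 2 - \<epsilon>"
  have \<beta>: "0 \<le> \<beta>" "\<beta> < 2" using \<epsilon> by (auto simp: \<beta>_def)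
  \<comment> \<open>This is the comparison of \<beta>^(l / 2) * 2^(2 e L) with 2^(b L), with the
    common exponent L removed. Since \<beta> / 2 < 1, any fixed factor is eventually
    outweighed.\<close>
  obtain b where b: "1 \<le> b" "\<beta> ^ (b + 1) * 2 ^ (2 * e) < 2 ^ b"
  proof -
    have "(\<lambda>b. (\<beta> / 2) ^ b) \<longlonglongrightarrow> 0" using \<beta> by (intro LIMSEQ_realpow_zero) auto
    then have "\<forall>\<^sub>F b in sequentially. (\<beta> / 2) ^ b < 1 / 2 ^ (2 * e + 1)"
      by (rule order_tendstoD) simp
    then obtain N where N: "\<And>b. b \<ge> N \<Longrightarrow> (\<beta> / 2) ^ b < 1 / 2 ^ (2 * e + 1)"
      by (auto simp: eventually_sequentially)
    have "(\<beta> / 2) ^ (N + 2) < 1 / 2 ^ (2 * e + 1)" by (rule N) simp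
    then have "\<beta> ^ (N + 1 + 1) * 2 ^ (2 * e) < 2 ^ (N + 1)"
      by (simp add: power_divide field_simps)
    then show ?thesis by (intro that[of "N + 1"]) auto
  qed
  define a where "a = 2 * (b + 1)"
  define l where "l n = a * bit_len n" for n
  define C where "C n g = tt_circuit (l n) (tester_points a n (oracle_fun n g))" for n g
  define mc where "mc n g = mult_complexity (l n) (circuit_fun (C n g))" for n g
  define \<tau> where "\<tau> n g = (c * num_gates (C n g) ^ c + c) * 2 ^ (c * l n)" for n g
  have wfC: "wf_circuit (C n g)" for n g unfolding C_def l_def by (rule wf_tester) simp
  have inC: "inputs (C n g) = l n" for n g by (simp add: C_def tt_circuit_def)
  have "\<forall>n g. \<exists>v. outputs_within M (enc_circuit (C n g)) (\<tau> n g) v \<and>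
      real (mc n g) \<le> real (horner_sum of_bool 2 v) \<and>
      real (horner_sum of_bool 2 v) \<le> \<beta> powr (real (l n) / 2) * real (mc n g)"
    using c[OF wfC] unfolding inC \<tau>_def mc_def \<beta>_def by simp
  then obtain v where v: "\<And>n g. outputs_within M (enc_circuit (C n g)) (\<tau> n g) (v n g)"
      "\<And>n g. real (mc n g) \<le> real (horner_sum of_bool 2 (v n g))"
      "\<And>n g. real (horner_sum of_bool 2 (v n g)) \<le> \<beta> powr (real (l n) / 2) * real (mc n g)"
    by metis
  \<comment> \<open>Acceptance refers to the value put out by \<open>M\<close>, which between the
    two bounds may be anything; the upper bound is used for the family, the lower one for random
    functions.\<close>
  define acc where "acc n g \<longleftrightarrow> horner_sum of_bool (2::nat) (v n g) < 2 ^ (b * bit_len n)" for n g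
  let ?d1 = "CSeq (cseek (-1)) post_com" and ?d2 = "CSeq (cseek 1) post_com"
  define A where "A = tester_tm M a b narrow_com (fin_com False ?d1 ?d2)"
  define W where "W n = word_bound a b n (l n)" for n
  define P where "P n = (c * pad_inputs (a * bit_len n) ^ c + c) * 2 ^ (c * a * bit_len n)" for n
  define T where "T n = loop_time a b n (l n) (10 * l n + 20) + 40 * W n + 20 * P n + 10 * (b * bit_len n) + 300" for n
  show False
  proof (rule no_distinguisher[OF pseudo])
    show "wf_tm A" unfolding A_def
      by (rule wf_tester_tm[OF wf prog_ok_narrow prog_ok_fin[OF wf prog_ok_post prog_ok_post]])
    have pl: "poly_bounded l" unfolding l_def by (intro poly_bounded_intros)
    have pW: "poly_bounded W" unfolding W_def by (rule poly_bounded_word[OF pl])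
    have pP: "poly_bounded P" unfolding P_def by (intro poly_bounded_intros poly_bounded_pad_inputs)
    show "poly_bounded T" unfolding T_def
      by (intro poly_bounded_add poly_bounded_mult poly_bounded_const poly_bounded_bit_len
          poly_bounded_loop_time pl pW pP)
    show "\<exists>t d. t \<le> T n \<and> tm_steps A (oracle_fun n g) (init_config A (unary_input n)) t d \<and>
      halted d \<and> (tm_output d = [True] \<longleftrightarrow> acc n g)" for n g
    proof -
      let ?w = "tester_word a b n (l n) (oracle_fun n g) False"
      have w: "enc_circuit (C n g) = ?w" by (simp add: tester_word_def C_def)
      have out: "outputs_within M ?w (\<tau> n g) (v n g)" using v(1)[of n g] unfolding w .
      obtain t d where td: "t \<le> loop_time a b n (l n) (10 * l n + 20) + 40 * length ?w +
          20 * \<tau> n g + 10 * (b * bit_len n) + 300"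
        "tm_steps A (oracle_fun n g) (init_config A (unary_input n)) t d" "halted d"
        "tm_output d = (if horner_sum of_bool (2::nat) (v n g) < 2 ^ (b * bit_len n) then [True] else [])"
        using approx_tester[OF det out[unfolded l_def], folded l_def A_def]
        by (elim exE conjE) (rule that)
      have lw: "length ?w \<le> W n" unfolding W_def by (rule length_tester_word) (simp add: l_def)
      have "num_gates (C n g) \<le> pad_inputs (a * bit_len n)" unfolding C_def by (rule num_gates_tester)
      then have "\<tau> n g \<le> P n" unfolding \<tau>_def P_def l_def
        by (intro mult_mono add_mono power_mono) (auto simp: mult.assoc)
      then have "t \<le> T n" using td(1) lw unfolding T_def by linarith
      then show ?thesis using td(2-4) by (intro exI[of _ t] exI[of _ d]) (auto simp: acc_def)
    qed
    show "\<forall>\<^sub>F n in sequentially. \<forall>k \<in> bit_strings n. acc n (f n k)"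
      using eventually_bit_len_le[of a] eventually_bit_len[of 1]
    proof eventually_elim
      case (elim n)
      define L where "L = bit_len n"
      have L: "1 \<le> L" using elim(2) by (simp add: L_def)
      show ?case
      proof
        fix k assume k: "k \<in> bit_strings n"
        have "mc n (f n k) \<le> (n + 2) ^ e" unfolding mc_def C_def
          by (rule e[OF elim(1) _ k]) (simp add: l_def)
        also have "\<dots> \<le> 2 ^ (2 * e * L)" unfolding L_def by (rule power_le_exp_bit_len[OF elim(2)])
        finally have "real (mc n (f n k)) \<le> real (2 ^ (2 * e * L))" by (rule of_nat_mono)
        then have m: "real (mc n (f n k)) \<le> (2 ^ (2 * e)) ^ L" by (simp add: power_mult)
        \<comment> \<open>The even factor in \<open>a\<close> makes half of \<open>l n\<close> an
          integer, so real powers become ordinary ones.\<close>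
        have "real (l n) / 2 = real ((b + 1) * L)" by (simp add: l_def a_def L_def)
        then have p: "\<beta> powr (real (l n) / 2) \<le> (\<beta> ^ (b + 1)) ^ L"
          using powr_le_power[OF \<beta>(1), of "(b + 1) * L"] unfolding power_mult by (simp only:)
        have "real (horner_sum of_bool 2 (v n (f n k))) \<le> \<beta> powr (real (l n) / 2) * real (mc n (f n k))"
          by (rule v(3))
        also have "\<dots> \<le> (\<beta> ^ (b + 1)) ^ L * (2 ^ (2 * e)) ^ L"
          using p m \<beta>(1) by (intro mult_mono) auto
        also have "\<dots> = (\<beta> ^ (b + 1) * 2 ^ (2 * e)) ^ L" by (simp only: power_mult_distrib)
        also have "\<dots> < (2 ^ b) ^ L" using b(2) \<beta>(1) L by (intro power_strict_mono) auto
        also have "\<dots> = real (2 ^ (b * L))" by (simp add: power_mult)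
        finally show "acc n (f n k)" unfolding acc_def L_def by (simp only: of_nat_less_iff)
      qed
    qed
    show "\<forall>\<^sub>F n in sequentially. 2 * card {g \<in> boolean_functions n. acc n g} \<le> card (boolean_functions n)"
      using eventually_bit_len_le[of a] eventually_bit_len[of 3]
    proof eventually_elim
      case (elim n)
      \<comment> \<open>The output is never below the true complexity, so acceptance implies low
        complexity.\<close>
      have "mc n g \<le> 2 ^ (b * bit_len n)" if "acc n g" for g
        using v(2)[of n g] that unfolding acc_def by linarith
      then have "card {g \<in> boolean_functions n. acc n g} \<le>
          card {g \<in> boolean_functions n. mc n g \<le> 2 ^ (b * bit_len n)}"
        by (intro card_mono) (auto simp: finite_boolean_functions)
      moreover have "2 * card {g \<in> boolean_functions n. mc n g \<le> 2 ^ (b * bit_len n)} \<le> card (boolean_functions n)"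
        using few_low_complexity[of b n "l n"] b(1) elim unfolding mc_def C_def by (simp add: a_def l_def)
      ultimately show ?case by linarith
    qed
  qed
qed

theorem theorem5:
  assumes "\<exists>f. pseudorandom_family f"
  shows "(\<forall>k \<ge> 1. \<not> (\<exists>M. decides_MC k M)) \<and>
         (\<forall>\<epsilon>. 0 < \<epsilon> \<and> \<epsilon> \<le> 2 \<longrightarrow> \<not> (\<exists>M. approximates_MC \<epsilon> M))"
  using assms no_decider no_approximator by metis

end
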